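(* Let $\lambda,r,\nu>0$. For any $u\in B^r_{\nu,\lambda}(\mathbb R^+)$ with $0\le s\le r\le N$, we have $$\big\|{}_xD_\infty^{s,\lambda}\{\Pi_N^{\nu,\lambda}u-u\}\big\|_{\omega^{\nu+s}}\le c\,(2\lambda N)^{\frac{s-r}{2}}\,\big\|{}_xD_\infty^{r,\lambda}u\big\|_{\omega^{\nu+r}},$$ where $c\approx 1$ for large $N$.
   Context: Here $N$ is a positive integer, $s$ is real, and $\mathbb R^+=(0,\infty)$. For real $a$, $\omega^a(x)=x^a$ on $\mathbb R^+$; $(f,g)_{\omega}=\int_0^\infty f\,\bar g\,\omega\,dx$, $\|f\|_\omega^2=(f,f)_\omega$, and $L^2_\omega(\mathbb R^+)$ is the corresponding weighted $L^2$ space. Right fractional operators: for $\mu>0$, ${}_xI_\infty^{\mu}u(x)=\frac1{\Gamma(\mu)}\int_x^\infty (y-x)^{\mu-1}u(y)\,dy$; for $\mu\in[k-1,k)$ with $k$ a positive integer, ${}_xD_\infty^{\mu}u=(-1)^k\frac{d^k}{dx^k}\,{}_xI_\infty^{k-\mu}u$ (so order $0$ is the identity). The right tempered fractional derivative is ${}_xD_\infty^{\mu,\lambda}u(x)=e^{\lambda x}\,{}_xD_\infty^{\mu}\{e^{-\lambda x}u(x)\}$. The weighted space is $$B^r_{\nu,\lambda}(\mathbb R^+)=\{u\in L^2_{\omega^{\nu}}(\mathbb R^+):\ {}_xD_\infty^{s,\lambda}u\in L^2_{\omega^{\nu+s}}(\mathbb R^+),\ 0\le s\le r\}.$$ With $\mathcal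 P_N$ the polynomials of degree at most $N$, $\mathcal F_N^{0,\lambda}(\mathbb R^+)=\{e^{-\lambda x}p(x):p\in\mathcal P_N\}$. The orthogonal projection $\Pi_N^{\nu,\lambda}:L^2_{\omega^{\nu}}(\mathbb R^+)\to\mathcal F_N^{0,\lambda}(\mathbb R^+)$ is defined by $(\Pi_N^{\nu,\lambda}u-u,\phi)_{\omega^{\nu}}=0$ for all $\phi\in\mathcal F_N^{0,\lambda}(\mathbb R^+)$. *)

theory Defs
  imports "HOL-Analysis.Analysis" "HOL-Computational_Algebra.Polynomial"
begin

text \<open>
  Functions on the half-line are total functions \<open>real \<Rightarrow> complex\<close>; only their values on
  \<open>{0<..}\<close> matter, up to null sets.
\<close>

definition wL2 :: "real \<Rightarrow> (real \<Rightarrow> complex) set" where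
  "wL2 a = {f. set_borel_measurable lebesgue {0<..} f \<and>
               set_integrable lebesgue {0<..} (\<lambda>x. (cmod (f x))\<^sup>2 * x powr a)}"

definition winner :: "real \<Rightarrow> (real \<Rightarrow> complex) \<Rightarrow> (real \<Rightarrow> complex) \<Rightarrow> complex" where
  "winner a f g = (LINT x:{0<..}|lebesgue. f x * cnj (g x) * complex_of_real (x powr a))"

definition wnorm :: "real \<Rightarrow> (real \<Rightarrow> complex) \<Rightarrow> real" where
  "wnorm a f = sqrt (Re (winner a f f))"

text \<open>
  Derivatives are taken in the Sobolev sense on \<open>{0<..}\<close>: \<open>f\<close> agrees almost everywhere with a
  locally absolutely continuous function \<open>F\<close>, and \<open>g\<close> is the almost-everywhere derivative of
  \<open>F\<close>. Absolute continuity is expressed by the fundamental theorem of calculus. A mere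
  almost-everywhere derivative would not do: it annihilates singular functions.
\<close>

definition has_ac_deriv :: "(real \<Rightarrow> complex) \<Rightarrow> (real \<Rightarrow> complex) \<Rightarrow> bool" where
  "has_ac_deriv f g \<longleftrightarrow>
     (\<forall>a b. 0 < a \<longrightarrow> a \<le> b \<longrightarrow> set_integrable lebesgue {a..b} g) \<and>
     (\<exists>F. (AE x in lebesgue. 0 < x \<longrightarrow> f x = F x) \<and>
          (\<forall>a b. 0 < a \<longrightarrow> a \<le> b \<longrightarrow> F b - F a = (LINT x:{a..b}|lebesgue. g x)))"

fun has_ac_derivs :: "nat \<Rightarrow> (real \<Rightarrow> complex) \<Rightarrow> (real \<Rightarrow> complex) \<Rightarrow> bool" where
  "has_ac_derivs 0 f g \<longleftrightarrow> (AE x in lebesgue. 0 < x \<longrightarrow> f x = g x)"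
| "has_ac_derivs (Suc k) f g \<longleftrightarrow> (\<exists>h. has_ac_deriv f h \<and> has_ac_derivs k h g)"

definition rfrac_integral :: "real \<Rightarrow> (real \<Rightarrow> complex) \<Rightarrow> real \<Rightarrow> complex" where
  "rfrac_integral \<mu> u x =
     (1 / Gamma \<mu>) *\<^sub>R (LINT y:{x<..}|lebesgue. (y - x) powr (\<mu> - 1) *\<^sub>R u y)"

definition rfrac_integral_exists :: "real \<Rightarrow> (real \<Rightarrow> complex) \<Rightarrow> bool" where
  "rfrac_integral_exists \<mu> u \<longleftrightarrow>
     (AE x in lebesgue. 0 < x \<longrightarrow>
        set_integrable lebesgue {x<..} (\<lambda>y. (y - x) powr (\<mu> - 1) *\<^sub>R u y))"

text \<open>The integer \<open>k \<ge> 1\<close> with \<open>k - 1 \<le> \<mu> < k\<close>, for \<open>\<mu> \<ge> 0\<close>.\<close>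

definition frac_ord :: "real \<Rightarrow> nat" where
  "frac_ord \<mu> = nat \<lfloor>\<mu>\<rfloor> + 1"

definition has_rfrac_deriv :: "real \<Rightarrow> (real \<Rightarrow> complex) \<Rightarrow> (real \<Rightarrow> complex) \<Rightarrow> bool" where
  "has_rfrac_deriv \<mu> u g \<longleftrightarrow> (let k = frac_ord \<mu> in
     rfrac_integral_exists (real k - \<mu>) u \<and>
     has_ac_derivs k (rfrac_integral (real k - \<mu>) u) (\<lambda>x. (-1) ^ k * g x))"

text \<open>
  The derivative is determined only almost everywhere, so a representative is chosen; when none
  exists the value is meaningless, and existence is always stated separately.
\<close>

definition rfrac_deriv :: "real \<Rightarrow> (real \<Rightarrow> complex) \<Rightarrow> real \<Rightarrow> complex" where
  "rfrac_deriv \<mu> u = (SOME g. has_rfrac_deriv \<mu> u g)"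

definition temp_deriv :: "real \<Rightarrow> real \<Rightarrow> (real \<Rightarrow> complex) \<Rightarrow> real \<Rightarrow> complex" where
  "temp_deriv \<mu> lam u = (\<lambda>x. exp (lam * x) *\<^sub>R rfrac_deriv \<mu> (\<lambda>y. exp (- lam * y) *\<^sub>R u y) x)"

definition temp_differentiable :: "real \<Rightarrow> real \<Rightarrow> (real \<Rightarrow> complex) \<Rightarrow> bool" where
  "temp_differentiable \<mu> lam u \<longleftrightarrow> (\<exists>g. has_rfrac_deriv \<mu> (\<lambda>y. exp (- lam * y) *\<^sub>R u y) g)"

definition temp_space :: "real \<Rightarrow> real \<Rightarrow> real \<Rightarrow> (real \<Rightarrow> complex) set" where
  "temp_space r \<nu> lam = {u \<in> wL2 \<nu>. \<forall>s. 0 \<le> s \<and> s \<le> r \<longrightarrow>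
      temp_differentiable s lam u \<and> temp_deriv s lam u \<in> wL2 (\<nu> + s)}"

definition exp_polys :: "nat \<Rightarrow> real \<Rightarrow> (real \<Rightarrow> complex) set" where
  "exp_polys N lam =
     {\<lambda>x. exp (- lam * x) *\<^sub>R poly p (complex_of_real x) | p. degree p \<le> N}"

definition temp_proj :: "nat \<Rightarrow> real \<Rightarrow> real \<Rightarrow> (real \<Rightarrow> complex) \<Rightarrow> real \<Rightarrow> complex" where
  "temp_proj N \<nu> lam u = (THE q. q \<in> exp_polys N lam \<and>
     (\<forall>\<phi>\<in>exp_polys N lam. winner \<nu> (\<lambda>x. q x - u x) \<phi> = 0))"

lemma has_rfrac_deriv_0:
  assumes "\<And>x. 0 < x \<Longrightarrow> set_integrable lebesgue {x<..} u"
  shows "has_rfrac_deriv 0 u u"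
proof -
  have I: "rfrac_integral 1 u x = (LINT y:{x<..}|lebesgue. u y)" for x
  proof -
    have "(LINT y:{x<..}|lebesgue. (y - x) powr (1 - 1) *\<^sub>R u y) = (LINT y:{x<..}|lebesgue. u y)"
      unfolding set_lebesgue_integral_def
      by (rule Bochner_Integration.integral_cong) (simp_all add: indicator_def)
    then show ?thesis by (simp add: rfrac_integral_def)
  qed
  have E: "set_integrable lebesgue {x<..} (\<lambda>y. (y - x) powr 0 *\<^sub>R u y)
           \<longleftrightarrow> set_integrable lebesgue {x<..} u" for x
    unfolding set_integrable_def
    by (rule Bochner_Integration.integrable_cong) (simp_all add: indicator_def)
  have sub: "set_integrable lebesgue {a..b} u" if "0 < a" for a b
    by (rule set_integrable_subset[OF assms[of "a/2"]]) (use that in auto)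
  have split: "(LINT y:{b<..}|lebesgue. u y) = (LINT y:{a<..}|lebesgue. u y) - (LINT y:{a..b}|lebesgue. u y)"
    if "0 < a" "a \<le> b" for a b
  proof -
    have "(LINT y:{a<..}|lebesgue. u y) = (LINT y:{a<..b} \<union> {b<..}|lebesgue. u y)"
      using that by (intro arg_cong[where f="\<lambda>A. set_lebesgue_integral lebesgue A u"]) auto
    also have "\<dots> = (LINT y:{a<..b}|lebesgue. u y) + (LINT y:{b<..}|lebesgue. u y)"
      using that
      by (intro set_integral_Un set_integrable_subset[OF assms[of a]]) auto
    also have "(LINT y:{a<..b}|lebesgue. u y) = (LINT y:{a..b}|lebesgue. u y)"
      unfolding set_lebesgue_integral_def
    proof (rule integral_cong_AE)
      have m: "(\<lambda>x. indicat_real {a..b} x *\<^sub>R u x) \<in> borel_measurable lebesgue"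
        using sub[of a b] that by (auto simp: set_integrable_def)
      then show "(\<lambda>x. indicat_real {a..b} x *\<^sub>R u x) \<in> borel_measurable lebesgue" .
      have "set_integrable lebesgue {a<..b} u"
        by (rule set_integrable_subset[OF assms[of a]]) (use that in auto)
      then show "(\<lambda>x. indicat_real {a<..b} x *\<^sub>R u x) \<in> borel_measurable lebesgue"
        by (auto simp: set_integrable_def)
      have "AE x in lebesgue. x \<noteq> a"
        by (rule AE_I[where N="{a}"]) auto
      then show "AE x in lebesgue. indicat_real {a<..b} x *\<^sub>R u x = indicat_real {a..b} x *\<^sub>R u x"
        by eventually_elim (auto simp: indicator_def)
    qed
    finally show ?thesis by simp
  qed
  have neg: "(LINT y:{a..b}|lebesgue. - u y) = - (LINT y:{a..b}|lebesgue. u y)" for a b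
    unfolding set_lebesgue_integral_def by simp
  have int: "set_integrable lebesgue {a..b} (\<lambda>y. - u y)" if "0 < a" for a b
    using sub[OF that] unfolding set_integrable_def by simp
  have ftc: "rfrac_integral 1 u b - rfrac_integral 1 u a = (LINT y:{a..b}|lebesgue. - u y)"
    if "0 < a" "a \<le> b" for a b
    unfolding I neg using split[OF that] by simp
  have "has_ac_deriv (rfrac_integral 1 u) (\<lambda>x. - u x)"
    unfolding has_ac_deriv_def
    by (intro conjI exI[of _ "rfrac_integral 1 u"]) (simp_all add: int ftc)
  moreover have "rfrac_integral_exists 1 u"
    unfolding rfrac_integral_exists_def diff_self E
    by (intro AE_I2 impI assms)
  ultimately show ?thesis
    by (auto simp: has_rfrac_deriv_def frac_ord_def)
qed

end

theory Submission
  imports Defs "HOL-Computational_Algebra.Fundamental_Theorem_Algebra"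
begin

text \<open>
  For every order \<open>s \<ge> 0\<close> the Laguerre functions \<open>exp (- lam x) L\<^sub>n(2 lam x)\<close> with parameter
  \<open>\<nu> + s\<close> are a complete orthogonal system of the space with weight \<open>x powr (\<nu> + s)\<close>, and the tempered
  derivative of order \<open>s\<close> carries the system with parameter \<open>\<nu>\<close> to the one with parameter \<open>\<nu> + s\<close>,
  up to constant factors. With a suitable normalisation the Laguerre coefficients \<open>c\<^sub>n\<close> of the derivative of
  \<open>u\<close> therefore do not depend on \<open>s\<close>, and the squared norm of the derivative is the sum of
  \<open>\<bar>c\<^sub>n\<bar>\<^sup>2 (2 lam) powr (\<nu> + s + 1) \<Gamma>(n + \<nu> + s + 1) / n!\<close>. The projection error has the
  coefficients \<open>0\<close> for \<open>n \<le> N\<close> and \<open>- c\<^sub>n\<close> for \<open>n > N\<close>. Comparing the series for the orders \<open>s\<close> and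
  \<open>r\<close> term by term gives the estimate: the quotient
  \<open>(2 lam) powr (s - r) \<Gamma>(n + \<nu> + s + 1) / \<Gamma>(n + \<nu> + r + 1)\<close> of the weights
  decreases in \<open>n\<close>, so its value at \<open>n = N + 1\<close> bounds it, and this value is asymptotic to
  \<open>(2 lam N) powr (s - r)\<close>.

  The delicate point is that the coefficients are independent of \<open>s\<close> for an arbitrary \<open>u\<close> of the space. An
  integration by parts would need boundary values. Instead, a Laguerre coefficient is a combination of
  moments, and a moment is, up to a Gamma factor, a right fractional integral evaluated at \<open>0\<close>. If
  \<open>exp (- lam x) u\<close> is the fractional integral of order \<open>s\<close> of \<open>g\<close>, then the semigroup law for fractional
  integrals, read at the base point \<open>0\<close>, converts the moments of one function into those of the other
  (\<open>rfrac_integral_semigroup\<close>, \<open>winner_fracI_lagfun\<close>). That a function is the fractional integral of its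
  fractional derivative holds up to a polynomial of integration constants; decay at infinity forces this
  polynomial to vanish (\<open>has_rfrac_deriv_imp_eq_fracI\<close>).

  For the order \<open>r\<close> Bessel's inequality suffices. For the order \<open>s\<close> the norm must be bounded by its
  coefficients, which needs completeness of the Laguerre functions (\<open>exp_polys_dense\<close>).
\<close>

section \<open>Bessel's inequality and completeness for orthogonal systems\<close>

definition L2 :: "'a measure \<Rightarrow> ('a \<Rightarrow> complex) set" where
  "L2 M = {f. f \<in> borel_measurable M \<and> integrable M (\<lambda>x. (cmod (f x))\<^sup>2)}"

definition sq_norm :: "'a measure \<Rightarrow> ('a \<Rightarrow> complex) \<Rightarrow> real" where
  "sq_norm M f = (\<integral>x. (cmod (f x))\<^sup>2 \<partial>M)"

definition L2_inner :: "'a measure \<Rightarrow> ('a \<Rightarrow> complex) \<Rightarrow> ('a \<Rightarrow> complex) \<Rightarrow> complex" where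
  "L2_inner M f g = (\<integral>x. f x * cnj (g x) \<partial>M)"

lemma sq_norm_nonneg: "sq_norm M f \<ge> 0" by (simp add: sq_norm_def)

lemma L2_measurable [measurable_dest]: "f \<in> L2 M \<Longrightarrow> f \<in> borel_measurable M"
  by (simp add: L2_def)

lemma L2_mult_integrable:
  assumes "f \<in> L2 M" "g \<in> L2 M"
  shows "integrable M (\<lambda>x. f x * cnj (g x))"
proof (rule Bochner_Integration.integrable_bound)
  show "integrable M (\<lambda>x. (cmod (f x))\<^sup>2 + (cmod (g x))\<^sup>2)"
    using assms by (auto simp: L2_def)
  have "cnj \<in> borel_measurable borel"
    by (intro borel_measurable_continuous_onI continuous_intros)
  with assms show "(\<lambda>x. f x * cnj (g x)) \<in> borel_measurable M"
    by (auto simp: L2_def)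
  show "AE x in M. norm (f x * cnj (g x)) \<le> norm ((cmod (f x))\<^sup>2 + (cmod (g x))\<^sup>2)"
  proof (rule AE_I2)
    fix x
    have "0 \<le> (cmod (f x) - cmod (g x))\<^sup>2" by simp
    moreover have "0 \<le> cmod (f x) * cmod (g x)" by simp
    ultimately have "cmod (f x) * cmod (g x) \<le> (cmod (f x))\<^sup>2 + (cmod (g x))\<^sup>2"
      unfolding power2_diff by linarith
    then show "norm (f x * cnj (g x)) \<le> norm ((cmod (f x))\<^sup>2 + (cmod (g x))\<^sup>2)"
      by (simp add: norm_mult)
  qed
qed

lemma cmod_add_square_le: "(cmod (a + b))\<^sup>2 \<le> 2 * (cmod a)\<^sup>2 + 2 * (cmod b)\<^sup>2"
proof -
  have "(cmod (a + b))\<^sup>2 \<le> (cmod a + cmod b)\<^sup>2"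
    by (intro power_mono norm_triangle_ineq) auto
  also have "\<dots> \<le> 2 * (cmod a)\<^sup>2 + 2 * (cmod b)\<^sup>2"
    using zero_le_power2[of "cmod a - cmod b"] by (simp add: power2_eq_square field_simps)
  finally show ?thesis .
qed

lemma L2_add:
  assumes "f \<in> L2 M" "g \<in> L2 M"
  shows "(\<lambda>x. f x + g x) \<in> L2 M"
    and "sq_norm M (\<lambda>x. f x + g x) \<le> 2 * sq_norm M f + 2 * sq_norm M g"
proof -
  have [measurable]: "f \<in> borel_measurable M" "g \<in> borel_measurable M"
    using assms by (auto simp: L2_def)
  have i: "integrable M (\<lambda>x. 2 * (cmod (f x))\<^sup>2 + 2 * (cmod (g x))\<^sup>2)"
    using assms by (auto simp: L2_def)
  have j: "integrable M (\<lambda>x. (cmod (f x + g x))\<^sup>2)"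
    by (rule Bochner_Integration.integrable_bound[OF i])
       (auto intro!: AE_I2 cmod_add_square_le)
  then show "(\<lambda>x. f x + g x) \<in> L2 M" by (simp add: L2_def)
  have "sq_norm M (\<lambda>x. f x + g x) \<le> (\<integral>x. 2 * (cmod (f x))\<^sup>2 + 2 * (cmod (g x))\<^sup>2 \<partial>M)"
    unfolding sq_norm_def by (rule integral_mono[OF j i]) (rule cmod_add_square_le)
  also have "\<dots> = 2 * sq_norm M f + 2 * sq_norm M g"
    using assms by (simp add: L2_def sq_norm_def)
  finally show "sq_norm M (\<lambda>x. f x + g x) \<le> 2 * sq_norm M f + 2 * sq_norm M g" .
qed

lemma L2_cmult:
  assumes "f \<in> L2 M"
  shows "(\<lambda>x. c * f x) \<in> L2 M" and "sq_norm M (\<lambda>x. c * f x) = (cmod c)\<^sup>2 * sq_norm M f"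
  using assms by (auto simp: L2_def sq_norm_def norm_mult power_mult_distrib)

lemma L2_diff:
  assumes "f \<in> L2 M" "g \<in> L2 M"
  shows "(\<lambda>x. f x - g x) \<in> L2 M"
  using L2_add(1)[OF assms(1) L2_cmult(1)[OF assms(2), of "-1"]] by simp

lemma L2_zero: "(\<lambda>x. 0) \<in> L2 M" by (simp add: L2_def)

lemma L2_sum:
  assumes "\<And>i. i \<in> A \<Longrightarrow> f i \<in> L2 M"
  shows "(\<lambda>x. \<Sum>i\<in>A. f i x) \<in> L2 M"
  using assms by (induction A rule: infinite_finite_induct) (auto simp: L2_zero L2_add(1))

lemma L2_inner_self: "L2_inner M f f = of_real (sq_norm M f)"
proof -
  have "L2_inner M f f = (\<integral>x. of_real ((cmod (f x))\<^sup>2) \<partial>M)"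
    unfolding L2_inner_def by (rule Bochner_Integration.integral_cong)
      (simp_all only: complex_norm_square)
  also have "\<dots> = of_real (sq_norm M f)" unfolding sq_norm_def by (rule integral_complex_of_real)
  finally show ?thesis .
qed

lemma L2_inner_cnj: "L2_inner M g f = cnj (L2_inner M f g)"
proof -
  have "cnj (L2_inner M f g) = (\<integral>x. cnj (f x * cnj (g x)) \<partial>M)" unfolding L2_inner_def by (simp only: Bochner_Integration.integral_cnj)
  then show ?thesis by (simp add: L2_inner_def mult.commute)
qed

lemma L2_inner_diff_left:
  assumes "f \<in> L2 M" "g \<in> L2 M" "k \<in> L2 M"
  shows "L2_inner M (\<lambda>x. f x - g x) k = L2_inner M f k - L2_inner M g k"
  unfolding L2_inner_def using L2_mult_integrable[OF assms(1,3)] L2_mult_integrable[OF assms(2,3)]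
  by (simp add: left_diff_distrib)

lemma L2_inner_cmult_left: "L2_inner M (\<lambda>x. c * f x) k = c * L2_inner M f k"
  unfolding L2_inner_def by (simp add: mult.assoc)

lemma L2_inner_sum_left:
  assumes "\<And>i. i \<in> A \<Longrightarrow> f i \<in> L2 M" "k \<in> L2 M"
  shows "L2_inner M (\<lambda>x. \<Sum>i\<in>A. f i x) k = (\<Sum>i\<in>A. L2_inner M (f i) k)"
  unfolding L2_inner_def using L2_mult_integrable[OF assms]
  by (simp add: sum_distrib_right)

lemma sq_norm_diff:
  assumes "f \<in> L2 M" "g \<in> L2 M"
  shows "sq_norm M (\<lambda>x. f x - g x) = sq_norm M f - 2 * Re (L2_inner M f g) + sq_norm M g"
proof -
  let ?d = "\<lambda>x. f x - g x"
  have d: "?d \<in> L2 M" by (rule L2_diff[OF assms])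
  have "L2_inner M ?d ?d = L2_inner M f ?d - L2_inner M g ?d" by (rule L2_inner_diff_left[OF assms d])
  also have "L2_inner M f ?d = cnj (L2_inner M f f - L2_inner M g f)"
    unfolding L2_inner_cnj[of M f ?d] L2_inner_diff_left[OF assms assms(1)] ..
  also have "L2_inner M g ?d = cnj (L2_inner M f g - L2_inner M g g)"
    unfolding L2_inner_cnj[of M g ?d] L2_inner_diff_left[OF assms assms(2)] ..
  finally have "Re (L2_inner M ?d ?d) = Re (L2_inner M f f) - Re (L2_inner M f g) - Re (L2_inner M g f) + Re (L2_inner M g g)"
    by simp
  moreover have "Re (L2_inner M g f) = Re (L2_inner M f g)" by (simp add: L2_inner_cnj[of M g f])
  ultimately show ?thesis by (simp add: L2_inner_self)
qed

locale L2_orthogonal =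
  fixes M :: "'a measure" and \<psi> :: "nat \<Rightarrow> 'a \<Rightarrow> complex" and h :: "nat \<Rightarrow> real"
  assumes \<psi>_L2: "\<psi> n \<in> L2 M"
    and orth: "m \<noteq> n \<Longrightarrow> L2_inner M (\<psi> m) (\<psi> n) = 0"
    and sq_norm_\<psi>: "sq_norm M (\<psi> n) = h n"
    and h_pos: "h n > 0"
begin

text \<open>
  Adding one function of the system at a time completes one square at a time, because the
  inner product with \<open>\<psi> n\<close> does not see the earlier terms. The choice of \<open>a\<close> that makes all squares vanish
  is the Fourier sum, which is therefore the best approximation.
\<close>

lemma sq_norm_diff_span:
  assumes f: "f \<in> L2 M"
  shows "sq_norm M (\<lambda>x. f x - (\<Sum>i<n. a i * \<psi> i x)) = sq_norm M f
    + (\<Sum>i<n. h i * (cmod (a i - L2_inner M f (\<psi> i) / h i))\<^sup>2 - (cmod (L2_inner M f (\<psi> i)))\<^sup>2 / h i)"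
proof (induction n)
  case 0
  show ?case by simp
next
  case (Suc n)
  let ?S = "\<lambda>x. \<Sum>i<n. a i * \<psi> i x" and ?c = "L2_inner M f (\<psi> n)"
  have S: "?S \<in> L2 M" by (intro L2_sum L2_cmult(1) \<psi>_L2)
  have d: "(\<lambda>x. f x - ?S x) \<in> L2 M" by (rule L2_diff[OF f S])
  have "L2_inner M ?S (\<psi> n) = (\<Sum>i<n. L2_inner M (\<lambda>x. a i * \<psi> i x) (\<psi> n))"
    by (intro L2_inner_sum_left L2_cmult(1) \<psi>_L2)
  also have "\<dots> = 0" by (intro sum.neutral) (auto simp: L2_inner_cmult_left orth)
  finally have c: "L2_inner M (\<lambda>x. f x - ?S x) (\<psi> n) = ?c"
    by (simp add: L2_inner_diff_left[OF f S \<psi>_L2])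
  have hn: "h n > 0" by (rule h_pos)
  have "L2_inner M (\<lambda>x. f x - ?S x) (\<lambda>x. a n * \<psi> n x) = cnj (a n) * ?c"
    by (subst L2_inner_cnj) (simp add: L2_inner_cmult_left L2_inner_cnj[of M "\<psi> n"] c)
  then have "sq_norm M (\<lambda>x. (f x - ?S x) - a n * \<psi> n x)
      = sq_norm M (\<lambda>x. f x - ?S x) - 2 * Re (cnj (a n) * ?c) + (cmod (a n))\<^sup>2 * h n"
    using sq_norm_diff[OF d L2_cmult(1)[OF \<psi>_L2, of "a n" n]]
    by (simp add: L2_cmult(2)[OF \<psi>_L2] sq_norm_\<psi>)
  moreover have "- 2 * Re (cnj (a n) * ?c) + (cmod (a n))\<^sup>2 * h n
      = h n * (cmod (a n - ?c / h n))\<^sup>2 - (cmod ?c)\<^sup>2 / h n"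
  proof -
    define w where "w = ?c / h n"
    have cw: "?c = of_real (h n) * w" using hn by (simp add: w_def)
    show ?thesis
      unfolding w_def[symmetric] cw using hn
      by (simp add: norm_mult power_mult_distrib cmod_power2)
         (simp add: power2_eq_square field_simps)
  qed
  ultimately show ?case
    using Suc.IH by (simp add: algebra_simps)
qed

lemma Bessel:
  assumes "f \<in> L2 M"
  shows "(\<Sum>i<n. (cmod (L2_inner M f (\<psi> i)))\<^sup>2 / h i) \<le> sq_norm M f"
  using sq_norm_diff_span[OF assms, where n = n and a = "\<lambda>i. L2_inner M f (\<psi> i) / h i"]
    sq_norm_nonneg[of M "\<lambda>x. f x - (\<Sum>i<n. (L2_inner M f (\<psi> i) / h i) * \<psi> i x)"]
  by (simp add: sum_negf)

text \<open>
  An approximating combination of the first \<open>n\<close> functions is no better than the Fourier sum of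
  that length, whose error is the square norm minus the partial sum of the coefficients.
\<close>

lemma Parseval_le:
  assumes f: "f \<in> L2 M"
    and dense: "\<And>e. e > 0 \<Longrightarrow> \<exists>n a. sq_norm M (\<lambda>x. f x - (\<Sum>i<n. a i * \<psi> i x)) < e"
    and bound: "\<And>n. (\<Sum>i<n. (cmod (L2_inner M f (\<psi> i)))\<^sup>2 / h i) \<le> B"
  shows "sq_norm M f \<le> B"
proof (rule field_le_epsilon)
  fix e :: real assume "e > 0"
  then obtain n a where a: "sq_norm M (\<lambda>x. f x - (\<Sum>i<n. a i * \<psi> i x)) < e" using dense by blast
  have "0 \<le> (\<Sum>i<n. h i * (cmod (a i - L2_inner M f (\<psi> i) / h i))\<^sup>2)"
    by (intro sum_nonneg mult_nonneg_nonneg) (simp_all add: h_pos less_imp_le)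
  then show "sq_norm M f \<le> B + e"
    using a bound[of n] by (simp add: sq_norm_diff_span[OF f] sum_subtractf)
qed

end

section \<open>Weighted square-integrable functions on the half-line\<close>

lemma Gamma_integral_exp:
  fixes p a :: real
  assumes "p > 0" "a > 0"
  shows set_integrable_powr_exp: "set_integrable lebesgue {0<..} (\<lambda>x. x powr (p - 1) * exp (- a * x))"
    and integral_powr_exp: "(LINT x:{0<..}|lebesgue. x powr (p - 1) * exp (- a * x)) = Gamma p / a powr p"
proof -
  let ?f = "\<lambda>t::real. indicator {0..} t * t powr (p - 1) / exp t"
  let ?g = "\<lambda>x. indicat_real {0<..} x *\<^sub>R (x powr (p - 1) * exp (- a * x))"
  have "has_bochner_integral lborel ?f (Gamma p)"
    using Gamma_conv_nn_integral_real[OF assms(1)] assms(1)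
    by (intro has_bochner_integral_nn_integral) auto
  then have int: "integrable lborel ?f" and val: "integral\<^sup>L lborel ?f = Gamma p"
    by (auto simp: has_bochner_integral_iff)
  have eq: "?f (0 + a * x) = a powr (p - 1) * ?g x" for x
  proof (cases "x > 0")
    case True
    then show ?thesis using assms by (simp add: powr_mult exp_minus field_simps)
  next
    case False
    show ?thesis
    proof (cases "x = 0")
      case True
      then show ?thesis by simp
    next
      case F2: False
      then have "a * x < 0" using False assms by (simp add: mult_pos_neg)
      then show ?thesis using False by simp
    qed
  qed
  have "integrable lborel (\<lambda>x. ?f (0 + a * x))"
    by (rule lborel_integrable_real_affine[OF int]) (use assms in simp)
  then have i: "integrable lborel ?g" unfolding eq using assms by simp
  have [measurable]: "?g \<in> borel_measurable borel" by measurable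
  show "set_integrable lebesgue {0<..} (\<lambda>x. x powr (p - 1) * exp (- a * x))"
    unfolding set_integrable_def by (subst integrable_completion) (use i in simp_all)
  have "Gamma p = \<bar>a\<bar> *\<^sub>R (\<integral>x. ?f (0 + a * x) \<partial>lborel)"
    unfolding val[symmetric] by (rule lborel_integral_real_affine) (use assms in simp)
  also have "\<dots> = (a * a powr (p - 1)) * (\<integral>x. ?g x \<partial>lborel)"
    unfolding eq integral_mult_right_zero using assms by simp
  also have "a * a powr (p - 1) = a powr p"
    using assms by (simp add: powr_diff)
  finally have "(\<integral>x. ?g x \<partial>lborel) = Gamma p / a powr p" using assms by simp
  then show "(LINT x:{0<..}|lebesgue. x powr (p - 1) * exp (- a * x)) = Gamma p / a powr p"
    unfolding set_lebesgue_integral_def by (subst integral_completion) simp_all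
qed

text \<open>
  Multiplication by the square root of the weight embeds the weighted space isometrically into
  the square-integrable functions on the line. The cut-off discards the values off the half-line, which
  carry no meaning.
\<close>

definition weighted :: "real \<Rightarrow> (real \<Rightarrow> complex) \<Rightarrow> real \<Rightarrow> complex" where
  "weighted a f x = (if 0 < x then x powr (a/2) *\<^sub>R f x else 0)"

lemma weighted_sq: "(cmod (weighted a f x))\<^sup>2 = indicator {0<..} x *\<^sub>R ((cmod (f x))\<^sup>2 * x powr a)"
proof -
  have "(x powr (a/2))\<^sup>2 = x powr a" if "x > 0"
    using that by (simp add: power2_eq_square flip: powr_add)
  then show ?thesis by (simp add: weighted_def power_mult_distrib mult.commute)
qed

lemma weighted_measurable_iff:
  "weighted a f \<in> borel_measurable lebesgue \<longleftrightarrow> set_borel_measurable lebesgue {0<..} f"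
proof -
  have 1: "weighted a f = (\<lambda>x. x powr (a/2) *\<^sub>R (indicator {0<..} x *\<^sub>R f x))"
    by (auto simp: weighted_def fun_eq_iff indicator_def)
  have 2: "(\<lambda>x. indicator {0<..} x *\<^sub>R f x) = (\<lambda>x. x powr (- a/2) *\<^sub>R weighted a f x)"
    by (auto simp: weighted_def fun_eq_iff indicator_def simp flip: powr_add)
  have [measurable]: "(\<lambda>x. x powr c) \<in> borel_measurable lebesgue" for c :: real
    by (rule measurable_completion) measurable
  show ?thesis unfolding set_borel_measurable_def
  proof
    assume [measurable]: "weighted a f \<in> borel_measurable lebesgue"
    show "(\<lambda>x. indicator {0<..} x *\<^sub>R f x) \<in> borel_measurable lebesgue"
      unfolding 2 by measurable
  next
    assume [measurable]: "(\<lambda>x. indicator {0<..} x *\<^sub>R f x) \<in> borel_measurable lebesgue"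
    show "weighted a f \<in> borel_measurable lebesgue"
      unfolding 1 by measurable
  qed
qed

lemma wL2_iff: "f \<in> wL2 a \<longleftrightarrow> weighted a f \<in> L2 lebesgue"
  unfolding wL2_def L2_def mem_Collect_eq weighted_measurable_iff weighted_sq set_integrable_def ..

lemma winner_L2_inner: "winner a f g = L2_inner lebesgue (weighted a f) (weighted a g)"
proof -
  have "x powr (a/2) * x powr (a/2) = x powr a" if "x > 0" for x
    using that by (simp flip: powr_add)
  then have "indicat_real {0<..} x *\<^sub>R (f x * cnj (g x) * complex_of_real (x powr a))
      = weighted a f x * cnj (weighted a g x)" for x
    by (auto simp: weighted_def indicator_def scaleR_conv_of_real simp flip: of_real_mult)
  then show ?thesis unfolding winner_def L2_inner_def set_lebesgue_integral_def by simp
qed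

lemma wnorm_sq_norm: "wnorm a f = sqrt (sq_norm lebesgue (weighted a f))"
  by (simp add: wnorm_def winner_L2_inner L2_inner_self)

lemma weighted_add: "weighted a (\<lambda>x. f x + g x) = (\<lambda>x. weighted a f x + weighted a g x)"
  and weighted_diff: "weighted a (\<lambda>x. f x - g x) = (\<lambda>x. weighted a f x - weighted a g x)"
  and weighted_cmult: "weighted a (\<lambda>x. c * f x) = (\<lambda>x. c * weighted a f x)"
  and weighted_zero: "weighted a (\<lambda>x. 0) = (\<lambda>x. 0)"
  by (auto simp: weighted_def fun_eq_iff scaleR_add_right scaleR_diff_right)

lemma weighted_sum: "weighted a (\<lambda>x. \<Sum>i\<in>A. f i x) = (\<lambda>x. \<Sum>i\<in>A. weighted a (f i) x)"
  by (auto simp: weighted_def fun_eq_iff scaleR_sum_right)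

lemma wL2_add: "f \<in> wL2 a \<Longrightarrow> g \<in> wL2 a \<Longrightarrow> (\<lambda>x. f x + g x) \<in> wL2 a"
  and wL2_diff: "f \<in> wL2 a \<Longrightarrow> g \<in> wL2 a \<Longrightarrow> (\<lambda>x. f x - g x) \<in> wL2 a"
  and wL2_cmult: "f \<in> wL2 a \<Longrightarrow> (\<lambda>x. c * f x) \<in> wL2 a"
  unfolding wL2_iff weighted_add weighted_diff weighted_cmult by (rule L2_add L2_diff L2_cmult; assumption)+

lemma wL2_sum: "(\<And>i. i \<in> A \<Longrightarrow> f i \<in> wL2 a) \<Longrightarrow> (\<lambda>x. \<Sum>i\<in>A. f i x) \<in> wL2 a"
  unfolding wL2_iff weighted_sum by (rule L2_sum)

lemma exp_monom_wL2:
  assumes "a > -1" "c > 0"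
  shows "(\<lambda>x. exp (- c * x) *\<^sub>R complex_of_real x ^ m) \<in> wL2 a"
proof -
  have "set_integrable lebesgue {0<..} (\<lambda>x. x powr ((a + 2 * m + 1) - 1) * exp (- (2*c) * x))"
    by (rule set_integrable_powr_exp) (use assms in auto)
  moreover have eq: "indicat_real {0<..} x *\<^sub>R (x powr ((a + 2 * m + 1) - 1) * exp (- (2*c) * x))
      = indicat_real {0<..} x *\<^sub>R ((cmod (exp (- c * x) *\<^sub>R complex_of_real x ^ m))\<^sup>2 * x powr a)" for x
  proof (cases "x > 0")
    case True
    have "x powr (a + 2 * real m) = x powr a * (x ^ m)\<^sup>2"
      using True by (simp add: powr_add powr_realpow[symmetric] power2_eq_square flip: powr_add)
    moreover have "exp (- (2*c) * x) = (exp (- c * x))\<^sup>2"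
      by (simp add: power2_eq_square flip: exp_add)
    ultimately show ?thesis using True
      by (simp add: norm_power power_mult_distrib power2_eq_square)
  qed simp
  ultimately have "integrable lebesgue (\<lambda>x. indicat_real {0<..} x *\<^sub>R ((cmod (exp (- c * x) *\<^sub>R complex_of_real x ^ m))\<^sup>2 * x powr a))"
    unfolding set_integrable_def by (simp only:)
  moreover have "set_borel_measurable lebesgue {0<..} (\<lambda>x. exp (- c * x) *\<^sub>R complex_of_real x ^ m)"
    unfolding set_borel_measurable_def by (rule measurable_completion) measurable
  ultimately show ?thesis unfolding wL2_def set_integrable_def by blast
qed

lemma exp_poly_wL2:
  assumes "a > -1" "c > 0"
  shows "(\<lambda>x. exp (- c * x) *\<^sub>R poly p (complex_of_real x)) \<in> wL2 a"
proof -
  have "(\<lambda>x. \<Sum>i\<le>degree p. coeff p i * (exp (- c * x) *\<^sub>R complex_of_real x ^ i)) \<in> wL2 a"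
    by (intro wL2_sum wL2_cmult exp_monom_wL2 assms)
  moreover have "(\<lambda>x. \<Sum>i\<le>degree p. coeff p i * (exp (- c * x) *\<^sub>R complex_of_real x ^ i))
     = (\<lambda>x. exp (- c * x) *\<^sub>R poly p (complex_of_real x))"
    by (simp add: poly_altdef scaleR_sum_right)
  ultimately show ?thesis by simp
qed

section \<open>Density of exponential polynomials\<close>

text \<open>
  Closure of the functions \<open>exp (- c x) p(x)\<close> in the weighted space; it will turn out to be the
  whole space.
\<close>

definition expoly_closure :: "real \<Rightarrow> real \<Rightarrow> (real \<Rightarrow> complex) set" where
  "expoly_closure a c = {f \<in> wL2 a. \<forall>e>0. \<exists>p.
     sq_norm lebesgue (weighted a (\<lambda>x. f x - exp (- c * x) *\<^sub>R poly p (complex_of_real x))) < e}"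

context
  fixes a c :: real
  assumes a: "a > -1" and c: "c > 0"
begin

lemma expoly_closureI:
  assumes f: "f \<in> wL2 a"
    and *: "\<And>e. e > 0 \<Longrightarrow> \<exists>g\<in>expoly_closure a c. sq_norm lebesgue (weighted a (\<lambda>x. f x - g x)) < e"
  shows "f \<in> expoly_closure a c"
  unfolding expoly_closure_def
proof (intro CollectI conjI f allI impI)
  fix e :: real assume "e > 0"
  then obtain g where g: "g \<in> expoly_closure a c" "sq_norm lebesgue (weighted a (\<lambda>x. f x - g x)) < e / 4"
    using *[of "e/4"] by auto
  obtain p where p: "sq_norm lebesgue (weighted a (\<lambda>x. g x - exp (- c * x) *\<^sub>R poly p (complex_of_real x))) < e / 4"
    using g(1) \<open>e > 0\<close> unfolding expoly_closure_def by (auto dest!: spec[of _ "e/4"])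
  have gL: "g \<in> wL2 a" using g by (simp add: expoly_closure_def)
  let ?p = "\<lambda>x. exp (- c * x) *\<^sub>R poly p (complex_of_real x)"
  have "sq_norm lebesgue (\<lambda>x. weighted a (\<lambda>x. f x - g x) x + weighted a (\<lambda>x. g x - ?p x) x)
      \<le> 2 * sq_norm lebesgue (weighted a (\<lambda>x. f x - g x)) + 2 * sq_norm lebesgue (weighted a (\<lambda>x. g x - ?p x))"
    by (intro L2_add(2) wL2_iff[THEN iffD1] wL2_diff f gL exp_poly_wL2 a c)
  also have "\<dots> < e" using g(2) p by simp
  finally show "\<exists>p. sq_norm lebesgue (weighted a (\<lambda>x. f x - exp (- c * x) *\<^sub>R poly p (complex_of_real x))) < e"
    by (intro exI[of _ p]) (simp flip: weighted_add)
qed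

lemma expoly_closure_poly: "(\<lambda>x. exp (- c * x) *\<^sub>R poly p (complex_of_real x)) \<in> expoly_closure a c"
  unfolding expoly_closure_def
  by (intro CollectI conjI exp_poly_wL2 a c allI impI exI[of _ p]) (simp add: weighted_zero sq_norm_def)

lemma expoly_closure_add:
  assumes "f \<in> expoly_closure a c" "g \<in> expoly_closure a c"
  shows "(\<lambda>x. f x + g x) \<in> expoly_closure a c"
  unfolding expoly_closure_def
proof (intro CollectI conjI allI impI)
  have fg: "f \<in> wL2 a" "g \<in> wL2 a" using assms by (auto simp: expoly_closure_def)
  then show "(\<lambda>x. f x + g x) \<in> wL2 a" by (rule wL2_add)
  fix e :: real assume "e > 0"
  then obtain p q
    where p: "sq_norm lebesgue (weighted a (\<lambda>x. f x - exp (- c * x) *\<^sub>R poly p (complex_of_real x))) < e / 4"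
      and q: "sq_norm lebesgue (weighted a (\<lambda>x. g x - exp (- c * x) *\<^sub>R poly q (complex_of_real x))) < e / 4"
    using assms unfolding expoly_closure_def by (auto dest!: spec[of _ "e/4"])
  let ?p = "\<lambda>p x. exp (- c * x) *\<^sub>R poly p (complex_of_real x)"
  have "sq_norm lebesgue (\<lambda>x. weighted a (\<lambda>x. f x - ?p p x) x + weighted a (\<lambda>x. g x - ?p q x) x)
      \<le> 2 * sq_norm lebesgue (weighted a (\<lambda>x. f x - ?p p x)) + 2 * sq_norm lebesgue (weighted a (\<lambda>x. g x - ?p q x))"
    by (intro L2_add(2) wL2_iff[THEN iffD1] wL2_diff fg exp_poly_wL2 a c)
  also have "\<dots> < e" using p q by simp
  finally show "\<exists>p. sq_norm lebesgue (weighted a (\<lambda>x. f x + g x - ?p p x)) < e"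
    by (intro exI[of _ "p + q"]) (simp add: scaleR_add_right add_diff_add flip: weighted_add)
qed

lemma expoly_closure_cmult:
  assumes "f \<in> expoly_closure a c"
  shows "(\<lambda>x. k * f x) \<in> expoly_closure a c"
  unfolding expoly_closure_def
proof (intro CollectI conjI allI impI)
  have f: "f \<in> wL2 a" using assms by (auto simp: expoly_closure_def)
  then show "(\<lambda>x. k * f x) \<in> wL2 a" by (rule wL2_cmult)
  fix e :: real assume e: "e > 0"
  have pos: "(cmod k)\<^sup>2 + 1 > 0" by (simp add: add_nonneg_pos)
  let ?p = "\<lambda>p x. exp (- c * x) *\<^sub>R poly p (complex_of_real x)"
  obtain p where p: "sq_norm lebesgue (weighted a (\<lambda>x. f x - ?p p x)) < e / ((cmod k)\<^sup>2 + 1)"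
    using assms divide_pos_pos[OF e pos] unfolding expoly_closure_def by auto
  have "sq_norm lebesgue (weighted a (\<lambda>x. k * f x - ?p (smult k p) x))
      = sq_norm lebesgue (\<lambda>x. k * weighted a (\<lambda>x. f x - ?p p x) x)"
    by (simp add: right_diff_distrib flip: weighted_cmult)
  also have "\<dots> = (cmod k)\<^sup>2 * sq_norm lebesgue (weighted a (\<lambda>x. f x - ?p p x))"
    by (intro L2_cmult(2) wL2_iff[THEN iffD1] wL2_diff f exp_poly_wL2 a c)
  also have "\<dots> \<le> ((cmod k)\<^sup>2 + 1) * sq_norm lebesgue (weighted a (\<lambda>x. f x - ?p p x))"
    by (intro mult_right_mono sq_norm_nonneg) simp
  also have "\<dots> < e" using p pos by (simp add: field_simps)
  finally show "\<exists>p. sq_norm lebesgue (weighted a (\<lambda>x. k * f x - ?p p x)) < e" by blast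
qed

lemma expoly_closure_sum:
  assumes "\<And>i. i \<in> A \<Longrightarrow> f i \<in> expoly_closure a c"
  shows "(\<lambda>x. \<Sum>i\<in>A. f i x) \<in> expoly_closure a c"
  using assms
proof (induction A rule: infinite_finite_induct)
  case (insert i A)
  then show ?case by (simp add: expoly_closure_add)
qed (use expoly_closure_poly[of 0] in simp_all)

text \<open>
  Every extension of the closure below is a pointwise limit with an integrable majorant, so this
  one form of dominated convergence replaces estimates of norms.
\<close>

lemma expoly_closure_limit:
  assumes F: "\<And>i. F i \<in> expoly_closure a c"
    and g: "set_integrable lebesgue {0<..} (\<lambda>x. (g x)\<^sup>2 * x powr a)"
    and le: "\<And>i x. x > 0 \<Longrightarrow> cmod (F i x) \<le> g x"
    and lim: "\<And>x. x > 0 \<Longrightarrow> (\<lambda>i. F i x) \<longlonglongrightarrow> f x"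
  shows "f \<in> expoly_closure a c"
proof -
  have FL: "weighted a (F i) \<in> L2 lebesgue" for i using F[of i] by (simp add: expoly_closure_def wL2_iff)
  have wlim: "(\<lambda>i. weighted a (F i) x) \<longlonglongrightarrow> weighted a f x" for x
    unfolding weighted_def using lim[of x] by (auto intro!: tendsto_intros)
  have m: "weighted a f \<in> borel_measurable lebesgue"
    by (rule borel_measurable_LIMSEQ_metric[OF _ wlim]) (rule L2_measurable[OF FL])
  have fle: "cmod (f x) \<le> g x" if "x > 0" for x
    by (rule tendsto_upperbound[OF tendsto_norm[OF lim[OF that]]]) (auto simp: le that)
  have ig: "integrable lebesgue (\<lambda>x. indicator {0<..} x *\<^sub>R ((g x)\<^sup>2 * x powr a))"
    using g by (simp add: set_integrable_def)
  have fL: "f \<in> wL2 a"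
    unfolding wL2_iff L2_def mem_Collect_eq
  proof (intro conjI m Bochner_Integration.integrable_bound[OF ig] AE_I2)
    show "(\<lambda>x. (cmod (weighted a f x))\<^sup>2) \<in> borel_measurable lebesgue" using m by measurable
    show "norm ((cmod (weighted a f x))\<^sup>2) \<le> norm (indicat_real {0<..} x *\<^sub>R ((g x)\<^sup>2 * x powr a))" for x
      unfolding weighted_sq using fle[of x]
      by (auto simp: indicator_def intro!: mult_right_mono power_mono)
  qed
  have "(\<lambda>i. sq_norm lebesgue (weighted a (\<lambda>x. f x - F i x))) \<longlonglongrightarrow> (\<integral>x. 0 \<partial>(lebesgue :: real measure))"
    unfolding sq_norm_def
  proof (rule integral_dominated_convergence)
    show "integrable lebesgue (\<lambda>x. 4 * (indicator {0<..} x *\<^sub>R ((g x)\<^sup>2 * x powr a)))"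
      using ig by simp
    show "AE x in lebesgue. (\<lambda>i. (cmod (weighted a (\<lambda>x. f x - F i x) x))\<^sup>2) \<longlonglongrightarrow> 0"
    proof (intro AE_I2)
      fix x
      have "(\<lambda>i. (cmod (weighted a f x - weighted a (F i) x))\<^sup>2) \<longlonglongrightarrow> (cmod (weighted a f x - weighted a f x))\<^sup>2"
        by (intro tendsto_intros wlim)
      then show "(\<lambda>i. (cmod (weighted a (\<lambda>x. f x - F i x) x))\<^sup>2) \<longlonglongrightarrow> 0" by (simp add: weighted_diff)
    qed
    show "(\<lambda>x. (cmod (weighted a (\<lambda>x. f x - F i x) x))\<^sup>2) \<in> borel_measurable lebesgue" for i
      unfolding weighted_diff using m L2_measurable[OF FL[of i]] by measurable
    show "AE x in lebesgue. norm ((cmod (weighted a (\<lambda>x. f x - F i x) x))\<^sup>2)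
        \<le> 4 * (indicator {0<..} x *\<^sub>R ((g x)\<^sup>2 * x powr a))" for i
    proof (intro AE_I2)
      fix x
      show "norm ((cmod (weighted a (\<lambda>x. f x - F i x) x))\<^sup>2)
        \<le> 4 * (indicator {0<..} x *\<^sub>R ((g x)\<^sup>2 * x powr a))"
      proof (cases "x > 0")
        case True
        have "cmod (f x - F i x) \<le> 2 * g x"
          using norm_triangle_ineq4[of "f x" "F i x"] fle[OF True] le[OF True, of i] by simp
        then have "(cmod (f x - F i x))\<^sup>2 \<le> (2 * g x)\<^sup>2" by (rule power_mono) simp
        then have "(cmod (f x - F i x))\<^sup>2 * x powr a \<le> (2 * g x)\<^sup>2 * x powr a"
          by (rule mult_right_mono) simp
        with True show ?thesis by (simp add: weighted_sq power_mult_distrib)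
      qed (simp add: weighted_sq)
    qed
  qed simp
  then have lim0: "(\<lambda>i. sq_norm lebesgue (weighted a (\<lambda>x. f x - F i x))) \<longlonglongrightarrow> 0" by simp
  show ?thesis
  proof (rule expoly_closureI[OF fL])
    fix e :: real assume "e > 0"
    then obtain i where "sq_norm lebesgue (weighted a (\<lambda>x. f x - F i x)) < e"
      using order_tendstoD(2)[OF lim0] eventually_happens' trivial_limit_sequentially by blast
    then show "\<exists>g\<in>expoly_closure a c. sq_norm lebesgue (weighted a (\<lambda>x. f x - g x)) < e" using F by blast
  qed
qed

text \<open>
  The majorants used with \<open>expoly_closure_limit\<close>.
\<close>

lemma exp_square_integrable:
  assumes "d > 0"
  shows "set_integrable lebesgue {0<..} (\<lambda>x. (B * (exp (- d * x) * x ^ m))\<^sup>2 * x powr a)"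
proof -
  have "set_integrable lebesgue {0<..} (\<lambda>x. (cmod (exp (- d * x) *\<^sub>R complex_of_real x ^ m))\<^sup>2 * x powr a)"
    using exp_monom_wL2[OF a assms, of m] by (simp add: wL2_def)
  then have "set_integrable lebesgue {0<..} (\<lambda>x. B\<^sup>2 * ((cmod (exp (- d * x) *\<^sub>R complex_of_real x ^ m))\<^sup>2 * x powr a))"
    by (rule set_integrable_mult_right)
  moreover have "B\<^sup>2 * ((cmod (exp (- d * x) *\<^sub>R complex_of_real x ^ m))\<^sup>2 * x powr a)
      = (B * (exp (- d * x) * x ^ m))\<^sup>2 * x powr a" for x
  proof -
    have "(cmod (complex_of_real x ^ m))\<^sup>2 = (x ^ m)\<^sup>2"
      by (metis norm_of_real of_real_power power2_abs)
    then show ?thesis by (simp add: power_mult_distrib)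
  qed
  ultimately show ?thesis by (simp only:)
qed

text \<open>
  Passing from rate \<open>d\<close> to rate \<open>d + c / 2\<close> expands \<open>exp (- c x / 2)\<close> into its Taylor series. The
  partial sums are dominated by \<open>exp (c x / 2)\<close>, which the factor \<open>exp (- d x)\<close> absorbs since \<open>d \<ge> c\<close>;
  this is why the rate is increased in small steps.
\<close>

lemma expoly_closure_exp_monom:
  "(\<lambda>x. exp (- (c * (1 + real k / 2)) * x) *\<^sub>R complex_of_real x ^ m) \<in> expoly_closure a c"
proof (induction k arbitrary: m)
  case 0
  then show ?case using expoly_closure_poly[of "monom 1 m"] by (simp add: poly_monom)
next
  case (Suc k)
  define d where "d = c * (1 + real k / 2)"
  define t where "t = c / 2"
  let ?F = "\<lambda>n x. \<Sum>j<n. complex_of_real ((- t) ^ j / fact j) * (exp (- d * x) *\<^sub>R complex_of_real x ^ (m + j))"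
  have F: "?F n x = complex_of_real (exp (- d * x) * x ^ m * (\<Sum>j<n. (- t * x) ^ j /\<^sub>R fact j))" for n x
    unfolding power_mult_distrib power_add sum_distrib_left of_real_sum
    by (intro sum.cong) (simp_all add: scaleR_conv_of_real divide_inverse mult_ac)
  show ?case
  proof (rule expoly_closure_limit[where F = ?F and g = "\<lambda>x. 1 * (exp (- (d - t) * x) * x ^ m)"])
    show "?F i \<in> expoly_closure a c" for i
      unfolding d_def by (intro expoly_closure_sum expoly_closure_cmult Suc.IH)
    have "d - t > 0" using c by (auto simp: d_def t_def algebra_simps intro!: add_pos_nonneg)
    then show "set_integrable lebesgue {0<..} (\<lambda>x. (1 * (exp (- (d - t) * x) * x ^ m))\<^sup>2 * x powr a)"
      by (rule exp_square_integrable)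
    fix x :: real assume x: "x > 0"
    show "cmod (?F i x) \<le> 1 * (exp (- (d - t) * x) * x ^ m)" for i
    proof -
      have "\<bar>\<Sum>j<i. (- t * x) ^ j /\<^sub>R fact j\<bar> \<le> (\<Sum>j<i. \<bar>(- t * x) ^ j /\<^sub>R fact j\<bar>)"
        by (rule sum_abs)
      also have "\<dots> = (\<Sum>j<i. (t * x) ^ j /\<^sub>R fact j)"
        using x c by (intro sum.cong) (auto simp: abs_mult power_abs t_def)
      also have "\<dots> \<le> (\<Sum>j. (t * x) ^ j /\<^sub>R fact j)"
        using x c by (intro sum_le_suminf summable_exp_generic) (auto simp: t_def)
      also have "\<dots> = exp (t * x)" by (simp add: exp_def)
      finally have "exp (- d * x) * x ^ m * \<bar>\<Sum>j<i. (- t * x) ^ j /\<^sub>R fact j\<bar> \<le> exp (- d * x) * x ^ m * exp (t * x)"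
        using x by (intro mult_left_mono) auto
      also have "\<dots> = 1 * (exp (- (d - t) * x) * x ^ m)"
        by (simp add: algebra_simps exp_diff exp_minus) (simp add: field_simps)
      finally show ?thesis using x unfolding F norm_of_real by (simp add: abs_mult)
    qed
    have "(\<lambda>n. complex_of_real (exp (- d * x) * x ^ m * (\<Sum>j<n. (- t * x) ^ j /\<^sub>R fact j)))
        \<longlonglongrightarrow> complex_of_real (exp (- d * x) * x ^ m * exp (- t * x))"
      using exp_converges[of "- t * x"] unfolding sums_def by (intro tendsto_intros)
    also have "complex_of_real (exp (- d * x) * x ^ m * exp (- t * x))
        = exp (- (c * (1 + real (Suc k) / 2)) * x) *\<^sub>R complex_of_real x ^ m"
    proof -
      have "exp (- (c * (1 + real (Suc k) / 2)) * x) = exp (- d * x) * exp (- t * x)"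
        unfolding exp_add[symmetric] by (rule arg_cong[where f = exp]) (simp add: d_def t_def field_simps)
      then show ?thesis by (simp add: scaleR_conv_of_real mult_ac)
    qed
    finally show "(\<lambda>n. ?F n x) \<longlonglongrightarrow> exp (- (c * (1 + real (Suc k) / 2)) * x) *\<^sub>R complex_of_real x ^ m"
      unfolding F .
  qed
qed

text \<open>
  In the variable \<open>t = exp (- c x / 2)\<close>, which ranges over the unit interval, the powers of \<open>t\<close> are the
  exponentials just obtained, and Weierstrass' theorem applies.
\<close>

lemma expoly_closure_continuous:
  fixes \<phi> :: "real \<Rightarrow> real"
  assumes \<phi>: "continuous_on {0..1} \<phi>"
  shows "(\<lambda>x. complex_of_real (exp (- c * x) * \<phi> (exp (- (c/2) * x)))) \<in> expoly_closure a c"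
proof -
  have t01: "exp (- (c/2) * x) \<in> {0..1}" if "x > 0" for x
    using that c by simp
  have "\<forall>i. \<exists>g. real_polynomial_function g \<and> (\<forall>x\<in>{0..1}. \<bar>\<phi> x - g x\<bar> < 1 / Suc i)"
    using Stone_Weierstrass_real_polynomial_function[OF compact_Icc \<phi>] by (metis of_nat_0_less_iff zero_less_Suc zero_less_divide_1_iff)
  then obtain q where q: "\<And>i. real_polynomial_function (q i)"
    and near: "\<And>i t. t \<in> {0..1} \<Longrightarrow> \<bar>\<phi> t - q i t\<bar> < 1 / Suc i" by metis
  obtain B where "\<forall>t\<in>{0..1}. \<bar>\<phi> t\<bar> \<le> B"
    using compact_imp_bounded[OF compact_continuous_image[OF \<phi> compact_Icc]]
    unfolding bounded_iff by auto
  then have B: "\<bar>\<phi> t\<bar> \<le> B" if "t \<in> {0..1}" for t using that by blast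
  show ?thesis
  proof (rule expoly_closure_limit[where F = "\<lambda>i x. complex_of_real (exp (- c * x) * q i (exp (- (c/2) * x)))"
        and g = "\<lambda>x. (B + 1) * (exp (- c * x) * x ^ 0)"])
    fix i
    obtain w n where w: "q i = (\<lambda>x. \<Sum>k\<le>n. w k * x ^ k)"
      using q[of i] unfolding real_polynomial_function_iff_sum by blast
    have "(\<lambda>x. \<Sum>k\<le>n. complex_of_real (w k) * (exp (- (c * (1 + real k / 2)) * x) *\<^sub>R complex_of_real x ^ 0)) \<in> expoly_closure a c"
      by (intro expoly_closure_sum expoly_closure_cmult expoly_closure_exp_monom)
    moreover have "exp (- (c * (1 + real k / 2)) * x) = exp (- c * x) * exp (- (c/2) * x) ^ k" for k x
      by (simp add: exp_of_nat_mult[symmetric] algebra_simps flip: exp_add)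
    ultimately show "(\<lambda>x. complex_of_real (exp (- c * x) * q i (exp (- (c/2) * x)))) \<in> expoly_closure a c"
      by (simp add: w scaleR_conv_of_real sum_distrib_left mult_ac)
  next
    show "set_integrable lebesgue {0<..} (\<lambda>x. ((B + 1) * (exp (- c * x) * x ^ 0))\<^sup>2 * x powr a)"
      by (rule exp_square_integrable[OF c])
  next
    fix i and x :: real assume "x > 0"
    then have t: "exp (- (c/2) * x) \<in> {0..1}" by (rule t01)
    have "\<bar>q i (exp (- (c/2) * x))\<bar> \<le> B + 1"
      using near[OF t, of i] B[OF t] by (smt (verit) divide_le_eq_1 of_nat_0_le_iff of_nat_Suc)
    then show "cmod (complex_of_real (exp (- c * x) * q i (exp (- (c/2) * x)))) \<le> (B + 1) * (exp (- c * x) * x ^ 0)"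
      unfolding norm_of_real by (simp add: abs_mult)
  next
    fix x :: real assume "x > 0"
    then have t: "exp (- (c/2) * x) \<in> {0..1}" by (rule t01)
    have "(\<lambda>i. \<phi> (exp (- (c/2) * x)) - q i (exp (- (c/2) * x))) \<longlonglongrightarrow> 0"
      by (rule Lim_null_comparison[OF _ LIMSEQ_inverse_real_of_nat])
        (use near[OF t] in \<open>auto intro!: always_eventually less_imp_le simp: inverse_eq_divide\<close>)
    then have "(\<lambda>i. q i (exp (- (c/2) * x))) \<longlonglongrightarrow> \<phi> (exp (- (c/2) * x))"
      using tendsto_diff[OF tendsto_const[of "\<phi> (exp (- (c/2) * x))"]] by fastforce
    then show "(\<lambda>i. complex_of_real (exp (- c * x) * q i (exp (- (c/2) * x))))
        \<longlonglongrightarrow> complex_of_real (exp (- c * x) * \<phi> (exp (- (c/2) * x)))"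
      by (intro tendsto_intros)
  qed
qed

text \<open>
  The sets with this property form a Dynkin system. Half-lines belong to it because, in the
  variable \<open>t\<close>, their indicators are limits of piecewise linear functions.
\<close>

lemma expoly_closure_borel_set:
  assumes "A \<in> sets borel"
  shows "(\<lambda>x. complex_of_real (exp (- c * x) * indicator A x)) \<in> expoly_closure a c"
proof -
  let ?P = "\<lambda>A. (\<lambda>x. complex_of_real (exp (- c * x) * indicator A x)) \<in> expoly_closure a c"
  have "Int_stable (range (\<lambda>b::real. {..b}))" by (auto simp: Int_stable_def)
  moreover have "range (\<lambda>b::real. {..b}) \<subseteq> Pow UNIV" by simp
  moreover have "A \<in> sigma_sets UNIV (range (\<lambda>b::real. {..b}))"
    using assms by (simp add: borel_eq_atMost)
  ultimately show ?thesis
  proof (induction A rule: sigma_sets_induct_disjoint[consumes 3])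
    case (basic A)
    then obtain b where A: "A = {..b}" by auto
    \<comment> \<open>The substitution reverses the order: \<open>x \<le> b\<close> becomes \<open>t \<ge> \<tau>\<close>.\<close>
    define \<tau> where "\<tau> = exp (- (c/2) * b)"
    let ?\<phi> = "\<lambda>i t. max 0 (min 1 (1 + real i * (t - \<tau>)))"
    show ?case
    proof (rule expoly_closure_limit[where F = "\<lambda>i x. complex_of_real (exp (- c * x) * ?\<phi> i (exp (- (c/2) * x)))"
          and g = "\<lambda>x. 1 * (exp (- c * x) * x ^ 0)"])
      show "(\<lambda>x. complex_of_real (exp (- c * x) * ?\<phi> i (exp (- (c/2) * x)))) \<in> expoly_closure a c" for i
        by (rule expoly_closure_continuous) (intro continuous_intros)
      show "set_integrable lebesgue {0<..} (\<lambda>x. (1 * (exp (- c * x) * x ^ 0))\<^sup>2 * x powr a)"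
        by (rule exp_square_integrable[OF c])
      show "cmod (complex_of_real (exp (- c * x) * ?\<phi> i (exp (- (c/2) * x)))) \<le> 1 * (exp (- c * x) * x ^ 0)" for i x
        unfolding norm_of_real by (simp add: abs_mult)
      fix x :: real assume "x > 0"
      let ?t = "exp (- (c/2) * x)"
      have "(\<lambda>i. ?\<phi> i ?t) \<longlonglongrightarrow> indicator A x"
      proof (cases "x \<le> b")
        case True
        then have "?t \<ge> \<tau>" using c by (simp add: \<tau>_def)
        then have "?\<phi> i ?t = 1" for i by simp
        then show ?thesis using True A by simp
      next
        case False
        then have lt: "?t < \<tau>" using c by (simp add: \<tau>_def)
        then obtain n where n: "real n * (\<tau> - ?t) > 1"
          using reals_Archimedean3[of "\<tau> - ?t"] by auto
        have "?\<phi> i ?t = 0" if "i \<ge> n" for i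
        proof -
          have "real n * (\<tau> - ?t) \<le> real i * (\<tau> - ?t)" using that lt by (intro mult_right_mono) auto
          then have "1 + real i * (?t - \<tau>) < 0" using n by (simp add: algebra_simps)
          then show ?thesis by simp
        qed
        then have "(\<lambda>i. ?\<phi> i ?t) \<longlonglongrightarrow> 0"
          by (intro tendsto_eventually) (auto simp: eventually_sequentially)
        then show ?thesis using False A by simp
      qed
      then show "(\<lambda>i. complex_of_real (exp (- c * x) * ?\<phi> i ?t)) \<longlonglongrightarrow> complex_of_real (exp (- c * x) * indicator A x)"
        by (intro tendsto_intros)
    qed
  next
    case empty
    then show ?case using expoly_closure_poly[of 0] by simp
  next
    case (compl A)
    have "(\<lambda>x. exp (- c * x) *\<^sub>R poly 1 (complex_of_real x) + (-1) * complex_of_real (exp (- c * x) * indicator A x)) \<in> expoly_closure a c"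
      by (intro expoly_closure_add expoly_closure_poly expoly_closure_cmult compl.IH)
    moreover have "(\<lambda>x. exp (- c * x) *\<^sub>R poly 1 (complex_of_real x) + (-1) * complex_of_real (exp (- c * x) * indicator A x))
       = (\<lambda>x. complex_of_real (exp (- c * x) * indicator (UNIV - A) x))"
      by (auto simp: fun_eq_iff indicator_def scaleR_conv_of_real)
    ultimately show ?case by simp
  next
    case (union A)
    show ?case
    proof (rule expoly_closure_limit[where F = "\<lambda>n x. \<Sum>i<n. complex_of_real (exp (- c * x) * indicator (A i) x)"
          and g = "\<lambda>x. 1 * (exp (- c * x) * x ^ 0)"])
      show "(\<lambda>x. \<Sum>i<n. complex_of_real (exp (- c * x) * indicator (A i) x)) \<in> expoly_closure a c" for n
        by (intro expoly_closure_sum union.IH)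
      show "set_integrable lebesgue {0<..} (\<lambda>x. (1 * (exp (- c * x) * x ^ 0))\<^sup>2 * x powr a)"
        by (rule exp_square_integrable[OF c])
      have F: "(\<Sum>i<n. complex_of_real (exp (- c * x) * indicator (A i) x))
          = complex_of_real (exp (- c * x) * (\<Sum>i<n. indicator (A i) x))" for n x
        by (simp only: of_real_sum of_real_mult sum_distrib_left)
      have s: "(\<Sum>i<n. indicat_real (A i) x) \<le> indicat_real (\<Union>i. A i) x"
              "(\<lambda>n. (\<Sum>i<n. indicat_real (A i) x)) \<longlonglongrightarrow> indicat_real (\<Union>i. A i) x" for n x
      proof -
        have sm: "(\<lambda>i. indicat_real (A i) x) sums indicat_real (\<Union>i. A i) x"
          by (rule indicator_sums) (use union in \<open>auto simp: disjoint_family_on_def\<close>)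
        then show "(\<lambda>n. (\<Sum>i<n. indicat_real (A i) x)) \<longlonglongrightarrow> indicat_real (\<Union>i. A i) x" by (simp add: sums_def)
        show "(\<Sum>i<n. indicat_real (A i) x) \<le> indicat_real (\<Union>i. A i) x"
          using sum_le_suminf[OF sums_summable[OF sm], of "{..<n}"] sums_unique[OF sm] by auto
      qed
      fix x :: real assume "x > 0"
      show "cmod (\<Sum>i<n. complex_of_real (exp (- c * x) * indicator (A i) x)) \<le> 1 * (exp (- c * x) * x ^ 0)" for n
      proof -
        have "(\<Sum>i<n. indicat_real (A i) x) \<le> 1" by (rule order_trans[OF s(1)]) simp
        moreover have "(\<Sum>i<n. indicat_real (A i) x) \<ge> 0" by (intro sum_nonneg) simp
        ultimately show ?thesis unfolding F norm_of_real by (simp add: abs_mult)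
      qed
      show "(\<lambda>n. \<Sum>i<n. complex_of_real (exp (- c * x) * indicator (A i) x)) \<longlonglongrightarrow> complex_of_real (exp (- c * x) * indicator (\<Union>i. A i) x)"
        unfolding F by (intro tendsto_intros s(2))
    qed
  qed
qed

lemma expoly_closure_lebesgue_set:
  assumes A: "A \<in> sets lebesgue"
  shows "(\<lambda>x. complex_of_real (exp (- c * x) * indicator A x)) \<in> expoly_closure a c"
proof -
  let ?f = "\<lambda>A x. complex_of_real (exp (- c * x) * indicator A x)"
  let ?B = "main_part lborel A"
  have B: "?B \<in> sets borel" using A main_part_sets by fastforce
  have fB: "?f ?B \<in> expoly_closure a c" by (rule expoly_closure_borel_set[OF B])
  have "AE x in lebesgue. x \<in> ?B \<longleftrightarrow> x \<in> A" using A AE_in_main_part AE_completion_iff by blast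
  then have ae: "AE x in lebesgue. weighted a (?f A) x = weighted a (?f ?B) x"
    by eventually_elim (simp add: weighted_def indicator_def)
  have m: "weighted a (?f A) \<in> borel_measurable lebesgue"
    unfolding weighted_measurable_iff set_borel_measurable_def
  proof -
    have 1: "(\<lambda>x. complex_of_real (exp (- c * x))) \<in> borel_measurable lebesgue"
      by (rule measurable_completion) measurable
    have 2: "indicat_real {0::real<..} \<in> borel_measurable lebesgue"
      by (rule borel_measurable_indicator) auto
    have "(\<lambda>x. (indicat_real {0<..} x * indicat_real A x) *\<^sub>R complex_of_real (exp (- c * x))) \<in> borel_measurable lebesgue"
      by (intro borel_measurable_scaleR borel_measurable_times 1 2 borel_measurable_indicator A)
    then show "(\<lambda>x. indicat_real {0<..} x *\<^sub>R ?f A x) \<in> borel_measurable lebesgue"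
      by (simp add: scaleR_conv_of_real mult_ac)
  qed
  have BL: "weighted a (?f ?B) \<in> L2 lebesgue" using fB by (simp add: expoly_closure_def wL2_iff)
  have AL: "?f A \<in> wL2 a"
    unfolding wL2_iff L2_def mem_Collect_eq
  proof
    show "integrable lebesgue (\<lambda>x. (cmod (weighted a (?f A) x))\<^sup>2)"
    proof (rule integrable_cong_AE_imp)
      show "integrable lebesgue (\<lambda>x. (cmod (weighted a (?f ?B) x))\<^sup>2)" using BL by (simp add: L2_def)
      show "(\<lambda>x. (cmod (weighted a (?f A) x))\<^sup>2) \<in> borel_measurable lebesgue" using m by measurable
      show "AE x in lebesgue. (cmod (weighted a (?f ?B) x))\<^sup>2 = (cmod (weighted a (?f A) x))\<^sup>2"
        using ae by eventually_elim simp
    qed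
  qed (rule m)
  show ?thesis
  proof (rule expoly_closureI[OF AL])
    fix e :: real assume "e > 0"
    have "sq_norm lebesgue (weighted a (\<lambda>x. ?f A x - ?f ?B x)) = 0"
      unfolding sq_norm_def
    proof (rule integral_eq_zero_AE)
      show "AE x in lebesgue. (cmod (weighted a (\<lambda>x. ?f A x - ?f ?B x) x))\<^sup>2 = 0"
        using ae by eventually_elim (simp add: weighted_diff)
    qed
    with fB \<open>e > 0\<close> show "\<exists>g\<in>expoly_closure a c. sq_norm lebesgue (weighted a (\<lambda>x. ?f A x - g x)) < e"
      by force
  qed
qed

text \<open>
  After division by \<open>exp (- c x)\<close> the function is a limit of simple functions of at most twice its
  modulus.
\<close>

lemma exp_polys_dense:
  assumes f: "f \<in> wL2 a"
  shows "f \<in> expoly_closure a c"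
proof -
  let ?F = "\<lambda>x. complex_of_real (exp (c * x) * indicator {0<..} x) * f x"
  have "(\<lambda>x. complex_of_real (exp (c * x))) \<in> borel_measurable lebesgue"
    by (rule measurable_completion) measurable
  moreover have "(\<lambda>x. indicat_real {0<..} x *\<^sub>R f x) \<in> borel_measurable lebesgue"
    using f by (simp add: wL2_def set_borel_measurable_def)
  ultimately have "(\<lambda>x. complex_of_real (exp (c * x)) * (indicat_real {0<..} x *\<^sub>R f x)) \<in> borel_measurable lebesgue"
    by measurable
  then have F: "?F \<in> borel_measurable lebesgue"
    by (simp add: scaleR_conv_of_real mult_ac)
  from borel_measurable_implies_sequence_metric[OF F, of 0] obtain s
    where s: "\<And>i. simple_function lebesgue (s i)"
      and lim: "\<And>x. (\<lambda>i. s i x) \<longlonglongrightarrow> ?F x"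
      and bnd: "\<And>i x. cmod (s i x) \<le> 2 * cmod (?F x)"
    by (auto simp: dist_norm)
  show ?thesis
  proof (rule expoly_closure_limit[where F = "\<lambda>i x. exp (- c * x) *\<^sub>R s i x" and g = "\<lambda>x. 2 * cmod (f x)"])
    fix i
    have "(\<lambda>x. \<Sum>y\<in>s i ` space lebesgue. y * complex_of_real (exp (- c * x) * indicator (s i -` {y} \<inter> space lebesgue) x)) \<in> expoly_closure a c"
      by (intro expoly_closure_sum expoly_closure_cmult expoly_closure_lebesgue_set simple_functionD(2)[OF s])
    moreover have "(\<Sum>y\<in>s i ` space lebesgue. y * complex_of_real (exp (- c * x) * indicator (s i -` {y} \<inter> space lebesgue) x))
      = exp (- c * x) *\<^sub>R s i x" for x
    proof -
      have "s i x = (\<Sum>y\<in>s i ` space lebesgue. indicator (s i -` {y} \<inter> space lebesgue) x *\<^sub>R y)"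
        by (rule simple_function_indicator_representation_banach[OF s]) simp
      note rep = this
      have "(\<Sum>y\<in>s i ` space lebesgue. y * complex_of_real (exp (- c * x) * indicator (s i -` {y} \<inter> space lebesgue) x))
        = (\<Sum>y\<in>s i ` space lebesgue. exp (- c * x) *\<^sub>R (indicat_real (s i -` {y} \<inter> space lebesgue) x *\<^sub>R y))"
        by (intro sum.cong refl) (simp add: scaleR_conv_of_real mult_ac)
      also have "\<dots> = exp (- c * x) *\<^sub>R s i x"
        unfolding scaleR_sum_right[symmetric] rep[symmetric] ..
      finally show ?thesis .
    qed
    ultimately show "(\<lambda>x. exp (- c * x) *\<^sub>R s i x) \<in> expoly_closure a c" by simp
  next
    have "set_integrable lebesgue {0<..} (\<lambda>x. 4 * ((cmod (f x))\<^sup>2 * x powr a))"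
      by (rule set_integrable_mult_right) (use f in \<open>simp add: wL2_def\<close>)
    then show "set_integrable lebesgue {0<..} (\<lambda>x. (2 * cmod (f x))\<^sup>2 * x powr a)"
      by (simp add: power_mult_distrib mult.assoc)
  next
    fix i and x :: real assume "x > 0"
    have "exp (- c * x) * cmod (s i x) \<le> exp (- c * x) * (2 * (exp (c * x) * cmod (f x)))"
      using bnd[of i x] \<open>x > 0\<close> by (intro mult_left_mono) (auto simp: norm_mult)
    then show "cmod (exp (- c * x) *\<^sub>R s i x) \<le> 2 * cmod (f x)"
      by (simp add: exp_minus field_simps)
  next
    fix x :: real assume "x > 0"
    have "(\<lambda>i. exp (- c * x) *\<^sub>R s i x) \<longlonglongrightarrow> exp (- c * x) *\<^sub>R ?F x"
      by (intro tendsto_intros lim)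
    also have "exp (- c * x) *\<^sub>R ?F x = f x"
      using \<open>x > 0\<close> by (simp add: scaleR_conv_of_real exp_minus flip: of_real_mult mult.assoc)
    finally show "(\<lambda>i. exp (- c * x) *\<^sub>R s i x) \<longlonglongrightarrow> f x" .
  qed
qed

end

section \<open>Laguerre functions\<close>

text \<open>
  This is \<open>n! / \<Gamma>(n + \<alpha> + 1)\<close> times the classical Laguerre polynomial with parameter \<open>\<alpha>\<close> at \<open>c x\<close>.
  Dividing the coefficient of \<open>x ^ i\<close> by \<open>\<Gamma>(\<alpha> + i + 1)\<close> is what turns moments into fractional
  integrals at \<open>0\<close>.
\<close>

definition laguerre :: "real \<Rightarrow> real \<Rightarrow> nat \<Rightarrow> complex poly" where
  "laguerre \<alpha> c n = (\<Sum>i\<le>n. monom (of_real ((-1) ^ i * real (n choose i) * c ^ i / Gamma (\<alpha> + real i + 1))) i)"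

definition lagfun :: "real \<Rightarrow> real \<Rightarrow> nat \<Rightarrow> real \<Rightarrow> complex" where
  "lagfun \<alpha> lam n x = exp (- lam * x) *\<^sub>R poly (laguerre \<alpha> (2 * lam) n) (complex_of_real x)"

lemma poly_laguerre:
  "poly (laguerre \<alpha> c n) (complex_of_real x)
    = of_real (\<Sum>i\<le>n. (-1) ^ i * real (n choose i) * c ^ i / Gamma (\<alpha> + real i + 1) * x ^ i)"
  by (simp add: laguerre_def poly_sum poly_monom)

lemma coeff_laguerre:
  "coeff (laguerre \<alpha> c n) i
    = (if i \<le> n then of_real ((-1) ^ i * real (n choose i) * c ^ i / Gamma (\<alpha> + real i + 1)) else 0)"
  by (simp add: laguerre_def coeff_sum)

lemma triangular_spans:
  fixes B :: "nat \<Rightarrow> 'a::field poly"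
  assumes nz: "\<And>n. coeff (B n) n \<noteq> 0" and B0: "\<And>n i. i > n \<Longrightarrow> coeff (B n) i = 0"
    and p0: "\<And>i. i \<ge> n \<Longrightarrow> coeff p i = 0"
  shows "\<exists>a. p = (\<Sum>i<n. smult (a i) (B i))"
  using p0
proof (induction n arbitrary: p)
  case 0
  then have "p = 0" by (simp add: poly_eq_iff)
  then show ?case by simp
next
  case (Suc n)
  define k where "k = coeff p n / coeff (B n) n"
  have "coeff (p - smult k (B n)) i = 0" if "i \<ge> n" for i
  proof (cases "i = n")
    case True
    then show ?thesis using nz by (simp add: k_def)
  next
    case False
    then show ?thesis using that Suc.prems[of i] by (simp add: B0)
  qed
  then obtain a where a: "p - smult k (B n) = (\<Sum>i<n. smult (a i) (B i))"
    using Suc.IH by blast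
  have "(\<Sum>i<n. smult ((a(n := k)) i) (B i)) = (\<Sum>i<n. smult (a i) (B i))"
    by (intro sum.cong) auto
  then have "p = (\<Sum>i<Suc n. smult ((a(n := k)) i) (B i))"
    using a by (simp add: algebra_simps)
  then show ?case by blast
qed

lemma laguerre_spans:
  assumes "\<alpha> > -1" "c > 0" and "degree p < n"
  shows "\<exists>a. p = (\<Sum>i<n. smult (a i) (laguerre \<alpha> c i))"
proof (rule triangular_spans)
  fix m :: nat
  have "Gamma (\<alpha> + real m + 1) > 0" using assms(1) by (intro Gamma_real_pos) linarith
  then show "coeff (laguerre \<alpha> c m) m \<noteq> 0" using assms(2) by (simp add: coeff_laguerre)
qed (use assms(3) in \<open>auto simp: coeff_laguerre coeff_eq_0\<close>)

text \<open>
  The left side is, up to sign, an \<open>n\<close>-th finite difference; by Pascal's rule each difference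
  lowers the lower index of the binomial coefficient by one.
\<close>

lemma alternating_binomial_gchoose:
  fixes z :: real
  shows "(\<Sum>i\<le>n. (-1) ^ i * real (n choose i) * ((z + real i) gchoose j))
    = (-1) ^ n * (if n \<le> j then z gchoose (j - n) else 0)"
proof (induction n arbitrary: z)
  case 0
  then show ?case by simp
next
  case (Suc n)
  let ?f = "\<lambda>i. (z + real i) gchoose j"
  have "(\<Sum>i\<le>Suc n. (-1) ^ i * real (Suc n choose i) * ?f i)
      = ?f 0 + (\<Sum>i\<le>n. (-1) ^ Suc i * real (Suc n choose Suc i) * ?f (Suc i))"
    by (subst sum.atMost_Suc_shift) simp
  also have "(\<Sum>i\<le>n. (-1) ^ Suc i * real (Suc n choose Suc i) * ?f (Suc i))
      = (\<Sum>i\<le>n. (-1) ^ Suc i * real (n choose Suc i) * ?f (Suc i))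
        - (\<Sum>i\<le>n. (-1) ^ i * real (n choose i) * ?f (Suc i))"
    unfolding sum_subtractf[symmetric]
    by (intro sum.cong refl) (simp add: algebra_simps)
  also have "?f 0 + (\<dots>) = (?f 0 + (\<Sum>i\<le>n. (-1) ^ Suc i * real (n choose Suc i) * ?f (Suc i)))
        - (\<Sum>i\<le>n. (-1) ^ i * real (n choose i) * ?f (Suc i))" by simp
  also have "?f 0 + (\<Sum>i\<le>n. (-1) ^ Suc i * real (n choose Suc i) * ?f (Suc i))
      = (\<Sum>i\<le>Suc n. (-1) ^ i * real (n choose i) * ?f i)"
    by (subst sum.atMost_Suc_shift) simp
  also have "\<dots> = (\<Sum>i\<le>n. (-1) ^ i * real (n choose i) * ?f i)" by simp
  also have "\<dots> = (-1) ^ n * (if n \<le> j then z gchoose (j - n) else 0)" by (rule Suc.IH)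
  also have "(\<Sum>i\<le>n. (-1) ^ i * real (n choose i) * ?f (Suc i))
      = (-1) ^ n * (if n \<le> j then (z + 1) gchoose (j - n) else 0)"
    using Suc.IH[of "z + 1"] by (simp add: add_ac)
  also have "(-1) ^ n * (if n \<le> j then z gchoose (j - n) else 0)
       - (-1) ^ n * (if n \<le> j then (z + 1) gchoose (j - n) else 0)
      = (-1) ^ Suc n * (if Suc n \<le> j then z gchoose (j - Suc n) else 0)"
  proof (cases "Suc n \<le> j")
    case True
    then obtain k where "j - n = Suc k" "j - Suc n = k" by (metis Suc_diff_le diff_Suc_Suc)
    then show ?thesis using True gbinomial_Suc_Suc[of z k] by (simp add: algebra_simps)
  qed (cases "n = j"; simp)
  finally show ?case .
qed

lemma Gamma_ratio_gchoose:
  fixes z :: real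
  assumes "z > 0"
  shows "Gamma (z + real j) / Gamma z = fact j * ((z + real j - 1) gchoose j)"
proof -
  have "z \<notin> \<int>\<^sub>\<le>\<^sub>0" using assms by (auto elim!: nonpos_Ints_cases)
  then have "Gamma (z + real j) / Gamma z = pochhammer z j"
    using pochhammer_Gamma[of z j] by simp
  then show ?thesis by (simp add: gbinomial_pochhammer')
qed

text \<open>
  The moment of order \<open>\<alpha> + i\<close> of \<open>exp (- lam x) f\<close> divided by \<open>\<Gamma>(\<alpha> + i + 1)\<close> is the right
  fractional integral of order \<open>\<alpha> + i + 1\<close> at \<open>0\<close>; the remaining factors do not involve \<open>\<alpha>\<close>.
\<close>

lemma winner_lagfun:
  assumes "\<alpha> > -1" "lam > 0" "f \<in> wL2 \<alpha>"
  shows "winner \<alpha> f (lagfun \<alpha> lam n)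
    = (\<Sum>i\<le>n. of_real ((-1) ^ i * real (n choose i) * (2 * lam) ^ i)
        * rfrac_integral (\<alpha> + real i + 1) (\<lambda>y. exp (- lam * y) *\<^sub>R f y) 0)"
proof -
  let ?w = "\<lambda>i. (-1) ^ i * real (n choose i) * (2 * lam) ^ i / Gamma (\<alpha> + real i + 1)"
  let ?g = "\<lambda>i y. (y - 0) powr (\<alpha> + real i + 1 - 1) *\<^sub>R (exp (- lam * y) *\<^sub>R f y)"
  have pw: "x powr (\<alpha> + real i) = x ^ i * x powr \<alpha>" if "x > 0" for x i
    using that by (simp add: powr_add powr_realpow mult.commute)
  have int: "integrable lebesgue (\<lambda>y. indicat_real {0<..} y *\<^sub>R ?g i y)" for i
  proof -
    have "integrable lebesgue (\<lambda>x. weighted \<alpha> f x * cnj (weighted \<alpha> (\<lambda>x. exp (- lam * x) *\<^sub>R complex_of_real x ^ i) x))"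
      using L2_mult_integrable[OF assms(3)[unfolded wL2_iff] exp_monom_wL2[OF assms(1,2), of i, unfolded wL2_iff]] .
    also have "(\<lambda>x. weighted \<alpha> f x * cnj (weighted \<alpha> (\<lambda>x. exp (- lam * x) *\<^sub>R complex_of_real x ^ i) x))
        = (\<lambda>y. indicat_real {0<..} y *\<^sub>R ?g i y)"
    proof
      fix x :: real
      show "weighted \<alpha> f x * cnj (weighted \<alpha> (\<lambda>x. exp (- lam * x) *\<^sub>R complex_of_real x ^ i) x) = indicat_real {0<..} x *\<^sub>R ?g i x"
      proof (cases "x > 0")
        case True
        have "weighted \<alpha> f x * cnj (weighted \<alpha> (\<lambda>x. exp (- lam * x) *\<^sub>R complex_of_real x ^ i) x)
          = of_real (x powr (\<alpha>/2) * x powr (\<alpha>/2)) * (of_real (exp (- lam * x)) * (of_real (x ^ i) * f x))"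
          using True by (simp add: weighted_def scaleR_conv_of_real mult_ac)
        also have "x powr (\<alpha>/2) * x powr (\<alpha>/2) = x powr \<alpha>" by (simp flip: powr_add)
        finally show ?thesis using True by (simp add: pw scaleR_conv_of_real mult_ac)
      qed (simp add: weighted_def)
    qed
    finally show ?thesis .
  qed
  have "winner \<alpha> f (lagfun \<alpha> lam n)
      = (\<integral>y. (\<Sum>i\<le>n. of_real (?w i) * (indicat_real {0<..} y *\<^sub>R ?g i y)) \<partial>lebesgue)"
    unfolding winner_def set_lebesgue_integral_def
  proof (rule Bochner_Integration.integral_cong[OF refl])
    fix x :: real
    show "indicat_real {0<..} x *\<^sub>R (f x * cnj (lagfun \<alpha> lam n x) * complex_of_real (x powr \<alpha>))
       = (\<Sum>i\<le>n. of_real (?w i) * (indicat_real {0<..} x *\<^sub>R ?g i x))"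
    proof (cases "x > 0")
      case True
      let ?r = "complex_of_real (x powr \<alpha> * exp (- lam * x)) * f x"
      have "indicat_real {0<..} x *\<^sub>R (f x * cnj (lagfun \<alpha> lam n x) * complex_of_real (x powr \<alpha>))
        = complex_of_real (\<Sum>i\<le>n. ?w i * x ^ i) * ?r"
        unfolding lagfun_def poly_laguerre using True by (simp add: scaleR_conv_of_real mult_ac)
      also have "\<dots> = (\<Sum>i\<le>n. complex_of_real (?w i * x ^ i) * ?r)"
        by (simp only: of_real_sum sum_distrib_right)
      also have "\<dots> = (\<Sum>i\<le>n. of_real (?w i) * (indicat_real {0<..} x *\<^sub>R ?g i x))"
        using True by (intro sum.cong refl) (simp add: pw scaleR_conv_of_real mult_ac)
      finally show ?thesis .
    qed simp
  qed
  also have "\<dots> = (\<Sum>i\<le>n. of_real (?w i) * (\<integral>y. indicat_real {0<..} y *\<^sub>R ?g i y \<partial>lebesgue))"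
    unfolding integral_mult_right_zero[symmetric]
    by (rule Bochner_Integration.integral_sum) (intro integrable_mult_right int)
  also have "\<dots> = (\<Sum>i\<le>n. of_real ((-1) ^ i * real (n choose i) * (2 * lam) ^ i)
        * rfrac_integral (\<alpha> + real i + 1) (\<lambda>y. exp (- lam * y) *\<^sub>R f y) 0)"
    unfolding rfrac_integral_def set_lebesgue_integral_def
    by (intro sum.cong) (simp_all add: scaleR_conv_of_real)
  finally show ?thesis .
qed

lemma rfrac_integral_exp_monom_0:
  assumes "\<mu> > 0" "lam > 0"
  shows "rfrac_integral \<mu> (\<lambda>y. exp (- lam * y) *\<^sub>R (exp (- lam * y) *\<^sub>R complex_of_real y ^ j)) 0
    = of_real (Gamma (\<mu> + j) / Gamma \<mu> / (2 * lam) powr (\<mu> + j))"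
proof -
  have "indicat_real {0<..} y *\<^sub>R ((y - 0) powr (\<mu> - 1) *\<^sub>R (exp (- lam * y) *\<^sub>R (exp (- lam * y) *\<^sub>R complex_of_real y ^ j)))
     = complex_of_real (indicat_real {0<..} y *\<^sub>R (y powr (\<mu> + j - 1) * exp (- (2 * lam) * y)))" for y
  proof (cases "y > 0")
    case True
    have "y powr (\<mu> + j - 1) = y powr (\<mu> - 1) * y ^ j"
      using True by (simp add: powr_realpow[symmetric] algebra_simps flip: powr_add)
    moreover have "exp (- (2 * lam) * y) = exp (- lam * y) * exp (- lam * y)"
      by (simp flip: exp_add)
    ultimately show ?thesis using True by (simp add: scaleR_conv_of_real mult_ac)
  qed simp
  then have "(LINT y:{0<..}|lebesgue. (y - 0) powr (\<mu> - 1) *\<^sub>R (exp (- lam * y) *\<^sub>R (exp (- lam * y) *\<^sub>R complex_of_real y ^ j)))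
     = complex_of_real (LINT y:{0<..}|lebesgue. y powr (\<mu> + j - 1) * exp (- (2 * lam) * y))"
    unfolding set_lebesgue_integral_def by (simp only: integral_complex_of_real)
  also have "(LINT y:{0<..}|lebesgue. y powr (\<mu> + j - 1) * exp (- (2 * lam) * y))
     = Gamma (\<mu> + j) / (2 * lam) powr (\<mu> + j)"
    by (rule integral_powr_exp) (use assms in auto)
  finally show ?thesis unfolding rfrac_integral_def by (simp add: scaleR_conv_of_real)
qed

text \<open>
  The moments of an exponential monomial are Gamma values, whose quotients are binomial
  coefficients of the summation index; their finite difference is known in closed form.
\<close>

lemma winner_monom_lagfun:
  assumes "\<alpha> > -1" "lam > 0"
  shows "winner \<alpha> (\<lambda>x. exp (- lam * x) *\<^sub>R complex_of_real x ^ j) (lagfun \<alpha> lam n)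
    = of_real (fact j / (2 * lam) powr (\<alpha> + j + 1) * ((-1) ^ n * (if n \<le> j then (\<alpha> + j) gchoose (j - n) else 0)))"
proof -
  have "rfrac_integral (\<alpha> + real i + 1) (\<lambda>y. exp (- lam * y) *\<^sub>R (exp (- lam * y) *\<^sub>R complex_of_real y ^ j)) 0
     = of_real (fact j / (2 * lam) powr (\<alpha> + j + 1) * (((\<alpha> + j) + real i) gchoose j) / (2 * lam) ^ i)" for i
  proof -
    have pos: "\<alpha> + real i + 1 > 0" using assms by linarith
    have "Gamma (\<alpha> + real i + 1 + real j) / Gamma (\<alpha> + real i + 1)
        = fact j * (((\<alpha> + j) + real i) gchoose j)"
      unfolding Gamma_ratio_gchoose[OF pos] by (simp add: algebra_simps)
    moreover have "(2 * lam) powr (\<alpha> + real i + 1 + j) = (2 * lam) powr (\<alpha> + j + 1) * (2 * lam) ^ i"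
    proof -
      have "(2 * lam) ^ i = (2 * lam) powr real i" using assms by (simp add: powr_realpow)
      then show ?thesis by (simp add: add_ac flip: powr_add)
    qed
    ultimately show ?thesis
      unfolding rfrac_integral_exp_monom_0[OF pos assms(2)] by (simp add: mult_ac)
  qed
  then have "winner \<alpha> (\<lambda>x. exp (- lam * x) *\<^sub>R complex_of_real x ^ j) (lagfun \<alpha> lam n)
    = (\<Sum>i\<le>n. complex_of_real ((-1) ^ i * real (n choose i) * (2 * lam) ^ i)
       * of_real (fact j / (2 * lam) powr (\<alpha> + j + 1) * (((\<alpha> + j) + real i) gchoose j) / (2 * lam) ^ i))"
    unfolding winner_lagfun[OF assms exp_monom_wL2[OF assms]] by simp
  also have "\<dots> = of_real (fact j / (2 * lam) powr (\<alpha> + j + 1)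
      * (\<Sum>i\<le>n. (-1) ^ i * real (n choose i) * (((\<alpha> + j) + real i) gchoose j)))"
    unfolding sum_distrib_left of_real_sum of_real_mult[symmetric]
    by (intro sum.cong refl arg_cong[where f = of_real]) (use assms in simp)
  finally show ?thesis unfolding alternating_binomial_gchoose .
qed

lemma lagfun_wL2: "\<alpha> > -1 \<Longrightarrow> lam > 0 \<Longrightarrow> lagfun \<beta> lam n \<in> wL2 \<alpha>"
  unfolding lagfun_def[abs_def] by (rule exp_poly_wL2)

lemma winner_cnj: "winner a g f = cnj (winner a f g)"
  unfolding winner_L2_inner by (rule L2_inner_cnj)

lemma winner_cmult_left: "winner a (\<lambda>x. k * f x) g = k * winner a f g"
  unfolding winner_L2_inner weighted_cmult by (rule L2_inner_cmult_left)

lemma winner_sum_left: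
  "(\<And>i. i \<in> A \<Longrightarrow> f i \<in> wL2 a) \<Longrightarrow> g \<in> wL2 a \<Longrightarrow>
    winner a (\<lambda>x. \<Sum>i\<in>A. f i x) g = (\<Sum>i\<in>A. winner a (f i) g)"
  unfolding winner_L2_inner weighted_sum wL2_iff by (rule L2_inner_sum_left)

lemma winner_diff_left:
  "f \<in> wL2 a \<Longrightarrow> g \<in> wL2 a \<Longrightarrow> h \<in> wL2 a \<Longrightarrow>
    winner a (\<lambda>x. f x - g x) h = winner a f h - winner a g h"
  unfolding winner_L2_inner weighted_diff wL2_iff by (rule L2_inner_diff_left)

text \<open>
  By \<open>winner_monom_lagfun\<close> only the leading term of the left factor can contribute.
\<close>

lemma winner_lagfun_le:
  assumes "\<alpha> > -1" "lam > 0" "m \<le> n"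
  shows "winner \<alpha> (lagfun \<alpha> lam m) (lagfun \<alpha> lam n)
    = (if m = n then of_real (fact n / Gamma (\<alpha> + n + 1) / (2 * lam) powr (\<alpha> + 1)) else 0)"
proof -
  let ?c = "\<lambda>i. coeff (laguerre \<alpha> (2 * lam) m) i"
  let ?e = "\<lambda>i x. exp (- lam * x) *\<^sub>R complex_of_real x ^ i"
  have "lagfun \<alpha> lam m = (\<lambda>x. \<Sum>i\<le>m. ?c i * ?e i x)"
    by (auto simp: fun_eq_iff lagfun_def laguerre_def poly_sum poly_monom coeff_sum scaleR_sum_right intro!: sum.cong)
  then have "winner \<alpha> (lagfun \<alpha> lam m) (lagfun \<alpha> lam n) = winner \<alpha> (\<lambda>x. \<Sum>i\<le>m. ?c i * ?e i x) (lagfun \<alpha> lam n)"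
    by (simp only:)
  also have "\<dots> = (\<Sum>i\<le>m. winner \<alpha> (\<lambda>x. ?c i * ?e i x) (lagfun \<alpha> lam n))"
    by (intro winner_sum_left wL2_cmult exp_monom_wL2 lagfun_wL2 assms)
  also have "\<dots> = (\<Sum>i\<le>m. ?c i * winner \<alpha> (?e i) (lagfun \<alpha> lam n))"
    unfolding winner_cmult_left ..
  also have "\<dots> = (\<Sum>i\<le>m. if i = n then ?c n * winner \<alpha> (?e n) (lagfun \<alpha> lam n) else 0)"
  proof (intro sum.cong refl)
    fix i assume "i \<in> {..m}"
    then have "i = n \<or> i < n" using assms(3) by auto
    then show "?c i * winner \<alpha> (?e i) (lagfun \<alpha> lam n) = (if i = n then ?c n * winner \<alpha> (?e n) (lagfun \<alpha> lam n) else 0)"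
      unfolding winner_monom_lagfun[OF assms(1,2)] by auto
  qed
  also have "\<dots> = (if m = n then ?c n * winner \<alpha> (?e n) (lagfun \<alpha> lam n) else 0)"
    using assms(3) by (auto simp: sum.delta)
  also have "?c n * winner \<alpha> (?e n) (lagfun \<alpha> lam n)
     = of_real (fact n / Gamma (\<alpha> + n + 1) / (2 * lam) powr (\<alpha> + 1))" if "m = n"
  proof -
    have "(2 * lam) powr (\<alpha> + n + 1) = (2 * lam) ^ n * (2 * lam) powr (\<alpha> + 1)"
    proof -
      have "(2 * lam) ^ n = (2 * lam) powr real n" using assms by (simp add: powr_realpow)
      then show ?thesis by (simp add: add_ac flip: powr_add)
    qed
    moreover have "((-1) ^ n * (-1) ^ n :: real) = 1" by (simp flip: power_mult_distrib)
    ultimately show ?thesis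
      unfolding winner_monom_lagfun[OF assms(1,2)] coeff_laguerre that using assms
      by (simp add: field_simps flip: of_real_mult of_real_power of_real_divide)
  qed
  ultimately show ?thesis by simp
qed

definition lagnorm :: "real \<Rightarrow> real \<Rightarrow> nat \<Rightarrow> real" where
  "lagnorm \<alpha> lam n = fact n / Gamma (\<alpha> + n + 1) / (2 * lam) powr (\<alpha> + 1)"

lemma L2_orthogonal_lagfun:
  assumes "\<alpha> > -1" "lam > 0"
  shows "L2_orthogonal lebesgue (\<lambda>n. weighted \<alpha> (lagfun \<alpha> lam n)) (lagnorm \<alpha> lam)"
proof
  fix m n :: nat
  show "weighted \<alpha> (lagfun \<alpha> lam n) \<in> L2 lebesgue" using lagfun_wL2[OF assms] by (simp add: wL2_iff)
  show "sq_norm lebesgue (weighted \<alpha> (lagfun \<alpha> lam n)) = lagnorm \<alpha> lam n"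
    using winner_lagfun_le[OF assms order_refl, of n] unfolding winner_L2_inner L2_inner_self lagnorm_def
    by (simp only: of_real_eq_iff if_True simp_thms)
  have "Gamma (\<alpha> + n + 1) > 0" using assms by (intro Gamma_real_pos) linarith
  then show "lagnorm \<alpha> lam n > 0" using assms by (simp add: lagnorm_def)
  assume "m \<noteq> n"
  then consider "m < n" | "n < m" by linarith
  then have "winner \<alpha> (lagfun \<alpha> lam m) (lagfun \<alpha> lam n) = 0"
  proof cases
    case 1
    then show ?thesis using winner_lagfun_le[OF assms, of m n] by simp
  next
    case 2
    then have "winner \<alpha> (lagfun \<alpha> lam n) (lagfun \<alpha> lam m) = 0" using winner_lagfun_le[OF assms, of n m] by simp
    then show ?thesis by (subst winner_cnj) simp
  qed
  then show "L2_inner lebesgue (weighted \<alpha> (lagfun \<alpha> lam m)) (weighted \<alpha> (lagfun \<alpha> lam n)) = 0" by (simp add: winner_L2_inner)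
qed

section \<open>Functions determined by their integrals over intervals\<close>

lemma sigma_finite_lebesgue: "sigma_finite_measure (lebesgue :: real measure)"
proof
  obtain A :: "real set set" where A: "countable A" "A \<subseteq> sets lborel" "\<Union>A = space lborel"
      "\<forall>a\<in>A. emeasure lborel a \<noteq> \<infinity>"
    using sigma_finite_measure.sigma_finite_countable[OF sigma_finite_lborel] by blast
  then show "\<exists>A. countable A \<and> A \<subseteq> sets (lebesgue :: real measure) \<and> \<Union>A = space lebesgue \<and> (\<forall>a\<in>A. emeasure lebesgue a \<noteq> \<infinity>)"
    by (intro exI[of _ A]) auto
qed

text \<open>
  Lebesgue measure is complete. So integrability and integrals over a set survive every change of
  a derivative or a representative on a null set.
\<close>

lemma borel_measurable_lebesgue_cong_AE:
  fixes f g :: "real \<Rightarrow> complex"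
  assumes f: "f \<in> borel_measurable lebesgue" and ae: "AE x in lebesgue. f x = g x"
  shows "g \<in> borel_measurable lebesgue"
proof (rule measurableI)
  fix A :: "complex set" assume A: "A \<in> sets borel"
  let ?D = "{x. (f x \<in> A) \<noteq> (g x \<in> A)}"
  have "AE x in lborel. \<not> ((f x \<in> A) \<noteq> (g x \<in> A))"
    using ae unfolding AE_completion_iff by eventually_elim auto
  then have D: "?D \<in> sets lebesgue"
    using sets_completion_AE[of "\<lambda>x. (f x \<in> A) \<noteq> (g x \<in> A)" lborel] by (simp add: pred_def)
  have F: "f -` A \<in> sets lebesgue" using measurable_sets[OF f A] by simp
  have "g -` A \<inter> space lebesgue = (f -` A - ?D) \<union> (?D - f -` A)" by auto
  also have "\<dots> \<in> sets lebesgue" using D F by blast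
  finally show "g -` A \<inter> space lebesgue \<in> sets lebesgue" .
qed simp

lemma
  fixes f g :: "real \<Rightarrow> complex"
  assumes ae: "AE x in lebesgue. x \<in> A \<longrightarrow> f x = g x"
  shows set_integrable_lebesgue_cong_AE: "set_integrable lebesgue A f \<longleftrightarrow> set_integrable lebesgue A g"
    and set_integral_lebesgue_cong_AE: "(LINT x:A|lebesgue. f x) = (LINT x:A|lebesgue. g x)"
proof -
  let ?f = "\<lambda>x. indicat_real A x *\<^sub>R f x" and ?g = "\<lambda>x. indicat_real A x *\<^sub>R g x"
  have ae1: "AE x in lebesgue. ?f x = ?g x" using ae by eventually_elim (auto simp: indicator_def)
  then have ae2: "AE x in lebesgue. ?g x = ?f x" by eventually_elim (rule sym)
  have m: "?f \<in> borel_measurable lebesgue \<longleftrightarrow> ?g \<in> borel_measurable lebesgue"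
    using borel_measurable_lebesgue_cong_AE[OF _ ae1] borel_measurable_lebesgue_cong_AE[OF _ ae2] by blast
  show *: "set_integrable lebesgue A f \<longleftrightarrow> set_integrable lebesgue A g"
    unfolding set_integrable_def
    using integrable_cong_AE_imp[OF _ _ ae1] integrable_cong_AE_imp[OF _ _ ae2] m
      borel_measurable_integrable by blast
  show "(LINT x:A|lebesgue. f x) = (LINT x:A|lebesgue. g x)"
  proof (cases "set_integrable lebesgue A f")
    case True
    then show ?thesis using * m ae1 unfolding set_lebesgue_integral_def set_integrable_def
      by (intro integral_cong_AE) auto
  next
    case False
    then show ?thesis using * unfolding set_lebesgue_integral_def set_integrable_def
      by (simp add: not_integrable_integral_eq)
  qed
qed

text \<open>
  A Dynkin argument extends the hypothesis from half-lines to Borel sets, and completeness of the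
  measure to Lebesgue sets; a function with vanishing integral over every set is zero.
\<close>

lemma AE_zero_if_initial_integrals_zero:
  fixes D :: "real \<Rightarrow> complex"
  assumes D: "integrable lebesgue D"
    and zero: "\<And>c. (LINT x:{..c}|lebesgue. D x) = 0" and total: "integral\<^sup>L lebesgue D = 0"
  shows "AE x in lebesgue. D x = 0"
proof -
  let ?P = "\<lambda>A. (LINT x:A|lebesgue. D x) = 0"
  have si: "set_integrable lebesgue A D" if "A \<in> sets lebesgue" for A
    unfolding set_integrable_def using integrable_mult_indicator[OF that D] .
  have borel: "?P A" if "A \<in> sets borel" for A
  proof -
    have "Int_stable (range (\<lambda>b::real. {..b}))" by (auto simp: Int_stable_def)
    moreover have "range (\<lambda>b::real. {..b}) \<subseteq> Pow UNIV" by simp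
    moreover have "A \<in> sigma_sets UNIV (range (\<lambda>b::real. {..b}))"
      using that by (simp add: borel_eq_atMost)
    ultimately show ?thesis
    proof (induction A rule: sigma_sets_induct_disjoint[consumes 3])
      case (basic A)
      then show ?case using zero by auto
    next
      case empty
      show ?case by (simp add: set_lebesgue_integral_def)
    next
      case (compl A)
      have A: "A \<in> sets borel" using compl.hyps by (simp add: borel_eq_atMost)
      then have "set_integrable lebesgue A D" "set_integrable lebesgue (UNIV - A) D" by (auto intro!: si)
      then have "(LINT x:A \<union> (UNIV - A)|lebesgue. D x) = (LINT x:A|lebesgue. D x) + (LINT x:UNIV - A|lebesgue. D x)"
        by (intro set_integral_Un) auto
      moreover have "(LINT x:A \<union> (UNIV - A)|lebesgue. D x) = 0"
        using total by (simp add: set_lebesgue_integral_def)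
      ultimately show ?case using compl.IH by simp
    next
      case (union A)
      have A: "A i \<in> sets borel" for i using union.hyps by (auto simp: borel_eq_atMost)
      have "(LINT x:(\<Union>i. A i)|lebesgue. D x) = (\<Sum>i. (LINT x:A i|lebesgue. D x))"
      proof (rule lebesgue_integral_countable_add)
        show "A i \<in> sets lebesgue" for i using A by auto
        show "A i \<inter> A j = {}" if "i \<noteq> j" for i j using union.hyps(1) that by (auto simp: disjoint_family_on_def)
        show "set_integrable lebesgue (\<Union>i. A i) D" using A by (intro si) auto
      qed
      then show ?case using union.IH by simp
    qed
  qed
  show ?thesis
  proof (rule sigma_finite_measure.density_zero[OF sigma_finite_lebesgue D])
    fix A :: "real set" assume A: "A \<in> sets lebesgue"
    let ?B = "main_part lborel A"
    have B: "?B \<in> sets borel" using A main_part_sets by fastforce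
    have "AE x in lebesgue. x \<in> ?B \<longleftrightarrow> x \<in> A" using A AE_in_main_part AE_completion_iff by blast
    then have "(LINT x:A|lebesgue. D x) = (LINT x:?B|lebesgue. D x)"
      unfolding set_lebesgue_integral_def
      using integrable_mult_indicator[OF A D] integrable_mult_indicator[of ?B lebesgue D] B D
      by (intro integral_cong_AE) (auto elim!: eventually_mono simp: indicator_def)
    then show "?P A" using borel[OF B] by simp
  qed
qed

lemma AE_zero_if_interval_integrals_zero:
  fixes g :: "real \<Rightarrow> complex"
  assumes int: "\<And>a b. 0 < a \<Longrightarrow> a \<le> b \<Longrightarrow> set_integrable lebesgue {a..b} g"
    and zero: "\<And>a b. 0 < a \<Longrightarrow> a \<le> b \<Longrightarrow> (LINT x:{a..b}|lebesgue. g x) = 0"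
  shows "AE x in lebesgue. 0 < x \<longrightarrow> g x = 0"
proof -
  have "AE x in lebesgue. x \<in> {1 / Suc n..real (Suc n)} \<longrightarrow> g x = 0" for n
  proof -
    let ?a = "1 / real (Suc n)" and ?b = "real (Suc n)"
    let ?D = "\<lambda>x. indicat_real {?a..?b} x *\<^sub>R g x"
    have ab: "0 < ?a" "?a \<le> ?b" by (auto simp: field_simps)
    have "AE x in lebesgue. ?D x = 0"
    proof (rule AE_zero_if_initial_integrals_zero)
      show "integrable lebesgue ?D" using int[OF ab] by (simp add: set_integrable_def)
      show "integral\<^sup>L lebesgue ?D = 0" using zero[OF ab] by (simp add: set_lebesgue_integral_def)
      fix c
      have "(LINT x:{..c}|lebesgue. ?D x) = (LINT x:{?a..min c ?b}|lebesgue. g x)"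
        unfolding set_lebesgue_integral_def
        by (rule Bochner_Integration.integral_cong) (auto simp: indicator_def)
      also have "\<dots> = 0"
      proof (cases "?a \<le> min c ?b")
        case True
        then show ?thesis by (intro zero ab)
      next
        case False
        then have "{?a..min c ?b} = {}" by auto
        then show ?thesis by (simp add: set_lebesgue_integral_def)
      qed
      finally show "(LINT x:{..c}|lebesgue. ?D x) = 0" .
    qed
    then show ?thesis by eventually_elim (auto simp: indicator_def split: if_splits)
  qed
  then have "AE x in lebesgue. \<forall>n. x \<in> {1 / Suc n..real (Suc n)} \<longrightarrow> g x = 0"
    unfolding AE_all_countable by blast
  then show ?thesis
  proof eventually_elim
    case (elim x)
    show ?case
    proof
      assume x: "0 < x"
      obtain n where n: "max x (1 / x) < real n" using reals_Archimedean2 by blast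
      then have "x \<le> real (Suc n)" "1 / x < real (Suc n)" by auto
      then have "x \<in> {1 / Suc n..real (Suc n)}" using x by (auto simp: field_simps)
      with elim show "g x = 0" by blast
    qed
  qed
qed

section \<open>Right fractional integrals and their semigroup law\<close>

text \<open>
  The Beta integral, transported to the interval by an affine substitution.
\<close>

lemma Beta_integral_interval:
  fixes x t \<alpha> \<beta> :: real
  assumes "\<alpha> > 0" "\<beta> > 0" "x < t"
  defines "K \<equiv> \<lambda>y. if x < y \<and> y < t then (y - x) powr (\<alpha> - 1) * (t - y) powr (\<beta> - 1) else 0"
  shows "integrable lebesgue K" and "integral\<^sup>L lebesgue K = Beta \<alpha> \<beta> * (t - x) powr (\<alpha> + \<beta> - 1)"
proof -
  define d where "d = t - x"
  have d: "d > 0" using assms by (simp add: d_def)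
  let ?f = "\<lambda>s. indicat_real {0..1} s *\<^sub>R (s powr (\<alpha> - 1) * (1 - s) powr (\<beta> - 1))"
  have int: "integrable lborel ?f"
    using integrable_Beta[OF assms(1,2)] by (simp add: set_integrable_def)
  have "(LINT s:{0..1}|lborel. s powr (\<alpha> - 1) * (1 - s) powr (\<beta> - 1)) = Beta \<alpha> \<beta>"
    using set_borel_integral_eq_integral(2)[OF integrable_Beta[OF assms(1,2)]]
      has_integral_Beta_real[OF assms(1,2)] by (simp add: integral_unique)
  then have val: "integral\<^sup>L lborel ?f = Beta \<alpha> \<beta>" by (simp add: set_lebesgue_integral_def)
  have eq: "?f (- x / d + (1 / d) * y) = d powr (2 - \<alpha> - \<beta>) * K y" for y
  proof -
    have s: "- x / d + (1 / d) * y = (y - x) / d" by (simp add: diff_divide_distrib)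
    have s': "1 - (y - x) / d = (t - y) / d" using d by (simp add: d_def field_simps)
    consider "x < y \<and> y < t" | "y = x" | "y = t" | "y < x \<or> t < y" by linarith
    then show ?thesis
    proof cases
      case 1
      have "(y - x) / d \<in> {0..1}" using 1 d by (auto simp: d_def field_simps)
      then have "?f ((y - x) / d) = ((y - x) powr (\<alpha> - 1) * (t - y) powr (\<beta> - 1)) * (d powr (1 - \<alpha>) * d powr (1 - \<beta>))"
        using 1 d unfolding s' by (simp add: powr_divide powr_minus powr_diff field_simps)
      also have "d powr (1 - \<alpha>) * d powr (1 - \<beta>) = d powr (2 - \<alpha> - \<beta>)"
        by (simp add: algebra_simps flip: powr_add)
      finally show ?thesis unfolding s using 1 by (simp add: K_def)
    next
      case 2
      then show ?thesis unfolding s by (simp add: K_def)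
    next
      case 3
      have e1: "(y - x) / d = 1" and K0: "K y = 0" using d 3 by (auto simp: d_def K_def)
      show ?thesis unfolding s e1 K0 by simp
    next
      case 4
      then have "(y - x) / d \<notin> {0..1}" using d by (auto simp: d_def field_simps)
      then show ?thesis unfolding s using 4 by (auto simp: K_def)
    qed
  qed
  have "integrable lborel (\<lambda>y. ?f (- x / d + (1 / d) * y))"
    by (rule lborel_integrable_real_affine[OF int]) (use d in simp)
  then have i: "integrable lborel K" unfolding eq using d by simp
  have [measurable]: "K \<in> borel_measurable borel" unfolding K_def by measurable
  show "integrable lebesgue K" by (subst integrable_completion) (use i in simp_all)
  have "Beta \<alpha> \<beta> = \<bar>1 / d\<bar> *\<^sub>R (\<integral>y. ?f (- x / d + (1 / d) * y) \<partial>lborel)"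
    unfolding val[symmetric] by (rule lborel_integral_real_affine) (use d in simp)
  also have "\<dots> = (d powr (-1) * d powr (2 - \<alpha> - \<beta>)) * integral\<^sup>L lborel K"
    unfolding eq integral_mult_right_zero using d by (simp add: powr_minus divide_inverse)
  also have "d powr (-1) * d powr (2 - \<alpha> - \<beta>) = d powr (1 - \<alpha> - \<beta>)"
    unfolding powr_add[symmetric] by (rule arg_cong[where f = "\<lambda>u. d powr u"]) simp
  finally have B: "Beta \<alpha> \<beta> = d powr (1 - \<alpha> - \<beta>) * integral\<^sup>L lborel K" .
  have "d powr (1 - \<alpha> - \<beta>) * d powr (\<alpha> + \<beta> - 1) = 1" using d by (simp flip: powr_add)
  then have "integral\<^sup>L lborel K = Beta \<alpha> \<beta> * d powr (\<alpha> + \<beta> - 1)"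
    unfolding B by (simp add: mult_ac)
  then show "integral\<^sup>L lebesgue K = Beta \<alpha> \<beta> * (t - x) powr (\<alpha> + \<beta> - 1)"
    unfolding d_def by (subst integral_completion) simp_all
qed

lemma integrable_scaleR_cancel:
  fixes f :: "'a \<Rightarrow> 'b::{banach, second_countable_topology}"
  assumes "integrable M (\<lambda>x. c *\<^sub>R f x)" "c \<noteq> 0"
  shows "integrable M f"
proof -
  have "integrable M (\<lambda>x. inverse c *\<^sub>R (c *\<^sub>R f x))"
    by (rule integrable_scaleR_right) (rule assms(1))
  then show ?thesis using assms(2) by simp
qed

definition frac_integrable :: "real \<Rightarrow> (real \<Rightarrow> complex) \<Rightarrow> real \<Rightarrow> bool" where
  "frac_integrable \<mu> u x \<longleftrightarrow> set_integrable lebesgue {x<..} (\<lambda>y. (y - x) powr (\<mu> - 1) *\<^sub>R u y)"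

text \<open>
  Fubini's theorem for the triangle \<open>x < y < t\<close>, where integrating over \<open>y\<close> first leaves a Beta
  integral. Absolute convergence at the single point \<open>x\<close> is enough. The base point is arbitrary: points
  \<open>x > 0\<close> give the usual semigroup law, the point \<open>0\<close> a relation between moments.
\<close>

theorem rfrac_integral_semigroup:
  fixes g :: "real \<Rightarrow> complex"
  assumes a: "\<alpha> > 0" and b: "\<beta> > 0" and g: "frac_integrable (\<alpha> + \<beta>) g x"
  shows frac_integrable_inner: "AE y in lebesgue. x < y \<longrightarrow> frac_integrable \<beta> g y"
    and frac_integrable_outer: "frac_integrable \<alpha> (rfrac_integral \<beta> g) x"
    and rfrac_integral_rfrac_integral:
      "rfrac_integral \<alpha> (rfrac_integral \<beta> g) x = rfrac_integral (\<alpha> + \<beta>) g x"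
proof -
  interpret L: sigma_finite_measure "lebesgue :: real measure" by (rule sigma_finite_lebesgue)
  interpret P: pair_sigma_finite "lebesgue :: real measure" "lebesgue :: real measure" ..
  define G where "G t = indicat_real {x<..} t *\<^sub>R ((t - x) powr (\<alpha> + \<beta> - 1) *\<^sub>R g t)" for t
  have G: "integrable lebesgue G" using g by (simp add: G_def[abs_def] frac_integrable_def set_integrable_def)
  define k where "k t y = (if x < y \<and> y < t then (y - x) powr (\<alpha> - 1) * (t - y) powr (\<beta> - 1) else 0)" for t y
  \<comment> \<open>\<open>H\<close> is \<open>k t y * g t\<close>, written through the integrable \<open>G\<close> because \<open>g\<close> itself may fail to be
    measurable left of \<open>x\<close>.\<close>
  define H where "H t y = k t y *\<^sub>R ((t - x) powr (1 - \<alpha> - \<beta>) *\<^sub>R G t)" for t y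
  have H: "H t y = k t y *\<^sub>R g t" for t y
    by (auto simp: H_def G_def k_def simp flip: powr_add)
  have id: "(\<lambda>x. x) \<in> borel_measurable (lebesgue :: real measure)"
    by (rule measurable_completion) measurable
  have [measurable]: "fst \<in> borel_measurable (lebesgue \<Otimes>\<^sub>M (lebesgue :: real measure) :: (real \<times> real) measure)"
    using measurable_compose[OF measurable_fst id] .
  have [measurable]: "snd \<in> borel_measurable (lebesgue \<Otimes>\<^sub>M (lebesgue :: real measure) :: (real \<times> real) measure)"
    using measurable_compose[OF measurable_snd id] .
  have [measurable]: "(\<lambda>p. G (fst p)) \<in> borel_measurable (lebesgue \<Otimes>\<^sub>M (lebesgue :: real measure))"
    using measurable_compose[OF measurable_fst borel_measurable_integrable[OF G]] .
  have Hm: "(\<lambda>(t, y). H t y) \<in> borel_measurable (lebesgue \<Otimes>\<^sub>M (lebesgue :: real measure))"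
    unfolding H_def k_def case_prod_unfold by measurable
  have k1: "integrable lebesgue (k t)" and
       k2: "integral\<^sup>L lebesgue (k t) *\<^sub>R g t = Beta \<alpha> \<beta> *\<^sub>R G t" for t
  proof -
    have "integrable lebesgue (k t) \<and> integral\<^sup>L lebesgue (k t) *\<^sub>R g t = Beta \<alpha> \<beta> *\<^sub>R G t"
    proof (cases "x < t")
      case True
      then show ?thesis using Beta_integral_interval[OF a b True]
        by (simp add: k_def[abs_def] G_def)
    next
      case False
      then have "k t = (\<lambda>y. 0)" by (auto simp: k_def fun_eq_iff)
      then show ?thesis using False by (simp add: G_def)
    qed
    then show "integrable lebesgue (k t)" "integral\<^sup>L lebesgue (k t) *\<^sub>R g t = Beta \<alpha> \<beta> *\<^sub>R G t" by auto
  qed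
  have kpos: "k t y \<ge> 0" for t y by (simp add: k_def)
  have Bpos: "Beta \<alpha> \<beta> > 0" using a b by (simp add: Beta_def Gamma_real_pos)
  have Hint: "integrable (lebesgue \<Otimes>\<^sub>M lebesgue) (\<lambda>(t, y). H t y)"
  proof (rule P.Fubini_integrable[OF Hm])
    have "(\<integral>y. cmod (H t y) \<partial>lebesgue) = Beta \<alpha> \<beta> * cmod (G t)" for t
    proof -
      have "(\<integral>y. cmod (H t y) \<partial>lebesgue) = (\<integral>y. k t y \<partial>lebesgue) * cmod (g t)"
        unfolding H by (simp add: kpos)
      also have "\<dots> = cmod (integral\<^sup>L lebesgue (k t) *\<^sub>R g t)"
        using integral_nonneg_AE[of "k t" lebesgue] kpos by simp
      also have "\<dots> = Beta \<alpha> \<beta> * cmod (G t)" unfolding k2 using Bpos by simp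
      finally show ?thesis .
    qed
    then show "integrable lebesgue (\<lambda>t. \<integral>y. cmod (case (t, y) of (t, y) \<Rightarrow> H t y) \<partial>lebesgue)"
      using G by simp
    show "AE t in lebesgue. integrable lebesgue (\<lambda>y. case (t, y) of (t, y) \<Rightarrow> H t y)"
      unfolding H using k1 by simp
  qed
  have Hy: "H t y = (y - x) powr (\<alpha> - 1) *\<^sub>R (indicat_real {y<..} t *\<^sub>R ((t - y) powr (\<beta> - 1) *\<^sub>R g t))"
    if "x < y" for t y using that by (simp add: H k_def)
  have Hy0: "H t y = 0" if "\<not> x < y" for t y using that by (simp add: H k_def)
  show "AE y in lebesgue. x < y \<longrightarrow> frac_integrable \<beta> g y"
    using P.AE_integrable_snd[OF Hint]
  proof eventually_elim
    case (elim y)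
    show ?case
    proof
      assume y: "x < y"
      show "frac_integrable \<beta> g y"
        unfolding frac_integrable_def set_integrable_def
        by (rule integrable_scaleR_cancel[OF elim[unfolded Hy[OF y]]]) (use y in simp)
    qed
  qed
  have inner: "(\<integral>t. H t y \<partial>lebesgue)
     = Gamma \<beta> *\<^sub>R (indicat_real {x<..} y *\<^sub>R ((y - x) powr (\<alpha> - 1) *\<^sub>R rfrac_integral \<beta> g y))" for y
  proof (cases "x < y")
    case True
    have "Gamma \<beta> \<noteq> 0" using Gamma_real_pos[OF b] by simp
    then show ?thesis using True
      unfolding Hy[OF True] integral_scaleR_right rfrac_integral_def set_lebesgue_integral_def by simp
  qed (simp add: Hy0)
  have "Gamma \<alpha> > 0" "Gamma \<beta> > 0" "Gamma (\<alpha> + \<beta>) > 0" using a b by (auto intro!: Gamma_real_pos)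
  note Gpos = this
  show "frac_integrable \<alpha> (rfrac_integral \<beta> g) x"
    unfolding frac_integrable_def set_integrable_def
    by (rule integrable_scaleR_cancel[OF P.integrable_snd[OF Hint, unfolded inner]]) (use Gpos in simp)
  have "(\<integral>y. (\<integral>t. H t y \<partial>lebesgue) \<partial>lebesgue) = (\<integral>t. (\<integral>y. H t y \<partial>lebesgue) \<partial>lebesgue)"
    by (rule P.Fubini_integral[OF Hint])
  also have "(\<integral>t. (\<integral>y. H t y \<partial>lebesgue) \<partial>lebesgue) = Beta \<alpha> \<beta> *\<^sub>R integral\<^sup>L lebesgue G"
    unfolding H using k1 k2 by simp
  finally have "Gamma \<beta> *\<^sub>R (\<integral>y. indicat_real {x<..} y *\<^sub>R ((y - x) powr (\<alpha> - 1) *\<^sub>R rfrac_integral \<beta> g y) \<partial>lebesgue)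
     = Beta \<alpha> \<beta> *\<^sub>R integral\<^sup>L lebesgue G"
    unfolding inner integral_scaleR_right .
  then have "rfrac_integral \<alpha> (rfrac_integral \<beta> g) x = (Beta \<alpha> \<beta> / (Gamma \<alpha> * Gamma \<beta>)) *\<^sub>R integral\<^sup>L lebesgue G"
    unfolding rfrac_integral_def[of \<alpha>] set_lebesgue_integral_def using Gpos
    by (simp add: field_simps scaleR_conv_of_real)
  also have "\<dots> = rfrac_integral (\<alpha> + \<beta>) g x"
    unfolding rfrac_integral_def set_lebesgue_integral_def G_def[abs_def] Beta_def
    using Gpos by simp
  finally show "rfrac_integral \<alpha> (rfrac_integral \<beta> g) x = rfrac_integral (\<alpha> + \<beta>) g x" .
qed

section \<open>Equality almost everywhere on the half-line and decay at infinity\<close>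

definition ae_eq :: "(real \<Rightarrow> complex) \<Rightarrow> (real \<Rightarrow> complex) \<Rightarrow> bool" where
  "ae_eq f g \<longleftrightarrow> (AE x in lebesgue. 0 < x \<longrightarrow> f x = g x)"

lemma ae_eq_refl: "ae_eq f f" by (simp add: ae_eq_def)

lemma ae_eq_sym: "ae_eq f g \<Longrightarrow> ae_eq g f"
  unfolding ae_eq_def by (auto elim: eventually_mono)

lemma ae_eq_trans [trans]:
  assumes "ae_eq f g" "ae_eq g h"
  shows "ae_eq f h"
  using assms unfolding ae_eq_def by eventually_elim simp

lemma set_integrable_ae_eq:
  assumes "ae_eq f g" "A \<subseteq> {0<..}"
  shows "set_integrable lebesgue A f \<longleftrightarrow> set_integrable lebesgue A g"
    and "(LINT x:A|lebesgue. f x) = (LINT x:A|lebesgue. g x)"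
proof -
  have "AE x in lebesgue. x \<in> A \<longrightarrow> f x = g x"
    using assms(1) unfolding ae_eq_def by eventually_elim (use assms(2) in auto)
  then show "set_integrable lebesgue A f \<longleftrightarrow> set_integrable lebesgue A g"
    and "(LINT x:A|lebesgue. f x) = (LINT x:A|lebesgue. g x)"
    by (rule set_integrable_lebesgue_cong_AE, rule set_integral_lebesgue_cong_AE)
qed

lemma frac_integrable_cong:
  assumes "ae_eq f g" "x \<ge> 0"
  shows "frac_integrable \<mu> f x \<longleftrightarrow> frac_integrable \<mu> g x"
proof -
  have "ae_eq (\<lambda>y. (y - x) powr (\<mu> - 1) *\<^sub>R f y) (\<lambda>y. (y - x) powr (\<mu> - 1) *\<^sub>R g y)"
    using assms(1) unfolding ae_eq_def by eventually_elim simp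
  moreover have "{x<..} \<subseteq> {0<..}" using assms(2) by auto
  ultimately show ?thesis unfolding frac_integrable_def by (rule set_integrable_ae_eq(1))
qed

lemma rfrac_integral_cong:
  assumes "ae_eq f g" "x \<ge> 0"
  shows "rfrac_integral \<mu> f x = rfrac_integral \<mu> g x"
proof -
  have "ae_eq (\<lambda>y. (y - x) powr (\<mu> - 1) *\<^sub>R f y) (\<lambda>y. (y - x) powr (\<mu> - 1) *\<^sub>R g y)"
    using assms(1) unfolding ae_eq_def by eventually_elim simp
  moreover have "{x<..} \<subseteq> {0<..}" using assms(2) by auto
  ultimately show ?thesis unfolding rfrac_integral_def by (subst set_integrable_ae_eq(2)) auto
qed

lemma frac_integrable_cmult: "frac_integrable \<mu> f x \<Longrightarrow> frac_integrable \<mu> (\<lambda>y. c * f y) x"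
  unfolding frac_integrable_def mult_scaleR_right[symmetric] by (rule set_integrable_mult_right)

lemma rfrac_integral_cmult: "rfrac_integral \<mu> (\<lambda>y. c * f y) x = c * rfrac_integral \<mu> f x"
  unfolding rfrac_integral_def mult_scaleR_right[symmetric] set_integral_mult_right ..

lemma frac_integrable_add:
  assumes "frac_integrable \<mu> f x" "frac_integrable \<mu> g x"
  shows "frac_integrable \<mu> (\<lambda>y. f y + g y) x"
    and "rfrac_integral \<mu> (\<lambda>y. f y + g y) x = rfrac_integral \<mu> f x + rfrac_integral \<mu> g x"
  using assms set_integral_add[of lebesgue "{x<..}" "\<lambda>y. (y - x) powr (\<mu> - 1) *\<^sub>R f y" "\<lambda>y. (y - x) powr (\<mu> - 1) *\<^sub>R g y"]
  unfolding frac_integrable_def rfrac_integral_def scaleR_add_right by (simp_all add: scaleR_add_right)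

lemma frac_integrable_diff:
  assumes "frac_integrable \<mu> f x" "frac_integrable \<mu> g x"
  shows "frac_integrable \<mu> (\<lambda>y. f y - g y) x"
    and "rfrac_integral \<mu> (\<lambda>y. f y - g y) x = rfrac_integral \<mu> f x - rfrac_integral \<mu> g x"
  using frac_integrable_add[OF assms(1) frac_integrable_cmult[OF assms(2), of "-1"]]
  by (simp_all add: rfrac_integral_cmult[where c = "-1", simplified])

lemma frac_integrable_sum:
  assumes "\<And>i. i \<in> A \<Longrightarrow> frac_integrable \<mu> (f i) x"
  shows "frac_integrable \<mu> (\<lambda>y. \<Sum>i\<in>A. f i y) x"
    and "rfrac_integral \<mu> (\<lambda>y. \<Sum>i\<in>A. f i y) x = (\<Sum>i\<in>A. rfrac_integral \<mu> (f i) x)"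
proof -
  have z: "frac_integrable \<mu> (\<lambda>y. 0) x" "rfrac_integral \<mu> (\<lambda>y. 0) x = 0"
    by (simp_all add: frac_integrable_def set_integrable_def rfrac_integral_def set_lebesgue_integral_def)
  have "frac_integrable \<mu> (\<lambda>y. \<Sum>i\<in>A. f i y) x
     \<and> rfrac_integral \<mu> (\<lambda>y. \<Sum>i\<in>A. f i y) x = (\<Sum>i\<in>A. rfrac_integral \<mu> (f i) x)"
    using assms
    by (induction A rule: infinite_finite_induct) (auto simp: z frac_integrable_add)
  then show "frac_integrable \<mu> (\<lambda>y. \<Sum>i\<in>A. f i y) x"
    and "rfrac_integral \<mu> (\<lambda>y. \<Sum>i\<in>A. f i y) x = (\<Sum>i\<in>A. rfrac_integral \<mu> (f i) x)" by auto
qed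

text \<open>
  Existence of all fractional integrals of order at least \<open>1\<close> is a decay condition at infinity
  without any condition at \<open>0\<close>. In this form it is inherited by fractional integrals directly from the
  semigroup law.
\<close>

definition rapidly_decaying :: "(real \<Rightarrow> complex) \<Rightarrow> bool" where
  "rapidly_decaying g \<longleftrightarrow> (\<forall>x>0. \<forall>\<beta>\<ge>1. frac_integrable \<beta> g x)"

text \<open>
  Order \<open>0\<close> has to be the identity, whereas \<open>rfrac_integral 0\<close> is the zero function because \<open>Gamma 0\<close> and
  division by it have the default value \<open>0\<close>.
\<close>

definition fracI :: "real \<Rightarrow> (real \<Rightarrow> complex) \<Rightarrow> real \<Rightarrow> complex" where
  "fracI \<mu> g = (if \<mu> = 0 then g else rfrac_integral \<mu> g)"

lemma rapidly_decaying_cong: "ae_eq f g \<Longrightarrow> rapidly_decaying f \<longleftrightarrow> rapidly_decaying g"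
  unfolding rapidly_decaying_def using frac_integrable_cong by (metis less_eq_real_def)

lemma rapidly_decaying_diff: "rapidly_decaying f \<Longrightarrow> rapidly_decaying g \<Longrightarrow> rapidly_decaying (\<lambda>x. f x - g x)"
  unfolding rapidly_decaying_def by (auto intro: frac_integrable_diff)

lemma rapidly_decaying_cmult: "rapidly_decaying f \<Longrightarrow> rapidly_decaying (\<lambda>x. c * f x)"
  unfolding rapidly_decaying_def by (auto intro: frac_integrable_cmult)

lemma rapidly_decaying_uminus: "rapidly_decaying f \<Longrightarrow> rapidly_decaying (\<lambda>x. - f x)"
  using rapidly_decaying_cmult[of f "-1"] by simp

lemma rapidly_decaying_fracI:
  assumes "rapidly_decaying g" "\<mu> \<ge> 0"
  shows "rapidly_decaying (fracI \<mu> g)"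
proof (cases "\<mu> = 0")
  case False
  then have "\<mu> > 0" using assms by simp
  show ?thesis unfolding rapidly_decaying_def
  proof (intro allI impI)
    fix x \<beta> :: real assume "x > 0" "\<beta> \<ge> 1"
    then have "frac_integrable (\<beta> + \<mu>) g x" using assms \<open>\<mu> > 0\<close> by (auto simp: rapidly_decaying_def)
    then show "frac_integrable \<beta> (fracI \<mu> g) x"
      using frac_integrable_outer[of \<beta> \<mu> g x] \<open>\<beta> \<ge> 1\<close> \<open>\<mu> > 0\<close> by (simp add: fracI_def)
  qed
qed (use assms in \<open>simp add: fracI_def\<close>)

lemma rapidly_decaying_rfrac_integral: "rapidly_decaying g \<Longrightarrow> \<mu> > 0 \<Longrightarrow> rapidly_decaying (rfrac_integral \<mu> g)"
  using rapidly_decaying_fracI[of g \<mu>] by (simp add: fracI_def)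

text \<open>
  Orders below \<open>1\<close> have a singular kernel, so existence can only hold almost everywhere; it comes
  from the inner integral in the semigroup law, with base points tending to \<open>0\<close>.
\<close>

lemma rapidly_decaying_frac_integrable:
  assumes "rapidly_decaying g" "\<mu> > 0"
  shows "AE x in lebesgue. 0 < x \<longrightarrow> frac_integrable \<mu> g x"
proof -
  have "AE y in lebesgue. 1 / real (Suc n) < y \<longrightarrow> frac_integrable \<mu> g y" for n
    by (rule frac_integrable_inner[where \<alpha> = 1]) (use assms in \<open>auto simp: rapidly_decaying_def\<close>)
  then have "AE y in lebesgue. \<forall>n. 1 / real (Suc n) < y \<longrightarrow> frac_integrable \<mu> g y"
    unfolding AE_all_countable by blast
  then show ?thesis
  proof eventually_elim
    case (elim y)
    show ?case
    proof
      assume "0 < y"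
      then obtain n where "inverse (real (Suc n)) < y" using reals_Archimedean by blast
      then show "frac_integrable \<mu> g y" using elim unfolding inverse_eq_divide by blast
    qed
  qed
qed

lemma rfrac_integral_exists_iff:
  "rfrac_integral_exists \<mu> u \<longleftrightarrow> (AE x in lebesgue. 0 < x \<longrightarrow> frac_integrable \<mu> u x)"
  by (simp add: rfrac_integral_exists_def frac_integrable_def)

lemma fracI_add:
  assumes "rapidly_decaying g" "\<alpha> \<ge> 0" "\<beta> \<ge> 0"
  shows "ae_eq (fracI \<alpha> (fracI \<beta> g)) (fracI (\<alpha> + \<beta>) g)"
proof (cases "\<alpha> = 0 \<or> \<beta> = 0")
  case True
  then show ?thesis by (auto simp: fracI_def ae_eq_refl)
next
  case False
  then have pos: "\<alpha> > 0" "\<beta> > 0" using assms by auto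
  then show ?thesis
    using rapidly_decaying_frac_integrable[OF assms(1), of "\<alpha> + \<beta>"] unfolding ae_eq_def fracI_def
    by (auto elim!: eventually_mono simp: rfrac_integral_rfrac_integral)
qed

lemma fracI_cong: "ae_eq f g \<Longrightarrow> ae_eq (fracI \<mu> f) (fracI \<mu> g)"
  using rfrac_integral_cong[of f g _ \<mu>] by (auto simp: fracI_def ae_eq_def)

lemma fracI_diff:
  assumes "rapidly_decaying f" "rapidly_decaying g" "\<mu> \<ge> 0"
  shows "ae_eq (fracI \<mu> (\<lambda>x. f x - g x)) (\<lambda>x. fracI \<mu> f x - fracI \<mu> g x)"
proof (cases "\<mu> = 0")
  case False
  then have "\<mu> > 0" using assms by simp
  have "AE x in lebesgue. 0 < x \<longrightarrow> frac_integrable \<mu> f x" "AE x in lebesgue. 0 < x \<longrightarrow> frac_integrable \<mu> g x"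
    using rapidly_decaying_frac_integrable assms \<open>\<mu> > 0\<close> by auto
  then show ?thesis unfolding ae_eq_def
    by eventually_elim (use False in \<open>simp add: fracI_def frac_integrable_diff\<close>)
qed (simp add: fracI_def ae_eq_refl)

lemma fracI_uminus: "fracI \<mu> (\<lambda>x. - g x) = (\<lambda>x. - fracI \<mu> g x)"
  using rfrac_integral_cmult[of \<mu> "-1" g] by (auto simp: fracI_def fun_eq_iff)

section \<open>Fractional derivatives invert fractional integrals\<close>

lemma zero_if_AE_zero:
  fixes E :: "real \<Rightarrow> complex"
  assumes cont: "continuous_on {0<..} E" and ae: "AE x in lebesgue. 0 < x \<longrightarrow> E x = 0" and x: "x > 0"
  shows "E x = 0"
proof (rule ccontr)
  assume ne: "E x \<noteq> 0"
  have "open ({0<..} \<inter> E -` (- {0}))"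
    by (rule continuous_open_preimage[OF cont]) auto
  moreover have "x \<in> {0<..} \<inter> E -` (- {0})" using ne x by simp
  ultimately obtain d where d: "d > 0" "ball x d \<subseteq> {0<..} \<inter> E -` (- {0})"
    by (elim openE)
  have "AE y in lebesgue. y \<notin> ball x d" using ae by eventually_elim (use d in auto)
  then have "emeasure lebesgue (ball x d) = 0"
    by (subst (asm) AE_iff_null_sets[symmetric]) auto
  moreover have "ball x d = {x - d<..<x + d}" by (auto simp: ball_def dist_real_def)
  ultimately show False using d(1) by simp
qed

lemma continuous_on_primitive:
  assumes int: "\<And>a b. 0 < a \<Longrightarrow> a \<le> b \<Longrightarrow> set_integrable lebesgue {a..b} g"
    and F: "\<And>a b. 0 < a \<Longrightarrow> a \<le> b \<Longrightarrow> F b - F a = (LINT x:{a..b}|lebesgue. g x)"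
  shows "continuous_on {0<..} (F :: real \<Rightarrow> complex)"
proof (rule continuous_at_imp_continuous_on, intro ballI)
  fix x :: real assume "x \<in> {0<..}"
  then have x: "x > 0" by simp
  let ?I = "{x/2..x+1}"
  have g: "set_integrable lebesgue ?I g" using int x by simp
  have "continuous_on ?I (\<lambda>t. F (x/2) + integral {x/2..t} g)"
    by (intro continuous_intros indefinite_integral_continuous_1 set_lebesgue_integral_eq_integral(1)[OF g])
  moreover have "F (x/2) + integral {x/2..t} g = F t" if "t \<in> ?I" for t
  proof -
    have "set_integrable lebesgue {x/2..t} g" using int x that by simp
    then show ?thesis using F[of "x/2" t] x that by (simp add: set_lebesgue_integral_eq_integral(2) diff_eq_eq add.commute)
  qed
  ultimately have "continuous_on ?I F" by (rule continuous_on_eq)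
  then show "isCont F x" by (rule continuous_on_interior) (use x in simp)
qed

text \<open>
  Two primitives of almost everywhere equal functions are continuous, hence equal everywhere, so
  the derivatives have the same integrals over all intervals.
\<close>

lemma has_ac_deriv_unique:
  assumes f: "has_ac_deriv f h" and f': "has_ac_deriv f' h'" and eq: "ae_eq f f'"
  shows "ae_eq h h'"
proof -
  obtain F where F: "ae_eq f F" "\<And>a b. 0 < a \<Longrightarrow> a \<le> b \<Longrightarrow> F b - F a = (LINT x:{a..b}|lebesgue. h x)"
    using f unfolding has_ac_deriv_def ae_eq_def by blast
  obtain F' where F': "ae_eq f' F'" "\<And>a b. 0 < a \<Longrightarrow> a \<le> b \<Longrightarrow> F' b - F' a = (LINT x:{a..b}|lebesgue. h' x)"
    using f' unfolding has_ac_deriv_def ae_eq_def by blast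
  have int: "set_integrable lebesgue {a..b} h" "set_integrable lebesgue {a..b} h'" if "0 < a" "a \<le> b" for a b
    using f f' that unfolding has_ac_deriv_def by auto
  have "ae_eq F F'" using F(1) F'(1) eq ae_eq_sym ae_eq_trans by blast
  then have "AE x in lebesgue. 0 < x \<longrightarrow> F x - F' x = 0" unfolding ae_eq_def by eventually_elim simp
  moreover have "continuous_on {0<..} (\<lambda>x. F x - F' x)"
    by (intro continuous_on_diff continuous_on_primitive[OF int(1) F(2)] continuous_on_primitive[OF int(2) F'(2)]) auto
  ultimately have E: "F x = F' x" if "x > 0" for x using zero_if_AE_zero[of "\<lambda>x. F x - F' x" x] that by simp
  have "AE x in lebesgue. 0 < x \<longrightarrow> h x - h' x = 0"
  proof (rule AE_zero_if_interval_integrals_zero)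
    fix a b :: real assume ab: "0 < a" "a \<le> b"
    show "set_integrable lebesgue {a..b} (\<lambda>x. h x - h' x)" by (rule set_integral_diff(1)[OF int[OF ab]])
    show "(LINT x:{a..b}|lebesgue. h x - h' x) = 0"
      using F(2)[OF ab] F'(2)[OF ab] E[of a] E[of b] ab by (simp add: set_integral_diff(2)[OF int[OF ab]])
  qed
  then show ?thesis unfolding ae_eq_def by eventually_elim simp
qed

lemma has_ac_derivs_unique:
  "has_ac_derivs k f g \<Longrightarrow> has_ac_derivs k f' g' \<Longrightarrow> ae_eq f f' \<Longrightarrow> ae_eq g g'"
proof (induction k arbitrary: f f')
  case 0
  then show ?case using ae_eq_sym ae_eq_trans by (metis ae_eq_def has_ac_derivs.simps(1))
next
  case (Suc k)
  then show ?case using has_ac_deriv_unique by (metis has_ac_derivs.simps(2))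
qed

lemma has_rfrac_deriv_unique:
  assumes "has_rfrac_deriv \<mu> u g" "has_rfrac_deriv \<mu> u g'"
  shows "ae_eq g g'"
proof -
  let ?k = "frac_ord \<mu>"
  have "ae_eq (\<lambda>x. (-1) ^ ?k * g x) (\<lambda>x. (-1) ^ ?k * g' x)"
    using assms unfolding has_rfrac_deriv_def Let_def by (blast intro: has_ac_derivs_unique ae_eq_refl)
  then show ?thesis unfolding ae_eq_def by eventually_elim simp
qed

lemma has_ac_deriv_cong: "has_ac_deriv f g \<Longrightarrow> ae_eq f f' \<Longrightarrow> ae_eq g g' \<Longrightarrow> has_ac_deriv f' g'"
  unfolding has_ac_deriv_def
proof (elim conjE exE, intro conjI allI impI)
  fix F assume f: "ae_eq f f'" and g: "ae_eq g g'"
    and int: "\<forall>a b. 0 < a \<longrightarrow> a \<le> b \<longrightarrow> set_integrable lebesgue {a..b} g"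
    and F: "AE x in lebesgue. 0 < x \<longrightarrow> f x = F x"
      "\<forall>a b. 0 < a \<longrightarrow> a \<le> b \<longrightarrow> F b - F a = (LINT x:{a..b}|lebesgue. g x)"
  have *: "{a..b} \<subseteq> {0<..}" if "0 < a" for a b :: real using that by auto
  show "set_integrable lebesgue {a..b} g'" if "0 < a" "a \<le> b" for a b
    using int that set_integrable_ae_eq(1)[OF g *] by blast
  have "ae_eq f' F" using F(1) f ae_eq_sym ae_eq_trans unfolding ae_eq_def[symmetric] by blast
  then show "\<exists>F. (AE x in lebesgue. 0 < x \<longrightarrow> f' x = F x) \<and> (\<forall>a b. 0 < a \<longrightarrow> a \<le> b \<longrightarrow> F b - F a = (LINT x:{a..b}|lebesgue. g' x))"
    using F(2) set_integrable_ae_eq(2)[OF g *] unfolding ae_eq_def by auto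
qed

lemma has_ac_deriv_add:
  assumes "has_ac_deriv f g" "has_ac_deriv f' g'"
  shows "has_ac_deriv (\<lambda>x. f x + f' x) (\<lambda>x. g x + g' x)"
proof -
  obtain F where F: "ae_eq f F" "\<And>a b. 0 < a \<Longrightarrow> a \<le> b \<Longrightarrow> F b - F a = (LINT x:{a..b}|lebesgue. g x)"
    using assms(1) unfolding has_ac_deriv_def ae_eq_def by blast
  obtain F' where F': "ae_eq f' F'" "\<And>a b. 0 < a \<Longrightarrow> a \<le> b \<Longrightarrow> F' b - F' a = (LINT x:{a..b}|lebesgue. g' x)"
    using assms(2) unfolding has_ac_deriv_def ae_eq_def by blast
  have int: "set_integrable lebesgue {a..b} g" "set_integrable lebesgue {a..b} g'" if "0 < a" "a \<le> b" for a b
    using assms that unfolding has_ac_deriv_def by auto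
  show ?thesis unfolding has_ac_deriv_def
  proof (intro conjI exI[of _ "\<lambda>x. F x + F' x"] allI impI)
    fix a b :: real assume ab: "0 < a" "a \<le> b"
    show "set_integrable lebesgue {a..b} (\<lambda>x. g x + g' x)" by (rule set_integral_add(1)[OF int[OF ab]])
    show "F b + F' b - (F a + F' a) = (LINT x:{a..b}|lebesgue. g x + g' x)"
      unfolding set_integral_add(2)[OF int[OF ab]] F(2)[OF ab, symmetric] F'(2)[OF ab, symmetric] by simp
  next
    show "AE x in lebesgue. 0 < x \<longrightarrow> f x + f' x = F x + F' x"
      using F(1) F'(1) unfolding ae_eq_def by eventually_elim simp
  qed
qed

lemma has_ac_deriv_const:
  assumes "has_ac_deriv f h" "has_ac_deriv f' h"
  shows "\<exists>C. ae_eq f (\<lambda>x. f' x + C)"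
proof -
  obtain F where F: "ae_eq f F" "\<And>a b. 0 < a \<Longrightarrow> a \<le> b \<Longrightarrow> F b - F a = (LINT x:{a..b}|lebesgue. h x)"
    using assms(1) unfolding has_ac_deriv_def ae_eq_def by blast
  obtain F' where F': "ae_eq f' F'" "\<And>a b. 0 < a \<Longrightarrow> a \<le> b \<Longrightarrow> F' b - F' a = (LINT x:{a..b}|lebesgue. h x)"
    using assms(2) unfolding has_ac_deriv_def ae_eq_def by blast
  have *: "F x = F' x + (F 1 - F' 1)" if "x > 0" for x
  proof (cases "x \<le> 1")
    case True
    then show ?thesis using F(2)[OF that True] F'(2)[OF that True] by (simp add: algebra_simps)
  next
    case False
    then show ?thesis using F(2)[of 1 x] F'(2)[of 1 x] by (simp add: algebra_simps)
  qed
  then have "ae_eq f (\<lambda>x. f' x + (F 1 - F' 1))"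
    using F(1) F'(1) unfolding ae_eq_def by eventually_elim (metis *)
  then show ?thesis by blast
qed

text \<open>
  The fractional integral of order \<open>1\<close> is the primitive that vanishes at infinity, up to sign.
\<close>

lemma has_ac_deriv_rfrac_integral_1:
  assumes "rapidly_decaying g"
  shows "has_ac_deriv (rfrac_integral 1 g) (\<lambda>x. - g x)"
proof -
  have "set_integrable lebesgue {x<..} g" if "0 < x" for x
  proof -
    have "frac_integrable 1 g x" using assms that by (simp add: rapidly_decaying_def)
    moreover have "indicat_real {x<..} y *\<^sub>R ((y - x) powr (1 - 1) *\<^sub>R g y) = indicat_real {x<..} y *\<^sub>R g y" for y
      by (simp add: indicator_def)
    ultimately show ?thesis unfolding frac_integrable_def set_integrable_def by (simp only:)
  qed
  then have "has_rfrac_deriv 0 g g" by (rule has_rfrac_deriv_0)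
  then obtain h where "has_ac_deriv (rfrac_integral 1 g) h" "ae_eq h (\<lambda>x. - g x)"
    by (auto simp: has_rfrac_deriv_def frac_ord_def ae_eq_def)
  then show ?thesis using has_ac_deriv_cong ae_eq_refl by blast
qed

lemma poly_antiderivative:
  fixes p :: "complex poly"
  obtains P where "pderiv P = p"
proof
  let ?P = "\<Sum>i\<le>degree p. monom (coeff p i / of_nat (Suc i)) (Suc i)"
  have "pderiv ?P = (\<Sum>i\<le>degree p. monom (coeff p i) i)"
    unfolding higher_pderiv_sum[of 1, simplified] pderiv_monom by (intro sum.cong) (simp_all del: of_nat_Suc)
  also have "\<dots> = p" by (rule poly_as_sum_of_monoms)
  finally show "pderiv ?P = p" .
qed

lemma has_ac_deriv_poly:
  "has_ac_deriv (\<lambda>x. poly P (complex_of_real x)) (\<lambda>x. poly (pderiv P) (complex_of_real x))"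
  unfolding has_ac_deriv_def
proof (intro conjI exI[of _ "\<lambda>x. poly P (complex_of_real x)"] allI impI)
  fix a b :: real assume ab: "0 < a" "a \<le> b"
  have cont: "continuous_on {a..b} (\<lambda>x. poly (pderiv P) (complex_of_real x))"
    by (intro continuous_intros)
  have vd: "((\<lambda>x. poly P (complex_of_real x)) has_vector_derivative poly (pderiv P) (complex_of_real x)) (at x within {a..b})" for x
    by (rule has_vector_derivative_real_field[OF poly_DERIV])
  show "set_integrable lebesgue {a..b} (\<lambda>x. poly (pderiv P) (complex_of_real x))"
    using borel_integrable_atLeastAtMost'[OF cont] unfolding set_integrable_def
    by (subst integrable_completion) (auto dest: borel_measurable_integrable)
  show "poly P (complex_of_real b) - poly P (complex_of_real a) = (LINT x:{a..b}|lebesgue. poly (pderiv P) (complex_of_real x))"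
    using integral_FTC_atLeastAtMost[OF ab(2) vd cont] borel_integrable_atLeastAtMost'[OF cont]
    unfolding set_lebesgue_integral_def set_integrable_def
    by (subst integral_completion) (auto dest: borel_measurable_integrable)
qed (simp)

text \<open>
  A nonzero polynomial is bounded away from zero near infinity.
\<close>

lemma poly_integrable_imp_zero:
  fixes p :: "complex poly"
  assumes "set_integrable lebesgue {1<..} (\<lambda>x. poly p (complex_of_real x))"
  shows "p = 0"
proof (rule ccontr)
  assume "p \<noteq> 0"
  have "\<exists>c>0. \<exists>r. \<forall>z. r \<le> cmod z \<longrightarrow> c \<le> cmod (poly p z)"
  proof (cases p)
    case (pCons a q)
    show ?thesis
    proof (cases "q = 0")
      case True
      then show ?thesis using pCons \<open>p \<noteq> 0\<close> by (intro exI[of _ "cmod a"]) auto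
    next
      case False
      then show ?thesis using poly_infinity[OF False, of 1 a] pCons by (intro exI[of _ 1]) auto
    qed
  qed
  then obtain c r where c: "c > 0" "\<And>z. r \<le> cmod z \<Longrightarrow> c \<le> cmod (poly p z)" by blast
  define b where "b = max 1 r"
  have "integrable lebesgue (\<lambda>x. indicat_real {b<..} x *\<^sub>R c)"
  proof (rule Bochner_Integration.integrable_bound)
    show "integrable lebesgue (\<lambda>x. indicat_real {1<..} x *\<^sub>R poly p (complex_of_real x))"
      using assms by (simp add: set_integrable_def)
    show "(\<lambda>x. indicat_real {b<..} x *\<^sub>R c) \<in> borel_measurable lebesgue"
      by (intro borel_measurable_scaleR borel_measurable_indicator) auto
    show "AE x in lebesgue. norm (indicat_real {b<..} x *\<^sub>R c) \<le> norm (indicat_real {1<..} x *\<^sub>R poly p (complex_of_real x))"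
    proof (intro AE_I2)
      fix x show "norm (indicat_real {b<..} x *\<^sub>R c) \<le> norm (indicat_real {1<..} x *\<^sub>R poly p (complex_of_real x))"
        using c(1) c(2)[of "complex_of_real x"] by (auto simp: b_def indicator_def)
    qed
  qed
  then have "integrable lebesgue (indicat_real {b<..})"
    using c(1) by (simp add: mult.commute[of _ c])
  then have "emeasure lebesgue {b<..} < \<infinity>" by (simp add: integrable_indicator_iff)
  then obtain m where m: "m \<ge> 0" "emeasure lebesgue {b<..} = ennreal m" by (cases "emeasure lebesgue {b<..}") auto
  obtain n where "m < real n" using reals_Archimedean2 by blast
  moreover have "ennreal (real n) \<le> emeasure lebesgue {b<..}"
  proof -
    have "emeasure lebesgue {b<..<b + real n} \<le> emeasure lebesgue {b<..}" by (intro emeasure_mono) auto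
    then show ?thesis by simp
  qed
  ultimately show False using m by simp
qed

text \<open>
  Undoing \<open>k\<close> derivatives gives the \<open>k\<close>-fold integral of \<open>g\<close> from infinity, plus one more
  integration constant at each step; these constants add up to a polynomial.
\<close>

lemma has_ac_derivs_fracI_poly:
  assumes "has_ac_derivs k f (\<lambda>x. (-1) ^ k * g x)" "rapidly_decaying g"
  shows "\<exists>p. ae_eq f (\<lambda>x. fracI (real k) g x + poly p (complex_of_real x))"
  using assms
proof (induction k arbitrary: f g)
  case 0
  then show ?case by (intro exI[of _ 0]) (simp add: fracI_def ae_eq_def)
next
  case (Suc k)
  obtain h where h: "has_ac_deriv f h" "has_ac_derivs k h (\<lambda>x. (-1) ^ k * (- g x))"
    using Suc.prems(1) by auto
  obtain p where p: "ae_eq h (\<lambda>x. fracI (real k) (\<lambda>x. - g x) x + poly p (complex_of_real x))"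
    using Suc.IH[OF h(2) rapidly_decaying_uminus[OF Suc.prems(2)]] by blast
  obtain P where P: "pderiv P = p" using poly_antiderivative by blast
  have "rapidly_decaying (fracI (real k) g)" by (rule rapidly_decaying_fracI[OF Suc.prems(2)]) simp
  then have "has_ac_deriv (\<lambda>x. rfrac_integral 1 (fracI k g) x + poly P (complex_of_real x)) (\<lambda>x. - fracI k g x + poly p (complex_of_real x))"
    unfolding P[symmetric] by (intro has_ac_deriv_add has_ac_deriv_rfrac_integral_1 has_ac_deriv_poly)
  then have "has_ac_deriv (\<lambda>x. rfrac_integral 1 (fracI k g) x + poly P (complex_of_real x)) h"
    by (rule has_ac_deriv_cong[OF _ ae_eq_refl]) (use p in \<open>simp add: fracI_uminus ae_eq_sym\<close>)
  then obtain C where C: "ae_eq f (\<lambda>x. rfrac_integral 1 (fracI k g) x + poly P (complex_of_real x) + C)"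
    using has_ac_deriv_const[OF h(1)] by blast
  have "ae_eq (fracI 1 (fracI k g)) (fracI (1 + real k) g)" by (rule fracI_add[OF Suc.prems(2)]) auto
  with C have "ae_eq f (\<lambda>x. fracI (real (Suc k)) g x + poly (P + [:C:]) (complex_of_real x))"
    unfolding ae_eq_def by eventually_elim (simp add: fracI_def)
  then show ?case by blast
qed

lemma has_ac_derivs_fracI:
  assumes "rapidly_decaying g" "ae_eq f (fracI (real k) g)"
  shows "has_ac_derivs k f (\<lambda>x. (-1) ^ k * g x)"
  using assms
proof (induction k arbitrary: f g)
  case 0
  then show ?case by (simp add: fracI_def ae_eq_def)
next
  case (Suc k)
  have w: "rapidly_decaying (fracI (real k) g)" by (rule rapidly_decaying_fracI[OF Suc.prems(1)]) simp
  have "ae_eq (fracI 1 (fracI k g)) (fracI (1 + real k) g)" by (rule fracI_add[OF Suc.prems(1)]) auto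
  then have "ae_eq (rfrac_integral 1 (fracI k g)) f"
    using Suc.prems(2) by (auto simp: fracI_def intro: ae_eq_trans ae_eq_sym)
  then have "has_ac_deriv f (\<lambda>x. - fracI k g x)"
    using has_ac_deriv_cong[OF has_ac_deriv_rfrac_integral_1[OF w] _ ae_eq_refl] by blast
  moreover have "has_ac_derivs k (\<lambda>x. - fracI k g x) (\<lambda>x. (-1) ^ k * (- g x))"
    by (rule Suc.IH[OF rapidly_decaying_uminus[OF Suc.prems(1)]]) (simp add: fracI_uminus ae_eq_refl)
  ultimately show ?case by auto
qed

text \<open>
  A further integral of order \<open>1 - \<delta>\<close> produces the integral of order \<open>1\<close>, which can be
  differentiated.
\<close>

lemma fracI_injective:
  assumes "rapidly_decaying w" "0 < \<delta>" "\<delta> \<le> 1" "ae_eq (fracI \<delta> w) (\<lambda>x. 0)"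
  shows "ae_eq w (\<lambda>x. 0)"
proof -
  have "ae_eq (fracI (1 - \<delta> + \<delta>) w) (fracI (1 - \<delta>) (fracI \<delta> w))"
    by (rule ae_eq_sym[OF fracI_add]) (use assms in auto)
  also have "ae_eq (fracI (1 - \<delta>) (fracI \<delta> w)) (fracI (1 - \<delta>) (\<lambda>x. 0))" by (rule fracI_cong[OF assms(4)])
  also have "fracI (1 - \<delta>) (\<lambda>x. 0) = (\<lambda>x. 0)"
    by (auto simp: fracI_def fun_eq_iff rfrac_integral_def set_lebesgue_integral_def)
  finally have 1: "ae_eq (rfrac_integral 1 w) (\<lambda>x. 0)" by (simp add: fracI_def)
  have "has_ac_deriv (\<lambda>x. 0) (\<lambda>x. 0)" using has_ac_deriv_poly[of 0] by simp
  then have "ae_eq (\<lambda>x. - w x) (\<lambda>x. 0)"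
    by (rule has_ac_deriv_unique[OF has_ac_deriv_rfrac_integral_1[OF assms(1)] _ 1])
  then show ?thesis unfolding ae_eq_def by eventually_elim simp
qed

lemma frac_ord_bounds:
  assumes "\<mu> \<ge> 0"
  shows "0 < real (frac_ord \<mu>) - \<mu>" "real (frac_ord \<mu>) - \<mu> \<le> 1" "frac_ord \<mu> > 0"
proof -
  have "real (frac_ord \<mu>) = of_int \<lfloor>\<mu>\<rfloor> + 1" using assms by (simp add: frac_ord_def)
  then show "0 < real (frac_ord \<mu>) - \<mu>" "real (frac_ord \<mu>) - \<mu> \<le> 1" by linarith+
  show "frac_ord \<mu> > 0" by (simp add: frac_ord_def)
qed

text \<open>
  By definition the integral of order \<open>\<delta> = k - \<mu>\<close> of \<open>v\<close> has \<open>k\<close>-th derivative \<open>g\<close>, up to sign, so it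
  is the integral of order \<open>k\<close> of \<open>g\<close> up to a polynomial. Decay removes the polynomial, and injectivity
  of the integral of order \<open>\<delta>\<close> cancels it from both sides.
\<close>

theorem has_rfrac_deriv_imp_eq_fracI:
  assumes d: "has_rfrac_deriv \<mu> v g" and mu: "\<mu> \<ge> 0" and v: "rapidly_decaying v" and g: "rapidly_decaying g"
  shows "ae_eq v (fracI \<mu> g)"
proof -
  define k where "k = frac_ord \<mu>"
  define \<delta> where "\<delta> = real k - \<mu>"
  have del: "0 < \<delta>" "\<delta> \<le> 1" "k > 0" using frac_ord_bounds[OF mu] by (auto simp: \<delta>_def k_def)
  have "has_ac_derivs k (rfrac_integral \<delta> v) (\<lambda>x. (-1) ^ k * g x)"
    using d by (simp add: has_rfrac_deriv_def k_def \<delta>_def Let_def)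
  then obtain p where p: "ae_eq (rfrac_integral \<delta> v) (\<lambda>x. fracI k g x + poly p (complex_of_real x))"
    using has_ac_derivs_fracI_poly[OF _ g] by blast
  have r: "rapidly_decaying (\<lambda>x. rfrac_integral \<delta> v x - fracI k g x)"
    by (intro rapidly_decaying_diff rapidly_decaying_rfrac_integral rapidly_decaying_fracI v g del) simp
  have "ae_eq (\<lambda>x. rfrac_integral \<delta> v x - fracI k g x) (\<lambda>x. poly p (complex_of_real x))"
    using p unfolding ae_eq_def by eventually_elim simp
  then have "rapidly_decaying (\<lambda>x. poly p (complex_of_real x))" using r rapidly_decaying_cong by blast
  then have "frac_integrable 1 (\<lambda>x. poly p (complex_of_real x)) 1" by (simp add: rapidly_decaying_def)
  moreover have "indicat_real {1<..} y *\<^sub>R ((y - 1) powr (1 - 1) *\<^sub>R poly p (complex_of_real y)) = indicat_real {1<..} y *\<^sub>R poly p (complex_of_real y)" for y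
    by (simp add: indicator_def)
  ultimately have "p = 0"
    by (intro poly_integrable_imp_zero) (simp only: frac_integrable_def set_integrable_def)
  with p have 1: "ae_eq (fracI \<delta> v) (fracI k g)" using del by (simp add: fracI_def)
  have 2: "ae_eq (fracI \<delta> (fracI \<mu> g)) (fracI k g)"
    using fracI_add[OF g, of \<delta> \<mu>] del mu by (simp add: \<delta>_def)
  let ?w = "\<lambda>x. v x - fracI \<mu> g x"
  have rm: "rapidly_decaying (fracI \<mu> g)" by (rule rapidly_decaying_fracI[OF g mu])
  have "ae_eq (fracI \<delta> ?w) (\<lambda>x. fracI \<delta> v x - fracI \<delta> (fracI \<mu> g) x)"
    by (rule fracI_diff[OF v rm]) (use del in simp)
  then have "ae_eq (fracI \<delta> ?w) (\<lambda>x. 0)" using 1 2 unfolding ae_eq_def by eventually_elim simp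
  then have "ae_eq ?w (\<lambda>x. 0)" by (rule fracI_injective[OF rapidly_decaying_diff[OF v rm] del(1,2)])
  then show ?thesis unfolding ae_eq_def by eventually_elim simp
qed

theorem has_rfrac_deriv_fracI:
  assumes "rapidly_decaying g" "\<mu> \<ge> 0" "ae_eq v (fracI \<mu> g)"
  shows "has_rfrac_deriv \<mu> v g"
proof -
  define k where "k = frac_ord \<mu>"
  define \<delta> where "\<delta> = real k - \<mu>"
  have del: "0 < \<delta>" "\<delta> \<le> 1" "k > 0" using frac_ord_bounds[OF assms(2)] by (auto simp: \<delta>_def k_def)
  have v: "rapidly_decaying v" using rapidly_decaying_cong[OF assms(3)] rapidly_decaying_fracI[OF assms(1,2)] by simp
  have "ae_eq (fracI \<delta> v) (fracI \<delta> (fracI \<mu> g))" by (rule fracI_cong[OF assms(3)])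
  also have "ae_eq (fracI \<delta> (fracI \<mu> g)) (fracI k g)"
    using fracI_add[OF assms(1), of \<delta> \<mu>] del assms(2) by (simp add: \<delta>_def)
  finally have "has_ac_derivs k (fracI \<delta> v) (\<lambda>x. (-1) ^ k * g x)" by (rule has_ac_derivs_fracI[OF assms(1)])
  then have "has_ac_derivs k (rfrac_integral \<delta> v) (\<lambda>x. (-1) ^ k * g x)" using del by (simp add: fracI_def)
  moreover have "rfrac_integral_exists \<delta> v"
    unfolding rfrac_integral_exists_iff by (rule rapidly_decaying_frac_integrable[OF v del(1)])
  ultimately show ?thesis by (simp add: has_rfrac_deriv_def k_def \<delta>_def Let_def)
qed

section \<open>Fractional integrals in the weighted spaces\<close>

text \<open>
  The inequality \<open>P Q \<le> P\<^sup>2 + Q\<^sup>2\<close> separates the square of \<open>f\<close>, which is integrable with the weight,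
  from an explicit Gamma integrand; \<open>\<beta> \<ge> a + 1\<close> keeps the latter integrable at \<open>0\<close>.
\<close>

lemma wL2_frac_integrable_0:
  assumes f: "f \<in> wL2 a" and a: "a > -1" and c: "c > 0" and b: "\<beta> \<ge> a + 1"
  shows "frac_integrable \<beta> (\<lambda>y. exp (- c * y) *\<^sub>R f y) 0"
proof -
  let ?k = "\<lambda>y. y powr (\<beta> - 1) * exp (- c * y)"
  have eq: "indicat_real {0<..} y *\<^sub>R ((y - 0) powr (\<beta> - 1) *\<^sub>R (exp (- c * y) *\<^sub>R f y))
      = ?k y *\<^sub>R (indicat_real {0<..} y *\<^sub>R f y)" for y by (simp add: indicator_def)
  show ?thesis unfolding frac_integrable_def set_integrable_def eq
  proof (rule Bochner_Integration.integrable_bound)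
    have "set_integrable lebesgue {0<..} (\<lambda>y. y powr ((2 * \<beta> - 1 - a) - 1) * exp (- (2 * c) * y))"
      by (rule set_integrable_powr_exp) (use a b c in auto)
    moreover have "set_integrable lebesgue {0<..} (\<lambda>y. (cmod (f y))\<^sup>2 * y powr a)"
      using f by (simp add: wL2_def)
    ultimately show "integrable lebesgue (\<lambda>y. indicat_real {0<..} y *\<^sub>R ((cmod (f y))\<^sup>2 * y powr a)
        + indicat_real {0<..} y *\<^sub>R (y powr ((2 * \<beta> - 1 - a) - 1) * exp (- (2 * c) * y)))"
      unfolding set_integrable_def by (intro Bochner_Integration.integrable_add)
    have "?k \<in> borel_measurable lebesgue" by (rule measurable_completion) measurable
    moreover have "(\<lambda>y. indicat_real {0<..} y *\<^sub>R f y) \<in> borel_measurable lebesgue"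
      using f by (simp add: wL2_def set_borel_measurable_def)
    ultimately show "(\<lambda>y. ?k y *\<^sub>R (indicat_real {0<..} y *\<^sub>R f y)) \<in> borel_measurable lebesgue"
      by (rule borel_measurable_scaleR)
    show "AE y in lebesgue. norm (?k y *\<^sub>R (indicat_real {0<..} y *\<^sub>R f y))
      \<le> norm (indicat_real {0<..} y *\<^sub>R ((cmod (f y))\<^sup>2 * y powr a)
        + indicat_real {0<..} y *\<^sub>R (y powr ((2 * \<beta> - 1 - a) - 1) * exp (- (2 * c) * y)))"
    proof (intro AE_I2)
      fix y :: real
      show "norm (?k y *\<^sub>R (indicat_real {0<..} y *\<^sub>R f y))
        \<le> norm (indicat_real {0<..} y *\<^sub>R ((cmod (f y))\<^sup>2 * y powr a)
          + indicat_real {0<..} y *\<^sub>R (y powr ((2 * \<beta> - 1 - a) - 1) * exp (- (2 * c) * y)))"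
      proof (cases "y > 0")
        case True
        define P where "P = cmod (f y) * y powr (a / 2)"
        define Q where "Q = y powr (\<beta> - 1 - a / 2) * exp (- c * y)"
        have "P\<^sup>2 = (cmod (f y))\<^sup>2 * y powr a"
          using True by (simp add: P_def power_mult_distrib power2_eq_square[of "y powr _"] flip: powr_add)
        moreover have "Q\<^sup>2 = y powr ((2 * \<beta> - 1 - a) - 1) * exp (- (2 * c) * y)"
        proof -
          have "Q\<^sup>2 = (y powr (\<beta> - 1 - a / 2) * y powr (\<beta> - 1 - a / 2)) * (exp (- c * y) * exp (- c * y))"
            by (simp add: Q_def power2_eq_square mult_ac)
          also have "\<dots> = y powr ((2 * \<beta> - 1 - a) - 1) * exp (- (2 * c) * y)"
            unfolding powr_add[symmetric] exp_add[symmetric] by (simp add: algebra_simps)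
          finally show ?thesis .
        qed
        moreover have "cmod (f y) * ?k y = P * Q"
        proof -
          have "y powr (\<beta> - 1) = y powr (a / 2) * y powr (\<beta> - 1 - a / 2)" by (simp flip: powr_add)
          then show ?thesis by (simp add: P_def Q_def)
        qed
        moreover have "P * Q \<le> P\<^sup>2 + Q\<^sup>2"
        proof -
          have "0 \<le> P * Q" by (simp add: P_def Q_def)
          then show ?thesis using sum_squares_bound[of P Q] by linarith
        qed
        ultimately show ?thesis using True by (simp add: mult.commute)
      qed simp
    qed
  qed
qed

text \<open>
  To the right of \<open>x > 0\<close> the kernel of order \<open>\<beta>\<close> is dominated by a multiple of the kernel at base
  point \<open>0\<close> of order \<open>\<beta> + a + 1\<close>.
\<close>

lemma wL2_rapidly_decaying:
  assumes f: "f \<in> wL2 a" and a: "a > -1" and c: "c > 0"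
  shows "rapidly_decaying (\<lambda>y. exp (- c * y) *\<^sub>R f y)"
  unfolding rapidly_decaying_def
proof (intro allI impI)
  fix x \<beta> :: real assume x: "x > 0" and b: "\<beta> \<ge> 1"
  let ?g = "\<lambda>y. exp (- c * y) *\<^sub>R f y"
  have int0: "integrable lebesgue (\<lambda>y. indicat_real {0<..} y *\<^sub>R ((y - 0) powr (\<beta> + a + 1 - 1) *\<^sub>R ?g y))"
    using wL2_frac_integrable_0[OF f a c, of "\<beta> + a + 1"] b unfolding frac_integrable_def set_integrable_def by simp
  show "frac_integrable \<beta> ?g x" unfolding frac_integrable_def set_integrable_def
  proof (rule Bochner_Integration.integrable_bound)
    show "integrable lebesgue (\<lambda>y. x powr (- (a + 1)) *\<^sub>R (indicat_real {0<..} y *\<^sub>R ((y - 0) powr (\<beta> + a + 1 - 1) *\<^sub>R ?g y)))"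
      by (rule integrable_scaleR_right) (rule int0)
    have "(\<lambda>y. indicat_real {x<..} y * (y - x) powr (\<beta> - 1) * exp (- c * y)) \<in> borel_measurable lebesgue"
      by (rule measurable_completion) measurable
    moreover have "(\<lambda>y. indicat_real {0<..} y *\<^sub>R f y) \<in> borel_measurable lebesgue"
      using f by (simp add: wL2_def set_borel_measurable_def)
    ultimately have "(\<lambda>y. (indicat_real {x<..} y * (y - x) powr (\<beta> - 1) * exp (- c * y)) *\<^sub>R (indicat_real {0<..} y *\<^sub>R f y)) \<in> borel_measurable lebesgue"
      by (rule borel_measurable_scaleR)
    also have "(\<lambda>y. (indicat_real {x<..} y * (y - x) powr (\<beta> - 1) * exp (- c * y)) *\<^sub>R (indicat_real {0<..} y *\<^sub>R f y))
      = (\<lambda>y. indicat_real {x<..} y *\<^sub>R ((y - x) powr (\<beta> - 1) *\<^sub>R ?g y))"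
      using x by (auto simp: fun_eq_iff indicator_def)
    finally show "(\<lambda>y. indicat_real {x<..} y *\<^sub>R ((y - x) powr (\<beta> - 1) *\<^sub>R ?g y)) \<in> borel_measurable lebesgue" .
    show "AE y in lebesgue. norm (indicat_real {x<..} y *\<^sub>R ((y - x) powr (\<beta> - 1) *\<^sub>R ?g y))
      \<le> norm (x powr (- (a + 1)) *\<^sub>R (indicat_real {0<..} y *\<^sub>R ((y - 0) powr (\<beta> + a + 1 - 1) *\<^sub>R ?g y)))"
    proof (intro AE_I2)
      fix y
      show "norm (indicat_real {x<..} y *\<^sub>R ((y - x) powr (\<beta> - 1) *\<^sub>R ?g y))
        \<le> norm (x powr (- (a + 1)) *\<^sub>R (indicat_real {0<..} y *\<^sub>R ((y - 0) powr (\<beta> + a + 1 - 1) *\<^sub>R ?g y)))"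
      proof (cases "x < y")
        case True
        have "(y - x) powr (\<beta> - 1) \<le> y powr (\<beta> - 1)"
          using x b True by (intro powr_mono2) auto
        also have "\<dots> = y powr (- (a + 1)) * y powr (\<beta> + a)" by (simp flip: powr_add)
        also have "\<dots> \<le> x powr (- (a + 1)) * y powr (\<beta> + a)"
          using x a True by (intro mult_right_mono powr_mono2') auto
        finally have "(y - x) powr (\<beta> - 1) * norm (?g y) \<le> x powr (- (a + 1)) * y powr (\<beta> + a) * norm (?g y)"
          by (rule mult_right_mono) simp
        then show ?thesis using x True by (simp add: mult_ac)
      qed simp
    qed
  qed
qed

text \<open>
  Substituting \<open>y = x + t\<close> and expanding \<open>(x + t) ^ m\<close> leaves Gamma integrals in \<open>t\<close>.
\<close>

lemma rfrac_integral_exp_monom: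
  assumes s: "s > 0" and c: "c > 0"
  shows "frac_integrable s (\<lambda>y. exp (- c * y) *\<^sub>R complex_of_real y ^ m) x"
    and "rfrac_integral s (\<lambda>y. exp (- c * y) *\<^sub>R complex_of_real y ^ m) x
      = exp (- c * x) *\<^sub>R poly (\<Sum>k\<le>m. monom (of_real (real (m choose k) * Gamma (s + k) / (Gamma s * c powr (s + k)))) (m - k)) (complex_of_real x)"
proof -
  let ?G = "\<lambda>y. indicat_real {x<..} y * ((y - x) powr (s - 1) * exp (- c * y) * y ^ m)"
  let ?K = "\<lambda>k t. indicat_real {0<..} t *\<^sub>R (t powr (s + real k - 1) * exp (- c * t))"
  let ?w = "\<lambda>k. exp (- c * x) * real (m choose k) * x ^ (m - k)"
  have K: "integrable lborel (?K k)" "integral\<^sup>L lborel (?K k) = Gamma (s + k) / c powr (s + k)" for k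
  proof -
    have p: "s + real k > 0" using s by simp
    have m: "?K k \<in> borel_measurable lborel" by measurable
    show "integrable lborel (?K k)"
      using set_integrable_powr_exp[OF p c] unfolding set_integrable_def integrable_completion[OF m] .
    show "integral\<^sup>L lborel (?K k) = Gamma (s + k) / c powr (s + k)"
      using integral_powr_exp[OF p c] unfolding set_lebesgue_integral_def integral_completion[OF m] .
  qed
  have shift: "?G (x + 1 * t) = (\<Sum>k\<le>m. ?w k * ?K k t)" for t
  proof (cases "t > 0")
    case True
    have "?G (x + 1 * t) = exp (- c * x) * (t powr (s - 1) * exp (- c * t)) * (t + x) ^ m"
      using True by (simp add: exp_add distrib_left add.commute exp_minus exp_diff field_simps)
    also have "(t + x) ^ m = (\<Sum>k\<le>m. real (m choose k) * t ^ k * x ^ (m - k))"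
      by (rule binomial_ring)
    also have "exp (- c * x) * (t powr (s - 1) * exp (- c * t)) * \<dots> = (\<Sum>k\<le>m. ?w k * ?K k t)"
      unfolding sum_distrib_left
    proof (intro sum.cong refl)
      fix k
      have "t powr (s + real k - 1) = t powr (s - 1) * t ^ k"
        using True by (simp add: powr_realpow[symmetric] algebra_simps flip: powr_add)
      then show "exp (- c * x) * (t powr (s - 1) * exp (- c * t)) * (real (m choose k) * t ^ k * x ^ (m - k)) = ?w k * ?K k t"
        using True by simp
    qed
    finally show ?thesis .
  qed simp
  have "integrable lborel (\<lambda>t. ?G (x + 1 * t))"
    unfolding shift by (intro Bochner_Integration.integrable_sum integrable_mult_right K(1))
  then have Gi: "integrable lborel ?G" by (subst (asm) lborel_integrable_real_affine_iff) simp_all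
  have Gm: "?G \<in> borel_measurable lborel" by measurable
  have "integral\<^sup>L lborel ?G = \<bar>1\<bar> *\<^sub>R (\<integral>t. ?G (x + 1 * t) \<partial>lborel)"
    by (rule lborel_integral_real_affine) simp
  also have "\<dots> = (\<integral>t. (\<Sum>k\<le>m. ?w k * ?K k t) \<partial>lborel)" unfolding shift by simp
  also have "\<dots> = (\<Sum>k\<le>m. ?w k * integral\<^sup>L lborel (?K k))"
    unfolding integral_mult_right_zero[symmetric]
    by (rule Bochner_Integration.integral_sum) (intro integrable_mult_right K(1))
  finally have Gv: "integral\<^sup>L lebesgue ?G = (\<Sum>k\<le>m. ?w k * (Gamma (s + k) / c powr (s + k)))"
    unfolding K(2) integral_completion[OF Gm] .
  have Gl: "integrable lebesgue ?G" unfolding integrable_completion[OF Gm] by (rule Gi)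
  have eq: "indicat_real {x<..} y *\<^sub>R ((y - x) powr (s - 1) *\<^sub>R (exp (- c * y) *\<^sub>R complex_of_real y ^ m)) = complex_of_real (?G y)" for y
    by (simp add: scaleR_conv_of_real)
  show "frac_integrable s (\<lambda>y. exp (- c * y) *\<^sub>R complex_of_real y ^ m) x"
    unfolding frac_integrable_def set_integrable_def eq using Gl by (rule integrable_of_real)
  have "rfrac_integral s (\<lambda>y. exp (- c * y) *\<^sub>R complex_of_real y ^ m) x
     = complex_of_real (1 / Gamma s * (\<Sum>k\<le>m. ?w k * (Gamma (s + k) / c powr (s + k))))"
    unfolding rfrac_integral_def set_lebesgue_integral_def eq integral_complex_of_real Gv
    by (simp only: scaleR_conv_of_real of_real_mult)
  also have "\<dots> = exp (- c * x) *\<^sub>R poly (\<Sum>k\<le>m. monom (of_real (real (m choose k) * Gamma (s + k) / (Gamma s * c powr (s + k)))) (m - k)) (complex_of_real x)"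
    unfolding poly_sum poly_monom scaleR_sum_right sum_distrib_left of_real_sum
    by (intro sum.cong refl) (simp add: scaleR_conv_of_real mult_ac)
  finally show "rfrac_integral s (\<lambda>y. exp (- c * y) *\<^sub>R complex_of_real y ^ m) x
      = exp (- c * x) *\<^sub>R poly (\<Sum>k\<le>m. monom (of_real (real (m choose k) * Gamma (s + k) / (Gamma s * c powr (s + k)))) (m - k)) (complex_of_real x)" .
qed

text \<open>
  On exponential polynomials the fractional integral is triangular with diagonal entries
  \<open>c powr (- s)\<close>, hence onto. So their fractional derivatives are again exponential polynomials.
\<close>

lemma exp_poly_fracI_preimage:
  assumes s: "s \<ge> 0" and c: "c > 0"
  shows "\<exists>q. fracI s (\<lambda>y. exp (- c * y) *\<^sub>R poly q (complex_of_real y))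
    = (\<lambda>x. exp (- c * x) *\<^sub>R poly p (complex_of_real x))"
proof (cases "s = 0")
  case True
  then show ?thesis by (auto simp: fracI_def)
next
  case False
  then have s: "s > 0" using s by simp
  define B where "B m = (\<Sum>k\<le>m. monom (complex_of_real (real (m choose k) * Gamma (s + k) / (Gamma s * c powr (s + k)))) (m - k))" for m
  have lead: "coeff (B m) m = complex_of_real (1 / c powr s)" for m
  proof -
    have "coeff (B m) m = (\<Sum>k\<le>m. if k = 0 then complex_of_real (1 / c powr s) else 0)"
      unfolding B_def coeff_sum
    proof (intro sum.cong refl)
      fix k assume "k \<in> {..m}"
      then show "coeff (monom (complex_of_real (real (m choose k) * Gamma (s + k) / (Gamma s * c powr (s + k)))) (m - k)) m
        = (if k = 0 then complex_of_real (1 / c powr s) else 0)"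
        using Gamma_real_pos[OF s] by auto
    qed
    then show ?thesis by simp
  qed
  have high: "coeff (B m) i = 0" if "i > m" for m i
    unfolding B_def coeff_sum using that by (intro sum.neutral) auto
  obtain a where a: "p = (\<Sum>i<Suc (degree p). smult (a i) (B i))"
    using triangular_spans[of B "Suc (degree p)" p] lead high c by (auto simp: coeff_eq_0)
  let ?q = "\<Sum>i<Suc (degree p). smult (a i) (monom 1 i)"
  let ?e = "\<lambda>i y. exp (- c * y) *\<^sub>R complex_of_real y ^ i"
  have q: "(\<lambda>y. exp (- c * y) *\<^sub>R poly ?q (complex_of_real y)) = (\<lambda>y. \<Sum>i<Suc (degree p). a i * ?e i y)"
    unfolding poly_sum scaleR_sum_right poly_smult poly_monom mult_scaleR_right by simp
  have "rfrac_integral s (\<lambda>y. exp (- c * y) *\<^sub>R poly ?q (complex_of_real y)) x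
     = exp (- c * x) *\<^sub>R poly p (complex_of_real x)" for x
  proof -
    have "rfrac_integral s (\<lambda>y. exp (- c * y) *\<^sub>R poly ?q (complex_of_real y)) x
       = (\<Sum>i<Suc (degree p). rfrac_integral s (\<lambda>y. a i * ?e i y) x)"
      unfolding q by (intro frac_integrable_sum(2) frac_integrable_cmult rfrac_integral_exp_monom(1) s c)
    also have "\<dots> = (\<Sum>i<Suc (degree p). a i * (exp (- c * x) *\<^sub>R poly (B i) (complex_of_real x)))"
      unfolding rfrac_integral_cmult rfrac_integral_exp_monom(2)[OF s c] B_def ..
    also have "\<dots> = exp (- c * x) *\<^sub>R poly (\<Sum>i<Suc (degree p). smult (a i) (B i)) (complex_of_real x)"
      unfolding poly_sum scaleR_sum_right poly_smult mult_scaleR_right ..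
    finally show ?thesis unfolding a[symmetric] .
  qed
  then show ?thesis using s by (intro exI[of _ ?q]) (auto simp: fracI_def fun_eq_iff)
qed

lemma weighted_ae_eq: "ae_eq f g \<Longrightarrow> AE x in lebesgue. weighted a f x = weighted a g x"
  unfolding ae_eq_def weighted_def by (auto elim: eventually_mono)

lemma wL2_ae_eq:
  assumes eq: "ae_eq f g" and f: "f \<in> wL2 a"
  shows "g \<in> wL2 a" and "wnorm a g = wnorm a f"
proof -
  have fL: "weighted a f \<in> L2 lebesgue" using f by (simp add: wL2_iff)
  note ae = weighted_ae_eq[OF eq, of a]
  have m: "weighted a g \<in> borel_measurable lebesgue"
    by (rule borel_measurable_lebesgue_cong_AE[OF L2_measurable[OF fL] ae])
  then have m2: "(\<lambda>x. (cmod (weighted a g x))\<^sup>2) \<in> borel_measurable lebesgue" by measurable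
  have ae2: "AE x in lebesgue. (cmod (weighted a f x))\<^sup>2 = (cmod (weighted a g x))\<^sup>2"
    using ae by eventually_elim simp
  have i: "integrable lebesgue (\<lambda>x. (cmod (weighted a f x))\<^sup>2)" using fL by (simp add: L2_def)
  show "g \<in> wL2 a" using integrable_cong_AE_imp[OF i m2] ae2 m
    by (auto simp: wL2_iff L2_def elim: eventually_mono)
  show "wnorm a g = wnorm a f"
    unfolding wnorm_sq_norm sq_norm_def
    by (intro arg_cong[where f = sqrt] integral_cong_AE m2 borel_measurable_integrable[OF i])
       (use ae2 in \<open>auto elim: eventually_mono\<close>)
qed

section \<open>Laguerre coefficients of tempered derivatives and of the projection\<close>

text \<open>
  By \<open>winner_lagfun\<close> both sides are the same combination of fractional integrals at \<open>0\<close>, of order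
  \<open>\<nu> + \<mu> + i + 1\<close> for \<open>exp (- lam x) G\<close> and of order \<open>\<nu> + i + 1\<close> for its fractional integral of order
  \<open>\<mu>\<close>; the semigroup law identifies them.
\<close>

lemma winner_fracI_lagfun:
  assumes nu: "\<nu> > -1" and mu: "\<mu> \<ge> 0" and lam: "lam > 0"
    and u: "u \<in> wL2 \<nu>" and G: "G \<in> wL2 (\<nu> + \<mu>)"
    and eq: "ae_eq (\<lambda>y. exp (- lam * y) *\<^sub>R u y) (fracI \<mu> (\<lambda>y. exp (- lam * y) *\<^sub>R G y))"
  shows "winner (\<nu> + \<mu>) G (lagfun (\<nu> + \<mu>) lam n) = winner \<nu> u (lagfun \<nu> lam n)"
proof -
  let ?v = "\<lambda>y. exp (- lam * y) *\<^sub>R u y" and ?g = "\<lambda>y. exp (- lam * y) *\<^sub>R G y"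
  have a: "\<nu> + \<mu> > -1" using nu mu by simp
  have "rfrac_integral (\<nu> + \<mu> + real i + 1) ?g 0 = rfrac_integral (\<nu> + real i + 1) ?v 0" for i
  proof -
    have "rfrac_integral (\<nu> + real i + 1) ?v 0 = rfrac_integral (\<nu> + real i + 1) (fracI \<mu> ?g) 0"
      by (rule rfrac_integral_cong[OF eq]) simp
    also have "\<dots> = rfrac_integral (\<nu> + \<mu> + real i + 1) ?g 0"
    proof (cases "\<mu> = 0")
      case False
      have "frac_integrable ((\<nu> + real i + 1) + \<mu>) ?g 0"
        by (rule wL2_frac_integrable_0[OF G a lam]) simp
      then have "rfrac_integral (\<nu> + real i + 1) (rfrac_integral \<mu> ?g) 0 = rfrac_integral ((\<nu> + real i + 1) + \<mu>) ?g 0"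
        by (intro rfrac_integral_rfrac_integral) (use False mu nu in auto)
      then show ?thesis using False by (simp add: fracI_def add_ac)
    qed (simp add: fracI_def)
    finally show ?thesis by simp
  qed
  then show ?thesis unfolding winner_lagfun[OF a lam G] winner_lagfun[OF nu lam u] by simp
qed

lemma temp_deriv_fracI:
  assumes nu: "\<nu> > -1" and mu: "\<mu> \<ge> 0" and lam: "lam > 0"
    and u: "u \<in> wL2 \<nu>" and d: "temp_differentiable \<mu> lam u" and G: "temp_deriv \<mu> lam u \<in> wL2 (\<nu> + \<mu>)"
  shows "ae_eq (\<lambda>y. exp (- lam * y) *\<^sub>R u y) (fracI \<mu> (\<lambda>y. exp (- lam * y) *\<^sub>R temp_deriv \<mu> lam u y))"
proof -
  let ?v = "\<lambda>y. exp (- lam * y) *\<^sub>R u y"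
  have g: "(\<lambda>y. exp (- lam * y) *\<^sub>R temp_deriv \<mu> lam u y) = rfrac_deriv \<mu> ?v"
    by (auto simp: temp_deriv_def fun_eq_iff simp flip: exp_add)
  have "rapidly_decaying (\<lambda>y. exp (- lam * y) *\<^sub>R temp_deriv \<mu> lam u y)"
    by (rule wL2_rapidly_decaying[OF G _ lam]) (use nu mu in simp)
  moreover have "has_rfrac_deriv \<mu> ?v (rfrac_deriv \<mu> ?v)"
    using d unfolding temp_differentiable_def rfrac_deriv_def by (rule someI_ex)
  ultimately show ?thesis unfolding g
    by (intro has_rfrac_deriv_imp_eq_fracI mu wL2_rapidly_decaying[OF u nu lam])
qed

text \<open>
  The chosen representative of the tempered derivative agrees almost everywhere with any
  function that reproduces \<open>u\<close> by fractional integration.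
\<close>

lemma fracI_temp_deriv:
  assumes a: "a > -1" and mu: "\<mu> \<ge> 0" and lam: "lam > 0" and G: "G \<in> wL2 a"
    and eq: "ae_eq (\<lambda>y. exp (- lam * y) *\<^sub>R u y) (fracI \<mu> (\<lambda>y. exp (- lam * y) *\<^sub>R G y))"
  shows "temp_differentiable \<mu> lam u" and "ae_eq G (temp_deriv \<mu> lam u)"
proof -
  let ?v = "\<lambda>y. exp (- lam * y) *\<^sub>R u y"
  have h: "has_rfrac_deriv \<mu> ?v (\<lambda>y. exp (- lam * y) *\<^sub>R G y)"
    by (rule has_rfrac_deriv_fracI[OF wL2_rapidly_decaying[OF G a lam] mu eq])
  then show "temp_differentiable \<mu> lam u" unfolding temp_differentiable_def by blast
  have "has_rfrac_deriv \<mu> ?v (rfrac_deriv \<mu> ?v)" unfolding rfrac_deriv_def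
    by (rule someI[of "has_rfrac_deriv \<mu> ?v", OF h])
  then have "ae_eq (\<lambda>y. exp (- lam * y) *\<^sub>R G y) (rfrac_deriv \<mu> ?v)" using has_rfrac_deriv_unique h by blast
  then show "ae_eq G (temp_deriv \<mu> lam u)"
    unfolding ae_eq_def temp_deriv_def
    by eventually_elim (auto simp flip: exp_add dest: sym)
qed

lemma lagfun_sum:
  "exp (- lam * x) *\<^sub>R poly (\<Sum>i<n. smult (b i) (laguerre \<alpha> (2 * lam) i)) (complex_of_real x)
    = (\<Sum>i<n. b i * lagfun \<alpha> lam i x)"
  by (simp add: lagfun_def poly_sum scaleR_sum_right)

lemma winner_lagfun_sum:
  assumes a: "\<alpha> > -1" and lam: "lam > 0"
  shows "winner \<alpha> (\<lambda>x. \<Sum>i<n. b i * lagfun \<alpha> lam i x) (lagfun \<alpha> lam j)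
    = (if j < n then b j * of_real (lagnorm \<alpha> lam j) else 0)"
proof -
  interpret L2_orthogonal lebesgue "\<lambda>n. weighted \<alpha> (lagfun \<alpha> lam n)" "lagnorm \<alpha> lam"
    by (rule L2_orthogonal_lagfun[OF a lam])
  have "winner \<alpha> (\<lambda>x. \<Sum>i<n. b i * lagfun \<alpha> lam i x) (lagfun \<alpha> lam j)
    = (\<Sum>i<n. b i * winner \<alpha> (lagfun \<alpha> lam i) (lagfun \<alpha> lam j))"
    by (subst winner_sum_left) (auto intro!: wL2_cmult lagfun_wL2 a lam simp: winner_cmult_left)
  also have "\<dots> = (\<Sum>i<n. if i = j then b j * of_real (lagnorm \<alpha> lam j) else 0)"
    by (intro sum.cong refl) (simp add: winner_L2_inner orth L2_inner_self sq_norm_\<psi>)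
  finally show ?thesis by simp
qed

text \<open>
  The Fourier sum of \<open>u\<close> has the defining property of the projection. Two functions with this
  property differ by an exponential polynomial all of whose Laguerre coefficients vanish, so they
  coincide everywhere and not only almost everywhere.
\<close>

lemma temp_proj_orthogonal:
  assumes nu: "\<nu> > -1" and lam: "lam > 0" and u: "u \<in> wL2 \<nu>"
  obtains p where "degree p \<le> N" "temp_proj N \<nu> lam u = (\<lambda>x. exp (- lam * x) *\<^sub>R poly p (complex_of_real x))"
    "\<And>n. n \<le> N \<Longrightarrow> winner \<nu> (\<lambda>x. temp_proj N \<nu> lam u x - u x) (lagfun \<nu> lam n) = 0"
proof -
  let ?E = "\<lambda>p x. exp (- lam * x) *\<^sub>R poly p (complex_of_real x)"
  let ?P = "\<lambda>q. q \<in> exp_polys N lam \<and> (\<forall>\<phi>\<in>exp_polys N lam. winner \<nu> (\<lambda>x. q x - u x) \<phi> = 0)"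
  have EL: "?E p \<in> wL2 \<nu>" for p by (rule exp_poly_wL2[OF nu lam])
  have span: "\<exists>b. ?E p = (\<lambda>x. \<Sum>i<Suc N. b i * lagfun \<nu> lam i x) \<and> p = (\<Sum>i<Suc N. smult (b i) (laguerre \<nu> (2 * lam) i))"
    if "degree p \<le> N" for p
    using laguerre_spans[OF nu, of "2 * lam" p "Suc N"] that lam lagfun_sum by (fastforce simp: less_Suc_eq_le simp del: sum.lessThan_Suc)
  have deg: "degree (laguerre \<nu> (2 * lam) n) \<le> n" for n
    by (rule degree_le) (simp add: coeff_laguerre)
  have lagE: "lagfun \<nu> lam n \<in> exp_polys N lam" if "n \<le> N" for n
    unfolding exp_polys_def lagfun_def[abs_def] using deg[of n] that by fastforce
  have h: "lagnorm \<nu> lam n > 0" for n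
    using L2_orthogonal.h_pos[OF L2_orthogonal_lagfun[OF nu lam]] .
  define b where "b i = winner \<nu> u (lagfun \<nu> lam i) / of_real (lagnorm \<nu> lam i)" for i
  define p where "p = (\<Sum>i<Suc N. smult (b i) (laguerre \<nu> (2 * lam) i))"
  have degp: "degree p \<le> N" unfolding p_def
    by (intro degree_sum_le order_trans[OF degree_smult_le] order_trans[OF deg]) auto
  have Ep: "?E p = (\<lambda>x. \<Sum>i<Suc N. b i * lagfun \<nu> lam i x)" unfolding p_def lagfun_sum ..
  have orthE: "winner \<nu> (\<lambda>x. ?E p x - u x) (lagfun \<nu> lam n) = 0" if "n \<le> N" for n
  proof -
    have "winner \<nu> (?E p) (lagfun \<nu> lam n) = winner \<nu> u (lagfun \<nu> lam n)"
      unfolding Ep winner_lagfun_sum[OF nu lam] using that h[of n] by (simp add: b_def)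
    then show ?thesis by (subst winner_diff_left[OF EL u lagfun_wL2[OF nu lam]]) simp
  qed
  have PE: "?P (?E p)"
  proof (intro conjI ballI)
    show "?E p \<in> exp_polys N lam" using degp by (auto simp: exp_polys_def)
    fix \<phi> assume "\<phi> \<in> exp_polys N lam"
    then obtain q where q: "degree q \<le> N" "\<phi> = ?E q" by (auto simp: exp_polys_def)
    then obtain d where d: "\<phi> = (\<lambda>x. \<Sum>i<Suc N. d i * lagfun \<nu> lam i x)" using span by blast
    have eL: "(\<lambda>x. ?E p x - u x) \<in> wL2 \<nu>" by (rule wL2_diff[OF EL u])
    have "winner \<nu> \<phi> (\<lambda>x. ?E p x - u x) = (\<Sum>i<Suc N. d i * winner \<nu> (lagfun \<nu> lam i) (\<lambda>x. ?E p x - u x))"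
      unfolding d winner_cmult_left[symmetric]
      by (intro winner_sum_left wL2_cmult lagfun_wL2 nu lam eL)
    also have "\<dots> = 0"
    proof (intro sum.neutral ballI)
      fix i assume "i \<in> {..<Suc N}"
      then show "d i * winner \<nu> (lagfun \<nu> lam i) (\<lambda>x. ?E p x - u x) = 0"
        using orthE[of i] by (subst winner_cnj) simp
    qed
    finally show "winner \<nu> (\<lambda>x. ?E p x - u x) \<phi> = 0" by (subst winner_cnj) simp
  qed
  have uniq: "q = ?E p" if q: "?P q" for q
  proof -
    obtain q' where q': "degree q' \<le> N" "q = ?E q'" using q by (auto simp: exp_polys_def)
    obtain d where d: "?E (q' - p) = (\<lambda>x. \<Sum>i<Suc N. d i * lagfun \<nu> lam i x)"
      "q' - p = (\<Sum>i<Suc N. smult (d i) (laguerre \<nu> (2 * lam) i))"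
      using span[of "q' - p"] degree_diff_le[OF q'(1) degp] by blast
    have "d n = 0" if "n < Suc N" for n
    proof -
      have "winner \<nu> (\<lambda>x. q x - u x) (lagfun \<nu> lam n) = 0" using q lagE[of n] that by auto
      moreover have "winner \<nu> (\<lambda>x. ?E p x - u x) (lagfun \<nu> lam n) = 0" using orthE[of n] that by simp
      ultimately have "winner \<nu> q (lagfun \<nu> lam n) = winner \<nu> (?E p) (lagfun \<nu> lam n)"
        using winner_diff_left[OF EL[of q'] u lagfun_wL2[OF nu lam]] winner_diff_left[OF EL[of p] u lagfun_wL2[OF nu lam]]
        unfolding q'(2) by simp
      then have "winner \<nu> (\<lambda>x. ?E q' x - ?E p x) (lagfun \<nu> lam n) = 0"
        unfolding q'(2) by (subst winner_diff_left[OF EL EL lagfun_wL2[OF nu lam]]) simp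
      moreover have "(\<lambda>x. ?E q' x - ?E p x) = ?E (q' - p)" by (simp add: scaleR_diff_right)
      ultimately have "winner \<nu> (\<lambda>x. \<Sum>i<Suc N. d i * lagfun \<nu> lam i x) (lagfun \<nu> lam n) = 0"
        unfolding d(1)[symmetric] by simp
      then show "d n = 0" unfolding winner_lagfun_sum[OF nu lam] using that h[of n] by simp
    qed
    then have "q' - p = 0" unfolding d(2) by (intro sum.neutral) auto
    then show ?thesis using q'(2) by simp
  qed
  have "temp_proj N \<nu> lam u = ?E p"
    unfolding temp_proj_def by (rule the_equality[of ?P]) (fact PE, rule uniq)
  with degp orthE show ?thesis using that[of p] by simp
qed

section \<open>The error estimate\<close>

text \<open>
  One step multiplies the quotient by \<open>(n + a) / (n + b) \<le> 1\<close>.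
\<close>

lemma Gamma_shift_ratio_antimono:
  fixes a b :: real
  assumes "0 < a" "a \<le> b" "m \<le> n"
  shows "Gamma (real n + a) / Gamma (real n + b) \<le> Gamma (real m + a) / Gamma (real m + b)"
  using assms(3)
proof (induction rule: dec_induct)
  case base
  show ?case by simp
next
  case (step n)
  have pos: "real n + a > 0" "real n + b > 0" using assms by auto
  have "Gamma (real n + a + 1) = (real n + a) * Gamma (real n + a)"
    and "Gamma (real n + b + 1) = (real n + b) * Gamma (real n + b)"
    using pos by (auto intro!: Gamma_plus1 elim!: nonpos_Ints_cases)
  then have "Gamma (real (Suc n) + a) / Gamma (real (Suc n) + b)
      = (real n + a) / (real n + b) * (Gamma (real n + a) / Gamma (real n + b))"
    by (simp add: add_ac)
  also have "\<dots> \<le> 1 * (Gamma (real n + a) / Gamma (real n + b))"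
    using pos assms Gamma_real_pos[OF pos(1)] Gamma_real_pos[OF pos(2)]
    by (intro mult_right_mono) auto
  finally show ?case using step.IH by simp
qed

text \<open>
  Gauss' product formula for the Gamma function, read as an asymptotic statement.
\<close>

lemma Gamma_shift_asymptotic:
  fixes a :: real
  assumes "a > 0"
  shows "(\<lambda>n. Gamma (real n + a + 1) / (fact n * real n powr a)) \<longlonglongrightarrow> 1"
proof -
  have G: "Gamma a > 0" by (rule Gamma_real_pos[OF assms])
  have "(\<lambda>n. Gamma a * rGamma_series a n) \<longlonglongrightarrow> Gamma a * rGamma a"
    by (intro tendsto_intros)
  also have "Gamma a * rGamma a = 1" using G by (simp add: rGamma_inverse_Gamma)
  finally have "(\<lambda>n. Gamma a * rGamma_series a n) \<longlonglongrightarrow> 1" .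
  moreover have "eventually (\<lambda>n. Gamma a * rGamma_series a n = Gamma (real n + a + 1) / (fact n * real n powr a)) sequentially"
    using eventually_gt_at_top[of 0]
  proof eventually_elim
    case (elim n)
    have "a \<notin> \<int>\<^sub>\<le>\<^sub>0" using assms by (auto elim!: nonpos_Ints_cases)
    then have "pochhammer a (n + 1) = Gamma (a + real (n + 1)) / Gamma a"
      by (rule pochhammer_Gamma[of a "n + 1"])
    then have "Gamma a * pochhammer a (n + 1) = Gamma (real n + a + 1)"
      using G by (simp add: add_ac)
    moreover have "exp (a * ln (real n)) = real n powr a" using elim by (simp add: powr_def)
    ultimately show ?case by (simp add: rGamma_series_def)
  qed
  ultimately show ?thesis by (rule Lim_transform_eventually)
qed

lemma Gamma_shift_ratio_tendsto:
  fixes a b :: real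
  assumes "a > 0" "b > 0"
  shows "(\<lambda>n. real n powr (b - a) * (Gamma (real n + a + 1) / Gamma (real n + b + 1))) \<longlonglongrightarrow> 1"
proof -
  have "(\<lambda>n. (Gamma (real n + a + 1) / (fact n * real n powr a)) / (Gamma (real n + b + 1) / (fact n * real n powr b))) \<longlonglongrightarrow> 1 / 1"
    by (intro tendsto_divide Gamma_shift_asymptotic assms) simp
  moreover have "eventually (\<lambda>n. (Gamma (real n + a + 1) / (fact n * real n powr a)) / (Gamma (real n + b + 1) / (fact n * real n powr b))
     = real n powr (b - a) * (Gamma (real n + a + 1) / Gamma (real n + b + 1))) sequentially"
    using eventually_gt_at_top[of 0]
  proof eventually_elim
    case (elim n)
    have "Gamma (real n + b + 1) > 0" using assms by (intro Gamma_real_pos) simp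
    then show ?case using elim by (simp add: powr_diff field_simps)
  qed
  ultimately show ?thesis by (simp add: Lim_transform_eventually)
qed

text \<open>
  The error has the tempered derivative \<open>G\<close>, the difference of the derivatives of the
  projection and of \<open>u\<close>. Its Laguerre coefficients vanish up to index \<open>N\<close> and beyond \<open>N\<close> are the
  negatives of those of the derivative of \<open>u\<close> of order \<open>r\<close>; \<open>K\<close> is the largest quotient of the two
  normalisations beyond \<open>N\<close>, attained at \<open>N + 1\<close>.
\<close>

lemma temp_proj_error_bound:
  fixes u :: "real \<Rightarrow> complex" and N :: nat
  assumes nu: "\<nu> > 0" and s: "0 \<le> s" "s \<le> r" and lam: "lam > 0" and u: "u \<in> temp_space r \<nu> lam"
  defines "e \<equiv> \<lambda>x. temp_proj N \<nu> lam u x - u x"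
  shows "temp_differentiable s lam e" and "temp_deriv s lam e \<in> wL2 (\<nu> + s)"
    and "(wnorm (\<nu> + s) (temp_deriv s lam e))\<^sup>2
      \<le> (2 * lam) powr (s - r) * (Gamma (real N + \<nu> + s + 2) / Gamma (real N + \<nu> + r + 2))
        * (wnorm (\<nu> + r) (temp_deriv r lam u))\<^sup>2"
proof -
  have nu1: "\<nu> > -1" and nus: "\<nu> + s > -1" and nur: "\<nu> + r > -1" and r: "r \<ge> 0" using nu s by auto
  have uL: "u \<in> wL2 \<nu>" using u by (simp add: temp_space_def)
  define R where "R = temp_deriv r lam u"
  define S where "S = temp_deriv s lam u"
  have R: "temp_differentiable r lam u" "R \<in> wL2 (\<nu> + r)"
    and S: "temp_differentiable s lam u" "S \<in> wL2 (\<nu> + s)"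
    using u s r by (auto simp: temp_space_def R_def S_def)
  have vR: "ae_eq (\<lambda>y. exp (- lam * y) *\<^sub>R u y) (fracI r (\<lambda>y. exp (- lam * y) *\<^sub>R R y))"
    using temp_deriv_fracI[OF nu1 r lam uL R(1)] R(2) by (simp add: R_def)
  have vS: "ae_eq (\<lambda>y. exp (- lam * y) *\<^sub>R u y) (fracI s (\<lambda>y. exp (- lam * y) *\<^sub>R S y))"
    using temp_deriv_fracI[OF nu1 s(1) lam uL S(1)] S(2) by (simp add: S_def)
  obtain p where p: "degree p \<le> N" "temp_proj N \<nu> lam u = (\<lambda>x. exp (- lam * x) *\<^sub>R poly p (complex_of_real x))"
    and orth: "\<And>n. n \<le> N \<Longrightarrow> winner \<nu> e (lagfun \<nu> lam n) = 0"
    using temp_proj_orthogonal[OF nu1 lam uL, of N] unfolding e_def by blast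
  let ?p = "\<lambda>x. exp (- lam * x) *\<^sub>R poly p (complex_of_real x)"
  have pL: "?p \<in> wL2 \<nu>" by (rule exp_poly_wL2[OF nu1 lam])
  have e: "e = (\<lambda>x. ?p x - u x)" by (simp add: e_def p(2))
  have eL: "e \<in> wL2 \<nu>" unfolding e by (rule wL2_diff[OF pL uL])
  obtain q where q: "fracI s (\<lambda>y. exp (- (2 * lam) * y) *\<^sub>R poly q (complex_of_real y))
    = (\<lambda>x. exp (- (2 * lam) * x) *\<^sub>R poly p (complex_of_real x))"
    using exp_poly_fracI_preimage[OF s(1), of "2 * lam" p] lam by auto
  let ?q = "\<lambda>x. exp (- lam * x) *\<^sub>R poly q (complex_of_real x)"
  \<comment> \<open>The projection carries one factor \<open>exp (- lam x)\<close> and tempering contributes another, so the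
    fractional integral acts on functions with rate \<open>2 lam\<close>.\<close>
  have twice: "exp (- (2 * lam) * x) = exp (- lam * x) * exp (- lam * x)" for x by (simp flip: exp_add)
  have qL: "?q \<in> wL2 (\<nu> + s)" by (rule exp_poly_wL2[OF nus lam])
  define G where "G = (\<lambda>x. ?q x - S x)"
  have GL: "G \<in> wL2 (\<nu> + s)" unfolding G_def by (rule wL2_diff[OF qL S(2)])
  have pq: "fracI s (\<lambda>y. exp (- lam * y) *\<^sub>R ?q y) = (\<lambda>y. exp (- lam * y) *\<^sub>R ?p y)"
    using q unfolding twice by simp
  have "ae_eq (fracI s (\<lambda>y. exp (- lam * y) *\<^sub>R ?q y - exp (- lam * y) *\<^sub>R S y))
      (\<lambda>y. fracI s (\<lambda>y. exp (- lam * y) *\<^sub>R ?q y) y - fracI s (\<lambda>y. exp (- lam * y) *\<^sub>R S y) y)"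
    by (intro fracI_diff wL2_rapidly_decaying[OF qL nus lam] wL2_rapidly_decaying[OF S(2) nus lam] s)
  then have eG: "ae_eq (\<lambda>y. exp (- lam * y) *\<^sub>R e y) (fracI s (\<lambda>y. exp (- lam * y) *\<^sub>R G y))"
    using vS unfolding pq ae_eq_def G_def e scaleR_diff_right by eventually_elim (intro impI, simp only: simp_thms)
  show "temp_differentiable s lam e" by (rule fracI_temp_deriv(1)[OF nus s(1) lam GL eG])
  have GD: "ae_eq G (temp_deriv s lam e)" by (rule fracI_temp_deriv(2)[OF nus s(1) lam GL eG])
  show "temp_deriv s lam e \<in> wL2 (\<nu> + s)" by (rule wL2_ae_eq(1)[OF GD GL])
  define K where "K = (2 * lam) powr (s - r) * (Gamma (real N + \<nu> + s + 2) / Gamma (real N + \<nu> + r + 2))"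
  interpret Os: L2_orthogonal lebesgue "\<lambda>n. weighted (\<nu> + s) (lagfun (\<nu> + s) lam n)" "lagnorm (\<nu> + s) lam"
    by (rule L2_orthogonal_lagfun[OF nus lam])
  interpret Or: L2_orthogonal lebesgue "\<lambda>n. weighted (\<nu> + r) (lagfun (\<nu> + r) lam n)" "lagnorm (\<nu> + r) lam"
    by (rule L2_orthogonal_lagfun[OF nur lam])
  let ?cG = "\<lambda>n. winner (\<nu> + s) G (lagfun (\<nu> + s) lam n)"
  let ?cR = "\<lambda>n. winner (\<nu> + r) R (lagfun (\<nu> + r) lam n)"
  have Kpos: "K \<ge> 0" unfolding K_def using lam nu s
    by (intro mult_nonneg_nonneg divide_nonneg_nonneg less_imp_le[OF Gamma_real_pos]) auto
  have cGe: "?cG n = winner \<nu> e (lagfun \<nu> lam n)" for n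
    by (rule winner_fracI_lagfun[OF nu1 s(1) lam eL GL eG])
  have cRu: "?cR n = winner \<nu> u (lagfun \<nu> lam n)" for n
    by (rule winner_fracI_lagfun[OF nu1 r lam uL R(2) vR])
  have high: "?cG n = - ?cR n" if "n > N" for n
  proof -
    obtain b where b: "p = (\<Sum>i<Suc N. smult (b i) (laguerre \<nu> (2 * lam) i))"
      using laguerre_spans[OF nu1, of "2 * lam" p "Suc N"] p(1) lam by auto
    have "winner \<nu> ?p (lagfun \<nu> lam n) = 0"
      unfolding b lagfun_sum winner_lagfun_sum[OF nu1 lam] using that by simp
    then show ?thesis unfolding cGe cRu unfolding e
      by (subst winner_diff_left[OF pL uL lagfun_wL2[OF nu1 lam]]) simp
  qed
  have ratio: "lagnorm (\<nu> + r) lam n \<le> K * lagnorm (\<nu> + s) lam n" if "n > N" for n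
  proof -
    have pos: "Gamma (\<nu> + s + real n + 1) > 0" "Gamma (\<nu> + r + real n + 1) > 0"
      using nu s by (auto intro!: Gamma_real_pos)
    have "Gamma (real n + (\<nu> + s + 1)) / Gamma (real n + (\<nu> + r + 1))
        \<le> Gamma (real (Suc N) + (\<nu> + s + 1)) / Gamma (real (Suc N) + (\<nu> + r + 1))"
      by (rule Gamma_shift_ratio_antimono) (use nu s that in auto)
    then have "Gamma (\<nu> + s + real n + 1) / Gamma (\<nu> + r + real n + 1)
        \<le> Gamma (real N + \<nu> + s + 2) / Gamma (real N + \<nu> + r + 2)"
      by (simp add: add_ac)
    then have "(2 * lam) powr (s - r) * (Gamma (\<nu> + s + real n + 1) / Gamma (\<nu> + r + real n + 1)) \<le> K"
      unfolding K_def by (intro mult_left_mono) auto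
    then have "((2 * lam) powr (s - r) * (Gamma (\<nu> + s + real n + 1) / Gamma (\<nu> + r + real n + 1))) * lagnorm (\<nu> + s) lam n
        \<le> K * lagnorm (\<nu> + s) lam n"
      by (rule mult_right_mono) (rule less_imp_le[OF Os.h_pos])
    also have "((2 * lam) powr (s - r) * (Gamma (\<nu> + s + real n + 1) / Gamma (\<nu> + r + real n + 1))) * lagnorm (\<nu> + s) lam n
        = lagnorm (\<nu> + r) lam n"
    proof -
      have "(2 * lam) powr (\<nu> + s + 1) = (2 * lam) powr (s - r) * (2 * lam) powr (\<nu> + r + 1)"
        by (simp add: add_ac flip: powr_add)
      then show ?thesis using pos lam by (simp add: lagnorm_def)
    qed
    finally show ?thesis .
  qed
  have coef: "(cmod (?cG n))\<^sup>2 / lagnorm (\<nu> + s) lam n \<le> K * ((cmod (?cR n))\<^sup>2 / lagnorm (\<nu> + r) lam n)" for n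
  proof (cases "n \<le> N")
    case True
    then show ?thesis using orth[OF True] Kpos Or.h_pos[of n] unfolding cGe by (simp add: less_imp_le)
  next
    case False
    then have "n > N" by simp
    then have "1 / lagnorm (\<nu> + s) lam n \<le> K / lagnorm (\<nu> + r) lam n"
      using ratio[of n] Os.h_pos[of n] Or.h_pos[of n] by (simp add: field_simps)
    then have "(cmod (?cR n))\<^sup>2 * (1 / lagnorm (\<nu> + s) lam n) \<le> (cmod (?cR n))\<^sup>2 * (K / lagnorm (\<nu> + r) lam n)"
      by (rule mult_left_mono) simp
    then show ?thesis using high[OF \<open>n > N\<close>] by (simp add: mult_ac)
  qed
  have "sq_norm lebesgue (weighted (\<nu> + s) G) \<le> K * sq_norm lebesgue (weighted (\<nu> + r) R)"
  proof (rule Os.Parseval_le)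
    show "weighted (\<nu> + s) G \<in> L2 lebesgue" using GL by (simp add: wL2_iff)
    fix n
    have "(\<Sum>i<n. (cmod (L2_inner lebesgue (weighted (\<nu> + s) G) (weighted (\<nu> + s) (lagfun (\<nu> + s) lam i))))\<^sup>2 / lagnorm (\<nu> + s) lam i)
        \<le> (\<Sum>i<n. K * ((cmod (?cR i))\<^sup>2 / lagnorm (\<nu> + r) lam i))"
      unfolding winner_L2_inner[symmetric] by (intro sum_mono coef)
    also have "\<dots> = K * (\<Sum>i<n. (cmod (?cR i))\<^sup>2 / lagnorm (\<nu> + r) lam i)" by (rule sum_distrib_left[symmetric])
    also have "\<dots> \<le> K * sq_norm lebesgue (weighted (\<nu> + r) R)"
      unfolding winner_L2_inner by (intro mult_left_mono Or.Bessel Kpos) (use R(2) in \<open>simp add: wL2_iff\<close>)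
    finally show "(\<Sum>i<n. (cmod (L2_inner lebesgue (weighted (\<nu> + s) G) (weighted (\<nu> + s) (lagfun (\<nu> + s) lam i))))\<^sup>2 / lagnorm (\<nu> + s) lam i)
        \<le> K * sq_norm lebesgue (weighted (\<nu> + r) R)" .
  next
    fix \<epsilon> :: real assume "\<epsilon> > 0"
    then obtain P where P: "sq_norm lebesgue (weighted (\<nu> + s) (\<lambda>x. G x - exp (- lam * x) *\<^sub>R poly P (complex_of_real x))) < \<epsilon>"
      using exp_polys_dense[OF nus lam GL] unfolding expoly_closure_def by blast
    obtain b where b: "P = (\<Sum>i<Suc (degree P). smult (b i) (laguerre (\<nu> + s) (2 * lam) i))"
      using laguerre_spans[OF nus, of "2 * lam" P "Suc (degree P)"] lam by auto
    have P_sum: "(\<lambda>x. exp (- lam * x) *\<^sub>R poly P (complex_of_real x)) = (\<lambda>x. \<Sum>i<Suc (degree P). b i * lagfun (\<nu> + s) lam i x)"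
      by (subst b) (simp only: lagfun_sum)
    have "sq_norm lebesgue (\<lambda>x. weighted (\<nu> + s) G x - (\<Sum>i<Suc (degree P). b i * weighted (\<nu> + s) (lagfun (\<nu> + s) lam i) x)) < \<epsilon>"
      using P unfolding weighted_diff unfolding P_sum weighted_sum weighted_cmult .
    then show "\<exists>n a. sq_norm lebesgue (\<lambda>x. weighted (\<nu> + s) G x - (\<Sum>i<n. a i * weighted (\<nu> + s) (lagfun (\<nu> + s) lam i) x)) < \<epsilon>"
      by blast
  qed
  then show "(wnorm (\<nu> + s) (temp_deriv s lam e))\<^sup>2
      \<le> (2 * lam) powr (s - r) * (Gamma (real N + \<nu> + s + 2) / Gamma (real N + \<nu> + r + 2))
        * (wnorm (\<nu> + r) (temp_deriv r lam u))\<^sup>2"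
    unfolding wL2_ae_eq(2)[OF GD GL] unfolding wnorm_sq_norm R_def K_def by (simp add: sq_norm_nonneg)
qed

theorem theorem4:
  fixes r s \<nu> :: real
  assumes "0 < r" and "0 < \<nu>" and "0 \<le> s" and "s \<le> r"
  shows "\<exists>c :: nat \<Rightarrow> real. c \<longlonglongrightarrow> 1 \<and>
    (\<forall>(lam::real) (N::nat) u. 0 < lam \<longrightarrow> 0 < N \<longrightarrow> r \<le> real N \<longrightarrow> u \<in> temp_space r \<nu> lam \<longrightarrow>
      (let e = (\<lambda>x. temp_proj N \<nu> lam u x - u x) in
        temp_differentiable s lam e \<and>
        temp_deriv s lam e \<in> wL2 (\<nu> + s) \<and>
        wnorm (\<nu> + s) (temp_deriv s lam e)
          \<le> c N * (2 * lam * real N) powr ((s - r) / 2) * wnorm (\<nu> + r) (temp_deriv r lam u)))"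
proof -
  define \<kappa> where "\<kappa> N = Gamma (real N + \<nu> + s + 2) / Gamma (real N + \<nu> + r + 2)" for N :: nat
  \<comment> \<open>\<open>\<kappa>\<close> is the quotient of the Gamma factors at index \<open>N + 1\<close>; \<open>c\<close> compares its square root with
    \<open>N powr ((s - r) / 2)\<close>.\<close>
  define c where "c N = sqrt (real N powr (r - s) * \<kappa> N)" for N :: nat
  have "(\<lambda>N. sqrt (real N powr ((\<nu> + r + 1) - (\<nu> + s + 1)) * (Gamma (real N + (\<nu> + s + 1) + 1) / Gamma (real N + (\<nu> + r + 1) + 1)))) \<longlonglongrightarrow> sqrt 1"
    by (intro tendsto_real_sqrt Gamma_shift_ratio_tendsto) (use assms in auto)
  then have lim: "c \<longlonglongrightarrow> 1" by (simp add: c_def[abs_def] \<kappa>_def add_ac)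
  show ?thesis
  proof (intro exI[of _ c] conjI lim allI impI)
    fix lam :: real and N :: nat and u
    assume lam: "0 < lam" and N: "0 < N" and u: "u \<in> temp_space r \<nu> lam"
    let ?e = "\<lambda>x. temp_proj N \<nu> lam u x - u x"
    note bound = temp_proj_error_bound[OF assms(2-4) lam u, of N]
    have kpos: "\<kappa> N \<ge> 0" unfolding \<kappa>_def using assms
      by (intro divide_nonneg_nonneg less_imp_le[OF Gamma_real_pos]) auto
    have wpos: "wnorm a f \<ge> 0" for a f by (simp add: wnorm_sq_norm sq_norm_nonneg)
    have split: "(2 * lam * real N) powr ((s - r) / 2) = sqrt ((2 * lam) powr (s - r)) * sqrt (real N powr (s - r))"
      using lam N by (simp add: powr_mult powr_half_sqrt_powr real_sqrt_mult)
    have "real N powr (r - s) * real N powr (s - r) = 1" using N by (simp flip: powr_add)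
    then have "c N * (2 * lam * real N) powr ((s - r) / 2) = sqrt ((2 * lam) powr (s - r) * \<kappa> N)"
      unfolding c_def split real_sqrt_mult[symmetric] by (intro arg_cong[where f = sqrt]) (simp add: mult_ac)
    moreover have "wnorm (\<nu> + s) (temp_deriv s lam ?e)
        \<le> sqrt ((2 * lam) powr (s - r) * \<kappa> N) * wnorm (\<nu> + r) (temp_deriv r lam u)"
    proof (rule power2_le_imp_le)
      show "(wnorm (\<nu> + s) (temp_deriv s lam ?e))\<^sup>2 \<le> (sqrt ((2 * lam) powr (s - r) * \<kappa> N) * wnorm (\<nu> + r) (temp_deriv r lam u))\<^sup>2"
        using bound(3) kpos unfolding power_mult_distrib \<kappa>_def[symmetric] by simp
      show "0 \<le> sqrt ((2 * lam) powr (s - r) * \<kappa> N) * wnorm (\<nu> + r) (temp_deriv r lam u)"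
        using kpos wpos by simp
    qed
    ultimately show "let e = ?e in temp_differentiable s lam e \<and> temp_deriv s lam e \<in> wL2 (\<nu> + s) \<and>
        wnorm (\<nu> + s) (temp_deriv s lam e)
          \<le> c N * (2 * lam * real N) powr ((s - r) / 2) * wnorm (\<nu> + r) (temp_deriv r lam u)"
      using bound(1,2) by (simp add: Let_def)
  qed
qed

end
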